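(* Let $p\in(0,1)$ be a constant. Let $X_n$ be the number of Hamiltonian cycles in $G(n,p)$, where the random graphs $G(n,p)$, $n\in\mathbb N$, are all obtained by restricting a single infinite random graph $G(\mathbb N,p)$ to the vertex sets $[n]=\{1,\dots,n\}$, and set $Y_n:=\log X_n$. Then $$\Pr\left[\limsup_{n\to\infty}\frac{Y_n-\log\left(\frac{(n-1)!}{2}p^n\right)+\frac{1-p}{p}}{\sqrt{\frac{2(1-p)}{p}}\,\sqrt{2\log\log n}}=1\right]=1.$$
   Context: $G(\mathbb N,p)$ is the random graph on vertex set $\mathbb N=\{1,2,\dots\}$ in which each 2-element subset of $\mathbb N$ is an edge with probability $p$, independently. $G(n,p)$ is its induced subgraph on $[n]$, so that all $G(n,p)$ live on one probability space. A Hamiltonian cycle is regarded as an (undirected) subgraph, so the complete graph $K_n$ has $(n-1)!/2$ of them. $\log$ is the natural logarithm, with the convention $\log 0=-\infty$. *)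

theory Defs
  imports "HOL-Probability.Probability"
begin

text \<open>A (simple, undirected) graph with a fixed vertex set is given by its edge set, whose
  elements are 2-element sets of vertices. The vertex set of the infinite graph is
  \<open>{1..} :: nat set\<close>.\<close>

definition vertex_pairs :: "nat set set" where
  "vertex_pairs = {e. e \<subseteq> {1..} \<and> card e = 2}"

text \<open>\<open>G\<close> is a random edge set, defined on an arbitrary probability space \<open>M\<close>, with the law of
  \<open>G(\<nat>,p)\<close>. The predicate \<open>indep_events\<close> includes the measurability of the events.\<close>

locale random_graph = prob_space M
  for M :: "'a measure" and p :: real and G :: "'a \<Rightarrow> nat set set" +
  assumes edges_subset: "\<And>\<omega>. \<omega> \<in> space M \<Longrightarrow> G \<omega> \<subseteq> vertex_pairs"
    and edges_indep: "indep_events (\<lambda>e. {\<omega> \<in> space M. e \<in> G \<omega>}) vertex_pairs"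
    and edges_prob: "\<And>e. e \<in> vertex_pairs \<Longrightarrow> prob {\<omega> \<in> space M. e \<in> G \<omega>} = p"

definition induced_edges :: "nat set set \<Rightarrow> nat \<Rightarrow> nat set set" where
  "induced_edges E n = {e \<in> E. e \<subseteq> {1..n}}"

text \<open>The edge set of the closed walk \<open>x\<^sub>0, x\<^sub>1, \<dots>, x\<^sub>k, x\<^sub>0\<close>.\<close>

definition cycle_edges :: "'v list \<Rightarrow> 'v set set" where
  "cycle_edges xs = {{xs ! i, xs ! (Suc i mod length xs)} | i. i < length xs}"

text \<open>A Hamiltonian cycle is identified with its edge set, so that the starting point and the
  orientation of the cycle are forgotten.\<close>

definition hamiltonian_cycles :: "'v set \<Rightarrow> 'v set set \<Rightarrow> 'v set set set" where
  "hamiltonian_cycles V E =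
    {C. C \<subseteq> E \<and> (\<exists>xs. distinct xs \<and> set xs = V \<and> 3 \<le> length xs \<and> C = cycle_edges xs)}"

definition num_ham_cycles :: "nat set set \<Rightarrow> nat \<Rightarrow> nat" where
  "num_ham_cycles E n = card (hamiltonian_cycles {1..n} (induced_edges E n))"

definition ereal_log :: "nat \<Rightarrow> ereal" where
  "ereal_log k = (if k = 0 then - \<infinity> else ereal (ln (real k)))"

text \<open>The canonical model: a random graph on \<open>\<nat>\<close> with edge probability \<open>p\<close> exists.\<close>

lemma random_graph_exists:
  assumes p: "0 \<le> p" "p \<le> 1"
  defines "N \<equiv> (\<lambda>_ :: nat set. measure_pmf (bernoulli_pmf p))"
  shows "random_graph (PiM vertex_pairs N) p (\<lambda>\<omega>. {e \<in> vertex_pairs. \<omega> e})"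
proof -
  interpret N: product_prob_space N vertex_pairs
    unfolding N_def by unfold_locales
  have sp: "space (N e) = UNIV" and st: "sets (N e) = UNIV" for e
    by (auto simp: N_def)
  have one: "measure (N e) {True} = p" for e
    using p by (simp add: N_def measure_pmf_single)
  have cyl: "measure (PiM vertex_pairs N) {\<omega> \<in> space (PiM vertex_pairs N). \<forall>e\<in>J. \<omega> e} = p ^ card J"
    if J: "J \<subseteq> vertex_pairs" "finite J" for J
  proof -
    have "{\<omega> \<in> space (PiM vertex_pairs N). \<forall>e\<in>J. \<omega> e \<in> A e} =
        prod_emb vertex_pairs N J (Pi\<^sub>E J A)" for A
      unfolding prod_emb_def using J st by (auto simp: space_PiM Pi_iff)
    from this[of "\<lambda>_. {True}"]
    have "{\<omega> \<in> space (PiM vertex_pairs N). \<forall>e\<in>J. \<omega> e} =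
        prod_emb vertex_pairs N J (Pi\<^sub>E J (\<lambda>_. {True}))"
      by simp
    also have "measure (PiM vertex_pairs N) \<dots> = (\<Prod>e\<in>J. measure (N e) {True})"
      by (rule N.measure_PiM_emb) (use J st in auto)
    finally show ?thesis by (simp add: one)
  qed
  have ev: "{\<omega> \<in> space (PiM vertex_pairs N). e \<in> {e \<in> vertex_pairs. \<omega> e}} =
      {\<omega> \<in> space (PiM vertex_pairs N). \<omega> e}" if "e \<in> vertex_pairs" for e
    using that by auto
  have pr: "measure (PiM vertex_pairs N) {\<omega> \<in> space (PiM vertex_pairs N). e \<in> {e \<in> vertex_pairs. \<omega> e}} = p"
    if "e \<in> vertex_pairs" for e
    using cyl[of "{e}"] that unfolding ev[OF that] by simp
  show ?thesis
  proof (unfold_locales)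
    show "N.P.indep_events (\<lambda>e. {\<omega> \<in> space (PiM vertex_pairs N). e \<in> {e \<in> vertex_pairs. \<omega> e}})
        vertex_pairs"
    proof (rule N.P.indep_eventsI)
      fix e assume e: "e \<in> vertex_pairs"
      have "(\<lambda>\<omega>. \<omega> e) -` {True} \<inter> space (PiM vertex_pairs N) \<in> sets (PiM vertex_pairs N)"
        by (rule measurable_sets[OF measurable_component_singleton[OF e]]) (simp add: st)
      also have "(\<lambda>\<omega>. \<omega> e) -` {True} \<inter> space (PiM vertex_pairs N) =
          {\<omega> \<in> space (PiM vertex_pairs N). \<omega> e}" by auto
      finally show "{\<omega> \<in> space (PiM vertex_pairs N). e \<in> {e \<in> vertex_pairs. \<omega> e}}
          \<in> sets (PiM vertex_pairs N)" unfolding ev[OF e] .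
    next
      fix J assume J: "J \<subseteq> vertex_pairs" "finite J" "J \<noteq> {}"
      have "(\<Inter>e\<in>J. {\<omega> \<in> space (PiM vertex_pairs N). e \<in> {e \<in> vertex_pairs. \<omega> e}}) =
          {\<omega> \<in> space (PiM vertex_pairs N). \<forall>e\<in>J. \<omega> e}"
        using J by auto
      moreover have "(\<Prod>e\<in>J. measure (PiM vertex_pairs N) {\<omega> \<in> space (PiM vertex_pairs N).
          e \<in> {e \<in> vertex_pairs. \<omega> e}}) = p ^ card J"
        using J(1) pr by (subst prod.cong[OF refl, of _ _ "\<lambda>_. p"]) (auto simp del: mem_Collect_eq)
      ultimately show "measure (PiM vertex_pairs N) (\<Inter>e\<in>J. {\<omega> \<in> space (PiM vertex_pairs N).
          e \<in> {e \<in> vertex_pairs. \<omega> e}}) =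
          (\<Prod>e\<in>J. measure (PiM vertex_pairs N) {\<omega> \<in> space (PiM vertex_pairs N). e \<in> {e \<in> vertex_pairs. \<omega> e}})"
        using cyl[OF J(1,2)] by simp
    qed
  qed (use pr in auto)
qed

end

theory Submission
  imports Defs "HOL-Combinatorics.Multiset_Permutations" "HOL-Real_Asymp.Real_Asymp"
begin

text \<open>The fluctuations of \<open>log X\<^sub>n\<close> come from the number of edges. Let \<open>Z\<^sub>n\<close> be the centred number of edges
  of \<open>G(n,p)\<close>, and let \<open>W\<^sub>n\<close> be \<open>X\<^sub>n / E X\<^sub>n\<close> divided by \<open>exp (c\<^sub>n Z\<^sub>n)\<close> with \<open>c\<^sub>n = 2 / ((n - 1) p)\<close>.
  Writing \<open>k\<close>-th moments of \<open>W\<^sub>n\<close> as averages over \<open>k\<close>-tuples of Hamiltonian cycles and revealing the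
  cycles one at a time, the contribution of the overlaps cancels against that of the exponential factor,
  and \<open>E W\<^sub>n\<^sup>k\<close> is at most \<open>exp (o(1))\<close> for every \<open>k = o(log n)\<close>. Taking \<open>k\<close> of order
  \<open>log n / sqrt (log log n)\<close> gives \<open>W\<^sub>n \<le> exp (\<epsilon> sqrt (log log n))\<close> for all large \<open>n\<close>, with no
  interpolation between different \<open>n\<close>. For the lower bound a subsequence suffices, and along \<open>n = j!\<close>
  the case \<open>k = 2\<close> and Chebyshev's inequality bound \<open>W\<^sub>n\<close> away from \<open>0\<close>. It remains to prove the law of
  the iterated logarithm for \<open>Z\<^sub>n\<close>, again along \<open>n = j!\<close> in the lower bound.\<close>

text \<open>Put \<open>s = (1 - p) / p\<close>. In the logarithm of the \<open>k\<close>-th moment,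
  averaging the exponential factor over all pairs contributes about \<open>s * k^2\<close>, its
  weight on the \<open>k * n\<close> edges that the cycles force contributes
  \<open>- 2 * s * k^2\<close>, and the overlaps contribute \<open>s * k * (k - 1)\<close>. What
  survives is \<open>- s * k\<close>, so W_n is near \<open>exp (- s)\<close>: this is the shift
  \<open>(1 - p) / p\<close> of the theorem. The choice of \<open>k\<close> is squeezed from two
  sides. By Markov, a fixed \<open>k\<close> gives only a tail of order
  \<open>exp (- k * \<epsilon> * sqrt (log log n))\<close>, which is not summable, so
  \<open>k\<close> must reach a multiple of \<open>log n / sqrt (log log n)\<close>. On the other
  side, the chance that a random cycle contains \<open>j\<close> given edges exceeds
  \<open>(2 / (n - 1)) ^ j\<close> by errors that add up to \<open>exp (O(k)) / n\<close>, so
  \<open>k\<close> must stay below a small multiple of \<open>log n\<close>. Chebyshev's bound is of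
  order \<open>1 / n\<close>, summable along factorials. Factorials serve a second purpose: the
  pairs inside \<open>(j - 1)!\<close> are at most a fraction \<open>1 / j^2\<close> of those inside
  \<open>j!\<close>, so the new edges, which are independent of the past, carry almost all the
  variance.\<close>

section \<open>Hamiltonian cycles as cyclic lists\<close>

text \<open>Oriented version of \<open>cycle_edges\<close>. Orientation is what allows counting: an
  arc together with the position of its tail determines the next entry of the list, which an
  undirected edge does not.\<close>

definition arcs :: "'v list \<Rightarrow> ('v \<times> 'v) set" where
  "arcs xs = set (zip xs (rotate1 xs))"

definition edge :: "'v \<times> 'v \<Rightarrow> 'v set" where
  "edge d = {fst d, snd d}"

lemma arcs_conv_nth: "arcs xs = {(xs ! i, xs ! (Suc i mod length xs)) | i. i < length xs}"
  unfolding arcs_def set_zip by (auto simp: nth_rotate1)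

lemma cycle_edges_conv_arcs: "cycle_edges xs = edge ` arcs xs"
  unfolding cycle_edges_def arcs_conv_nth edge_def by force

lemma cycle_edgesI: "i < length xs \<Longrightarrow> {xs ! i, xs ! (Suc i mod length xs)} \<in> cycle_edges xs"
  unfolding cycle_edges_def by (rule CollectI, rule exI[of _ i]) simp

lemma cycle_edgesE:
  assumes "e \<in> cycle_edges xs"
  obtains i where "i < length xs" "e = {xs ! i, xs ! (Suc i mod length xs)}"
  using assms unfolding cycle_edges_def mem_Collect_eq by (elim exE conjE)

lemma zip_rotate1:
  assumes "length xs = length ys"
  shows "zip (rotate1 xs) (rotate1 ys) = rotate1 (zip xs ys)"
  using assms by (cases xs; cases ys) auto

lemma arcs_rotate1: "arcs (rotate1 xs) = arcs xs"
  unfolding arcs_def by (simp add: zip_rotate1)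

lemma arcs_rotate: "arcs (rotate i xs) = arcs xs"
  by (induction i) (simp_all add: arcs_rotate1)

lemma cycle_edges_rotate: "cycle_edges (rotate i xs) = cycle_edges xs"
  by (simp add: cycle_edges_conv_arcs arcs_rotate)

lemma arcs_same_tail: "\<lbrakk>distinct xs; (a, b) \<in> arcs xs; (a, c) \<in> arcs xs\<rbrakk> \<Longrightarrow> b = c"
  unfolding arcs_conv_nth by (auto simp: nth_eq_iff_index_eq)

lemma arcs_same_head: "\<lbrakk>distinct xs; (a, c) \<in> arcs xs; (b, c) \<in> arcs xs\<rbrakk> \<Longrightarrow> a = b"
  unfolding arcs_def by (metis distinct1_rotate in_set_zip nth_eq_iff_index_eq
      length_rotate1 prod.sel)

lemma arcs_subset: "arcs xs \<subseteq> set xs \<times> set xs"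
  unfolding arcs_def by (auto dest: set_zip_leftD set_zip_rightD)

lemma arcs_adjacent: "(a, b) \<in> arcs (us @ a # b # vs)"
proof -
  have "(a, b) = ((us @ a # b # vs) ! length us,
      (us @ a # b # vs) ! (Suc (length us) mod length (us @ a # b # vs)))"
    by (simp add: nth_append)
  then show ?thesis unfolding arcs_conv_nth by (intro CollectI exI[of _ "length us"]) simp
qed

lemma finite_arcs [simp]: "finite (arcs xs)"
  by (simp add: arcs_def)

lemma finite_cycle_edges [simp]: "finite (cycle_edges xs)"
  by (simp add: cycle_edges_conv_arcs)

lemma card_arcs: "distinct xs \<Longrightarrow> card (arcs xs) = length xs"
  unfolding arcs_def by (simp add: distinct_card distinct_zipI1)

text \<open>A cyclic list of length 2 has two mutually reverse arcs, one of length 1 has a loop.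
  Excluding both makes \<open>edge\<close> injective on the arcs.\<close>

lemma arcs_length_ge_3:
  assumes "distinct xs" "3 \<le> length xs" "(a, b) \<in> arcs xs"
  shows "a \<noteq> b" "(b, a) \<notin> arcs xs"
proof -
  obtain i where i: "i < length xs" "a = xs ! i" "b = xs ! (Suc i mod length xs)"
    using assms(3) by (auto simp: arcs_conv_nth)
  have ne: "Suc i mod length xs \<noteq> i"
    using i(1) assms(2) by (cases "Suc i = length xs") auto
  have lt: "Suc i mod length xs < length xs" using assms(2) by (intro mod_less_divisor) auto
  show "a \<noteq> b" using i ne lt assms(1) by (simp add: nth_eq_iff_index_eq)
  show "(b, a) \<notin> arcs xs"
  proof
    assume "(b, a) \<in> arcs xs"
    then obtain j where j: "j < length xs" "b = xs ! j" "a = xs ! (Suc j mod length xs)"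
      by (auto simp: arcs_conv_nth)
    have lt': "Suc j mod length xs < length xs" using assms(2) by (intro mod_less_divisor) auto
    have e1: "j = Suc i mod length xs" using i j lt assms(1) by (metis nth_eq_iff_index_eq)
    have e2: "i = Suc j mod length xs" using i j lt' assms(1) by (metis nth_eq_iff_index_eq)
    have "Suc i = length xs \<and> j = 0 \<or> j = Suc i"
      unfolding e1 using i(1) by (simp add: mod_Suc)
    moreover have "Suc j = length xs \<and> i = 0 \<or> i = Suc j"
      unfolding e2 using j(1) by (simp add: mod_Suc)
    ultimately show False using assms(2) by linarith
  qed
qed

lemma edge_eq_iff: "edge d = edge d' \<longleftrightarrow> d = d' \<or> d = prod.swap d'"
  by (cases d; cases d') (auto simp: edge_def doubleton_eq_iff)

lemma card_cycle_edges:
  assumes "distinct xs" "3 \<le> length xs"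
  shows "card (cycle_edges xs) = length xs"
proof -
  have "inj_on edge (arcs xs)"
    using arcs_length_ge_3[OF assms] by (auto simp: inj_on_def edge_eq_iff)
  then show ?thesis
    by (simp add: cycle_edges_conv_arcs card_image card_arcs assms)
qed

lemma cycle_edges_pairs:
  assumes "distinct xs" "3 \<le> length xs" "e \<in> cycle_edges xs"
  shows "e \<subseteq> set xs" "card e = 2"
proof -
  obtain d where d: "d \<in> arcs xs" "e = edge d"
    using assms(3) unfolding cycle_edges_conv_arcs by (rule imageE)
  obtain a b where ab: "d = (a, b)" by (cases d)
  show "e \<subseteq> set xs" using d arcs_subset[of xs] by (auto simp: edge_def ab)
  show "card e = 2" using d arcs_length_ge_3(1)[OF assms(1,2)] by (simp add: edge_def ab)
qed

text \<open>A head of an arc in \<open>D\<close> is forced by its predecessor, so the vertices that are not heads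
  determine the whole list.\<close>

lemma eq_if_filter_eq:
  assumes xs: "distinct xs" "D \<subseteq> arcs xs" and ys: "distinct ys" "D \<subseteq> arcs ys"
    and set: "set xs = set ys" and hd: "hd xs = hd ys" "hd xs \<notin> H"
    and H: "H \<subseteq> snd ` D"
    and filter: "filter (\<lambda>x. x \<notin> H) xs = filter (\<lambda>x. x \<notin> H) ys"
  shows "xs = ys"
proof (rule ccontr)
  assume "xs \<noteq> ys"
  moreover have len: "length xs = length ys" using distinct_card[OF xs(1)] distinct_card[OF ys(1)] set by simp
  ultimately have "\<exists>pre x xs' y ys'. x \<noteq> y \<and> xs = pre @ [x] @ xs' \<and> ys = pre @ [y] @ ys'"
    by (rule same_length_different)
  then obtain pre x xs' y ys'
    where *: "x \<noteq> y" "xs = pre @ [x] @ xs'" "ys = pre @ [y] @ ys'"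
    by blast
  \<comment> \<open>At the first position where the lists differ, both entries have the same
    predecessor \<open>a\<close>, which exists because the heads agree.\<close>
  have "pre \<noteq> []" using * hd by (cases pre) auto
  then obtain us a where pre: "pre = us @ [a]" by (metis rev_exhaust)
  have ax: "(a, x) \<in> arcs xs" and ay: "(a, y) \<in> arcs ys"
    using * pre arcs_adjacent[of a x us xs'] arcs_adjacent[of a y us ys'] by simp_all
  \<comment> \<open>If \<open>x\<close> or \<open>y\<close> were the head of an arc of
    \<open>D\<close>, that arc would lie in both lists. Its tail must be \<open>a\<close>, so both
    lists would continue \<open>a\<close> in the same way.\<close>
  have nH: "x \<notin> H \<and> y \<notin> H"
  proof (rule ccontr)
    assume "\<not> ?thesis"
    then obtain a' b where "(a', b) \<in> D" "b = x \<or> b = y" using H by auto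
    moreover from this have "(a', b) \<in> arcs xs" "(a', b) \<in> arcs ys" using xs ys by auto
    ultimately have "(a, x) \<in> arcs ys \<or> (a, y) \<in> arcs xs"
      using ax ay arcs_same_head xs(1) ys(1) by metis
    then show False using ax ay arcs_same_tail xs(1) ys(1) *(1) by metis
  qed
  then show False using filter * by simp
qed

section \<open>Counting vertex orders that contain prescribed arcs or edges\<close>

lemma card_permutations_hd:
  assumes "finite V" "v \<in> V"
  shows "card {xs \<in> permutations_of_set V. hd xs = v} = fact (card V - 1)"
proof -
  have "{xs \<in> permutations_of_set V. hd xs = v} = (#) v ` permutations_of_set (V - {v})"
    using assms by (subst permutations_of_set_nonempty) auto
  then show ?thesis using assms by (simp add: card_image)
qed

text \<open>Deleting the entries in \<open>H\<close> is injective on these lists by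
  \<open>eq_if_filter_eq\<close> and leaves an order of \<open>V - H\<close> that starts in
  \<open>v\<close>. \<open>H\<close> may be smaller than the set of all heads because the anchor
  \<open>v\<close> must remain outside it.\<close>

lemma card_permutations_arcs_hd:
  assumes V: "finite V" "v \<in> V" and H: "H \<subseteq> snd ` D" "v \<notin> H"
  shows "card {xs \<in> permutations_of_set V. D \<subseteq> arcs xs \<and> hd xs = v} \<le> fact (card V - 1 - card H)"
    (is "card ?L \<le> _")
proof (cases "H \<subseteq> V")
  case False
  have "H \<subseteq> V" if "xs \<in> ?L" for xs
  proof -
    have "H \<subseteq> snd ` D" by (rule H)
    also have "\<dots> \<subseteq> snd ` arcs xs" using that by (intro image_mono) simp
    also have "\<dots> \<subseteq> set xs" using arcs_subset[of xs] by auto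
    also have "set xs = V" using that by (simp add: permutations_of_set_def)
    finally show ?thesis .
  qed
  then have "?L = {}" using False by blast
  then show ?thesis by (simp only: card.empty)
next
  case True
  let ?f = "filter (\<lambda>x. x \<notin> H)"
  have ne: "xs \<noteq> []" if "xs \<in> ?L" for xs using that V by (auto simp: permutations_of_set_def)
  have hdf: "hd (?f xs) = v" if "xs \<in> ?L" for xs
    using that ne[OF that] H by (cases xs) auto
  have "inj_on ?f ?L"
  proof (rule inj_onI)
    fix xs ys assume "xs \<in> ?L" "ys \<in> ?L" "?f xs = ?f ys"
    moreover from this have "set xs = V" "set ys = V" "distinct xs" "distinct ys"
      by (simp_all add: permutations_of_set_def)
    ultimately show "xs = ys"
      using H V by (intro eq_if_filter_eq[of xs D ys H]) auto
  qed
  moreover have "?f ` ?L \<subseteq> {xs \<in> permutations_of_set (V - H). hd xs = v}"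
    using hdf by (auto simp: permutations_of_set_def)
  ultimately have "card ?L \<le> card {xs \<in> permutations_of_set (V - H). hd xs = v}"
    by (intro card_inj_on_le[of ?f]) auto
  also have "\<dots> = fact (card (V - H) - 1)" using V H by (intro card_permutations_hd) auto
  also have "card (V - H) = card V - card H"
    using V True by (simp add: card_Diff_subset finite_subset)
  finally show ?thesis by (simp add: algebra_simps)
qed

text \<open>Every list is a rotation of one starting in a fixed \<open>v\<close>; the
  \<open>card V\<close> rotations give the first factor.\<close>

lemma card_permutations_arcs:
  assumes V: "finite V" "V \<noteq> {}" and D: "finite D"
  shows "card {xs \<in> permutations_of_set V. D \<subseteq> arcs xs} \<le> card V * fact (card V - 1 - card D)"
    (is "card ?L \<le> _")
proof (cases "?L = {}")
  case False
  then obtain zs where zs: "distinct zs" "set zs = V" "D \<subseteq> arcs zs"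
    by (auto simp: permutations_of_set_def)
  have "inj_on snd D"
    using zs(3) arcs_same_head[OF zs(1)] by (intro inj_onI) (metis prod.collapse subsetD)
  then have cD: "card (snd ` D) = card D" by (rule card_image)
  have sub: "snd ` D \<subseteq> V" using zs arcs_subset[of zs] by auto
  \<comment> \<open>If \<open>D\<close> is a whole cycle, every vertex is a head and one of them is
    given up as anchor. Then \<open>card D = card V\<close>, and truncated subtraction makes both
    factorials 1.\<close>
  obtain v H where v: "v \<in> V" "v \<notin> H" "H \<subseteq> snd ` D" "fact (card V - 1 - card H) \<le> (fact (card V - 1 - card D) :: nat)"
  proof (cases "snd ` D = V")
    case True
    obtain v where "v \<in> V" using V by auto
    moreover have "card (V - {v}) = card V - 1" using \<open>v \<in> V\<close> V by simp
    ultimately show ?thesis using that[of v "V - {v}"] True cD by auto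
  next
    case False
    then obtain v where "v \<in> V" "v \<notin> snd ` D" using sub by auto
    then show ?thesis using that[of v "snd ` D"] cD by auto
  qed
  let ?Lv = "{xs \<in> permutations_of_set V. D \<subseteq> arcs xs \<and> hd xs = v}"
  have "?L \<subseteq> (\<Union>i<card V. rotate i ` ?Lv)"
  proof
    fix xs assume xs: "xs \<in> ?L"
    then have len: "length xs = card V" by (simp add: length_finite_permutations_of_set)
    obtain i where i: "i < card V" "xs ! i = v"
      using v xs len by (auto simp: permutations_of_set_def in_set_conv_nth)
    have "hd (rotate i xs) = v" using i len V by (subst hd_rotate_conv_nth) (auto simp: card_gt_0_iff)
    then have "rotate i xs \<in> ?Lv" using xs
      by (auto simp: permutations_of_set_def arcs_rotate)
    \<comment> \<open>The rotation inverse to \<open>rotate i\<close>, kept below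
      \<open>card V\<close> for the range of the union.\<close>
    moreover define j where "j = (if i = 0 then 0 else card V - i)"
    moreover have "j < card V" using i by (auto simp: j_def)
    moreover have "rotate j (rotate i xs) = xs"
      using i len by (auto simp: j_def rotate_rotate)
    ultimately show "xs \<in> (\<Union>i<card V. rotate i ` ?Lv)" by (intro UN_I[of j] image_eqI[of _ _ "rotate i xs"]) auto
  qed
  then have "card ?L \<le> card (\<Union>i<card V. rotate i ` ?Lv)" by (intro card_mono) auto
  also have "\<dots> \<le> (\<Sum>i<card V. card (rotate i ` ?Lv))" by (intro card_UN_le) auto
  also have "\<dots> \<le> (\<Sum>i<card V. card ?Lv)" by (intro sum_mono card_image_le) auto
  also have "\<dots> \<le> card V * fact (card V - 1 - card D)"
    using card_permutations_arcs_hd[of V v H D] v V by simp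
  finally show ?thesis .
next
  case True
  show ?thesis unfolding True by simp
qed

lemma card_orientations: "card e = 2 \<Longrightarrow> card {d. edge d = e} = 2"
proof -
  assume "card e = 2"
  then obtain a b where e: "e = {a, b}" "a \<noteq> b" by (auto simp: card_2_iff)
  then have "{d. edge d = e} = {(a, b), (b, a)}" by (auto simp: edge_def doubleton_eq_iff)
  then show ?thesis using e by simp
qed

text \<open>Each edge of \<open>S\<close> is traversed in one of two directions, so the lists are
  covered by the \<open>2 ^ card S\<close> orientations of \<open>S\<close>, to each of which the
  count for arcs applies. Relative to \<open>fact (card V)\<close> the bound is about
  \<open>(2 / (card V - 1)) ^ card S\<close>.\<close>

lemma card_permutations_cycle_edges:
  assumes V: "finite V" "V \<noteq> {}" and S: "finite S" "\<And>e. e \<in> S \<Longrightarrow> card e = 2"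
  shows "card {xs \<in> permutations_of_set V. S \<subseteq> cycle_edges xs}
    \<le> card V * 2 ^ card S * fact (card V - 1 - card S)"
proof -
  define Os where "Os = PiE S (\<lambda>e. {d. edge d = e})"
  have finOs: "finite Os" unfolding Os_def
    by (intro finite_PiE S card_ge_0_finite) (simp add: card_orientations S)
  have cardOs: "card Os = 2 ^ card S"
    unfolding Os_def using S by (simp add: card_PiE card_orientations)
  have card_im: "card (d ` S) = card S" if "d \<in> Os" for d
    using that by (intro card_image inj_on_inverseI[of _ edge]) (auto simp: Os_def PiE_iff)
  have "{xs \<in> permutations_of_set V. S \<subseteq> cycle_edges xs} \<subseteq>
      (\<Union>d\<in>Os. {xs \<in> permutations_of_set V. d ` S \<subseteq> arcs xs})"
  proof
    fix xs assume xs: "xs \<in> {xs \<in> permutations_of_set V. S \<subseteq> cycle_edges xs}"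
    then have "\<forall>e\<in>S. \<exists>d. edge d = e \<and> d \<in> arcs xs"
      unfolding cycle_edges_conv_arcs by blast
    then obtain d where d: "\<And>e. e \<in> S \<Longrightarrow> edge (d e) = e \<and> d e \<in> arcs xs" by metis
    have "restrict d S \<in> Os" using d by (auto simp: Os_def)
    moreover have "restrict d S ` S \<subseteq> arcs xs" using d by auto
    ultimately show "xs \<in> (\<Union>d\<in>Os. {xs \<in> permutations_of_set V. d ` S \<subseteq> arcs xs})" using xs by blast
  qed
  then have "card {xs \<in> permutations_of_set V. S \<subseteq> cycle_edges xs} \<le>
      card (\<Union>d\<in>Os. {xs \<in> permutations_of_set V. d ` S \<subseteq> arcs xs})"
    using finOs by (intro card_mono) auto
  also have "\<dots> \<le> (\<Sum>d\<in>Os. card {xs \<in> permutations_of_set V. d ` S \<subseteq> arcs xs})"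
    by (intro card_UN_le finOs)
  also have "\<dots> \<le> (\<Sum>d\<in>Os. card V * fact (card V - 1 - card S))"
  proof (rule sum_mono)
    fix d assume "d \<in> Os"
    then show "card {xs \<in> permutations_of_set V. d ` S \<subseteq> arcs xs} \<le> card V * fact (card V - 1 - card S)"
      using card_permutations_arcs[of V "d ` S"] V S card_im by simp
  qed
  finally show ?thesis by (simp add: cardOs mult_ac)
qed

section \<open>From vertex orders back to undirected cycles\<close>

lemma cycle_list_eq:
  assumes xs: "distinct xs" "length xs = L" and ys: "distinct ys" "length ys = L" and L: "3 \<le> L"
    and C: "cycle_edges xs = cycle_edges ys" and start: "xs ! 0 = ys ! 0" "xs ! 1 = ys ! 1"
  shows "xs = ys"
proof -
  have "xs ! i = ys ! i \<and> xs ! Suc i = ys ! Suc i" if "Suc i < L" for i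
    using that
  proof (induction i)
    case 0
    then show ?case using start by simp
  next
    case (Suc i)
    then have IH: "xs ! i = ys ! i" "xs ! Suc i = ys ! Suc i" by auto
    have "{ys ! Suc i, ys ! (Suc (Suc i) mod L)} \<in> cycle_edges ys"
      using cycle_edgesI[of "Suc i" ys] Suc.prems ys(2) by simp
    then have "{ys ! Suc i, ys ! Suc (Suc i)} \<in> cycle_edges xs"
      using Suc.prems C by simp
    then obtain j where j: "j < L" "{ys ! Suc i, ys ! Suc (Suc i)} = {xs ! j, xs ! (Suc j mod L)}"
      using xs(2) by (elim cycle_edgesE) simp
    then consider "ys ! Suc i = xs ! j" "ys ! Suc (Suc i) = xs ! (Suc j mod L)"
      | "ys ! Suc i = xs ! (Suc j mod L)" "ys ! Suc (Suc i) = xs ! j"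
      by (auto simp: doubleton_eq_iff)
    then show ?case
    proof cases
      case 1
      then have "j = Suc i" using IH(2) j(1) Suc.prems xs by (simp add: nth_eq_iff_index_eq)
      then show ?thesis using 1 IH(2) Suc.prems by simp
    next
      \<comment> \<open>Traversing the edge backwards would mean that the list \<open>ys\<close>
        returns to the vertex it has just left, against distinctness.\<close>
      case 2
      have "Suc j mod L < L" using L by (intro mod_less_divisor) simp
      then have "Suc i = Suc j mod L" using 2 IH(2) Suc.prems xs by (simp add: nth_eq_iff_index_eq)
      then have "j = i" using j(1) by (cases "Suc j = L") auto
      then have "ys ! Suc (Suc i) = ys ! i" using 2 IH(1) by simp
      then show ?thesis using ys Suc.prems by (simp add: nth_eq_iff_index_eq)
    qed
  qed
  note * = this
  show ?thesis
  proof (rule nth_equalityI)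
    fix i assume "i < length xs"
    then show "xs ! i = ys ! i" using *[of i] *[of "i - 1"] L xs by (cases "Suc i < L") auto
  qed (use xs ys in simp)
qed

text \<open>The rotations of \<open>zs\<close> give the lower bound. For the upper bound, a list is
  determined by its first two entries, and these form an arc of \<open>zs\<close> in one of the two
  directions. The factor 2 between the bounds reappears as \<open>ln 2\<close> in
  \<open>ln_num_ham_cycles\<close>.\<close>

lemma card_lists_of_cycle:
  assumes zs: "distinct zs" "set zs = V" "3 \<le> length zs"
  defines "R \<equiv> {xs \<in> permutations_of_set V. cycle_edges xs = cycle_edges zs}"
  shows "card V \<le> card R" "card R \<le> 2 * card V"
proof -
  have len: "length zs = card V" using zs distinct_card[of zs] by simp
  have fin: "finite R" by (simp add: R_def)
  have "inj_on (\<lambda>i. rotate i zs) {..<length zs}"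
  proof (rule inj_onI)
    fix i j assume ij: "i \<in> {..<length zs}" "j \<in> {..<length zs}" "rotate i zs = rotate j zs"
    moreover have "zs \<noteq> []" using zs(3) by auto
    ultimately have "zs ! (i mod length zs) = zs ! (j mod length zs)" by (metis hd_rotate_conv_nth)
    then show "i = j" using ij zs by (simp add: nth_eq_iff_index_eq)
  qed
  moreover have "(\<lambda>i. rotate i zs) ` {..<length zs} \<subseteq> R"
    using zs by (auto simp: R_def permutations_of_set_def cycle_edges_rotate)
  ultimately have "card {..<length zs} \<le> card R" by (intro card_inj_on_le fin)
  then show "card V \<le> card R" using len by simp
  let ?f = "\<lambda>xs. (xs ! 0, xs ! 1)"
  have R: "distinct xs" "length xs = length zs" "cycle_edges xs = cycle_edges zs" if "xs \<in> R" for xs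
    using that len by (auto simp: R_def permutations_of_set_def distinct_card)
  have "inj_on ?f R"
  proof (rule inj_onI)
    fix xs ys assume "xs \<in> R" "ys \<in> R" "?f xs = ?f ys"
    then show "xs = ys" using R[of xs] R[of ys] zs(3)
      by (intro cycle_list_eq[of xs "length zs" ys]) auto
  qed
  moreover have "?f ` R \<subseteq> arcs zs \<union> prod.swap ` arcs zs"
  proof
    fix d assume "d \<in> ?f ` R"
    then obtain xs where xs: "xs \<in> R" "d = ?f xs" by blast
    have "edge d = {xs ! 0, xs ! (Suc 0 mod length xs)}"
      using xs R[OF xs(1)] zs(3) by (simp add: edge_def)
    moreover have "0 < length xs" using R[OF xs(1)] zs(3) by linarith
    ultimately have "edge d \<in> cycle_edges xs" using cycle_edgesI[of 0 xs] by simp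
    then have "edge d \<in> edge ` arcs zs" using R[OF xs(1)] by (simp add: cycle_edges_conv_arcs)
    then obtain d' where "d' \<in> arcs zs" "d = d' \<or> d = prod.swap d'"
      unfolding image_iff edge_eq_iff by blast
    then show "d \<in> arcs zs \<union> prod.swap ` arcs zs" by blast
  qed
  ultimately have "card R \<le> card (arcs zs \<union> prod.swap ` arcs zs)"
    by (intro card_inj_on_le) auto
  also have "\<dots> \<le> card (arcs zs) + card (prod.swap ` arcs zs)" by (rule card_Un_le)
  also have "\<dots> \<le> card (arcs zs) + card (arcs zs)" by (intro add_left_mono card_image_le) simp
  also have "\<dots> = 2 * card V" using card_arcs[OF zs(1)] len by simp
  finally show "card R \<le> 2 * card V" .
qed

text \<open>Hamiltonian cycles counted with a starting point and a direction, so that a uniformly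
  random cycle becomes a uniformly random permutation of \<open>{1..n}\<close>.\<close>

definition ham_lists :: "nat set set \<Rightarrow> nat \<Rightarrow> nat list set" where
  "ham_lists E n = {xs \<in> permutations_of_set {1..n}. cycle_edges xs \<subseteq> E}"

lemma card_ham_lists:
  assumes n: "3 \<le> n"
  shows "n * num_ham_cycles E n \<le> card (ham_lists E n)"
    and "card (ham_lists E n) \<le> 2 * n * num_ham_cycles E n"
proof -
  define HC where "HC = hamiltonian_cycles {1..n} (induced_edges E n)"
  define R where "R C = {xs \<in> permutations_of_set {1..n}. cycle_edges xs = C}" for C
  have len: "length xs = n" if "distinct xs" "set xs = {1..n}" for xs
    using distinct_card[of xs] that by simp
  have HC: "HC = cycle_edges ` ham_lists E n"
  proof (intro equalityI subsetI)
    fix C assume "C \<in> HC"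
    then show "C \<in> cycle_edges ` ham_lists E n"
      by (auto simp: HC_def hamiltonian_cycles_def induced_edges_def ham_lists_def permutations_of_set_def)
  next
    fix C assume "C \<in> cycle_edges ` ham_lists E n"
    then obtain xs where xs: "C = cycle_edges xs" "distinct xs" "set xs = {1..n}" "C \<subseteq> E"
      by (auto simp: ham_lists_def permutations_of_set_def)
    moreover have "3 \<le> length xs" using len xs n by simp
    moreover from this have "e \<subseteq> {1..n}" if "e \<in> C" for e
      using that cycle_edges_pairs(1)[of xs e] xs by simp
    ultimately show "C \<in> HC"
      unfolding HC_def hamiltonian_cycles_def induced_edges_def by blast
  qed
  have fin: "finite (ham_lists E n)" by (simp add: ham_lists_def)
  have R: "n \<le> card (R C)" "card (R C) \<le> 2 * n" if C: "C \<in> HC" for C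
  proof -
    obtain zs where zs: "zs \<in> ham_lists E n" "C = cycle_edges zs"
      using C unfolding HC by (rule imageE)
    then have "distinct zs" "set zs = {1..n}"
      by (simp_all add: ham_lists_def permutations_of_set_def)
    with zs(2) show "n \<le> card (R C)" "card (R C) \<le> 2 * n"
      using card_lists_of_cycle[of zs "{1..n}"] len[of zs] n by (simp_all add: R_def)
  qed
  have "ham_lists E n = (\<Union>C\<in>HC. R C)"
    by (auto simp: HC R_def ham_lists_def)
  also have "card \<dots> = (\<Sum>C\<in>HC. card (R C))"
    using fin by (intro card_UN_disjoint) (auto simp: HC R_def)
  finally have eq: "card (ham_lists E n) = (\<Sum>C\<in>HC. card (R C))" .
  have "n * card HC = (\<Sum>C\<in>HC. n)" by simp
  also have "\<dots> \<le> card (ham_lists E n)" unfolding eq by (intro sum_mono R)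
  finally show "n * num_ham_cycles E n \<le> card (ham_lists E n)"
    by (simp add: num_ham_cycles_def HC_def)
  have "card (ham_lists E n) \<le> (\<Sum>C\<in>HC. 2 * n)" unfolding eq by (intro sum_mono R)
  then show "card (ham_lists E n) \<le> 2 * n * num_ham_cycles E n"
    by (simp add: num_ham_cycles_def HC_def mult_ac)
qed

section \<open>Overlaps of random Hamiltonian cycles\<close>

lemma sum_le_exp:
  fixes x :: real
  assumes "0 \<le> x" "finite A"
  shows "(\<Sum>j\<in>A. x ^ j / fact j) \<le> exp x"
proof -
  have *: "(\<lambda>n. x ^ n / fact n) sums exp x"
    using exp_converges[of x] by (simp add: divide_inverse mult.commute)
  then show ?thesis
    using sum_le_suminf[OF sums_summable[OF *] assms(2)] assms(1) by (simp add: sums_iff)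
qed

lemma power_le_fact_exp: "real j ^ j \<le> fact j * exp (real j)"
  using sum_le_exp[of "real j" "{j}"] by (simp add: field_simps)

lemma sq_le_2exp: "(real j)\<^sup>2 \<le> 2 * exp (real j)"
  using sum_le_exp[of "real j" "{2}"] by (simp add: field_simps)

text \<open>The ratio below is the factor by which the chance that a random Hamiltonian cycle contains
  given \<open>j\<close> edges exceeds \<open>(2 / m) ^ j\<close> at most, where \<open>m = n - 1\<close>; for \<open>j = n\<close> the truncated
  subtraction gives \<open>fact (m - j) = 1\<close>.\<close>

lemma falling_ratio_bound:
  assumes m: "0 < m" and j: "j \<le> Suc m"
  shows "real m ^ j * fact (m - j) / fact m \<le> 1 + 2 / real m * exp (2 * real j)"
proof -
  define \<rho> where "\<rho> i = real m ^ i * fact (m - i) / fact m" for i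
  have pos: "0 < \<rho> i" for i using m by (simp add: \<rho>_def)
  \<comment> \<open>Crude bound for all \<open>i\<close>, to be combined with a sharper one that is
    useful when \<open>i^2\<close> is small against \<open>m\<close>.\<close>
  have exp: "\<rho> i \<le> exp (real i)" if i: "i \<le> m" for i
  proof (cases "i = 0")
    case False
    have "(real m / real i) ^ i \<le> real (m choose i)"
      using i by (rule binomial_ge_n_over_k_pow_k)
    also have "\<dots> = fact m / (fact i * fact (m - i))" using i by (simp add: binomial_fact)
    finally have "real m ^ i * fact (m - i) / fact m \<le> real i ^ i / fact i"
      using False by (simp add: power_divide field_simps)
    also have "\<dots> \<le> exp (real i)" using power_le_fact_exp[of i] by (simp add: field_simps)
    finally show ?thesis by (simp add: \<rho>_def)
  qed (simp add: \<rho>_def)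
  \<comment> \<open>The reciprocal is the product of \<open>1 - l / m\<close> over
    \<open>l < i\<close>, and the sum of these \<open>l / m\<close> is at most
    \<open>i^2 / m\<close>.\<close>
  have inv: "1 - (real i)\<^sup>2 / real m \<le> 1 / \<rho> i" if "i \<le> m" for i
    using that
  proof (induction i)
    case (Suc i)
    have "\<rho> (Suc i) * (1 - real i / real m) = \<rho> i"
      using Suc.prems m by (simp add: \<rho>_def field_simps Suc_diff_le fact_reduce[of "m - i"] of_nat_diff)
    then have eq: "1 / \<rho> (Suc i) = (1 / \<rho> i) * (1 - real i / real m)"
      using pos[of i] pos[of "Suc i"] by (auto simp: field_simps)
    have "1 - (real (Suc i))\<^sup>2 / real m \<le> (1 - (real i)\<^sup>2 / real m) * (1 - real i / real m)"
    proof -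
      have "(real i)\<^sup>2 / real m + real i / real m \<le> (real (Suc i))\<^sup>2 / real m"
        unfolding add_divide_distrib[symmetric]
        by (intro divide_right_mono) (auto simp: power2_eq_square algebra_simps)
      moreover have "0 \<le> (real i)\<^sup>2 / real m * (real i / real m)" by simp
      moreover have eq: "(1 - u) * (1 - v) = 1 - (u + v) + u * v" for u v :: real by algebra
      ultimately show ?thesis unfolding eq by linarith
    qed
    also have "\<dots> \<le> (1 / \<rho> i) * (1 - real i / real m)"
      using Suc m by (intro mult_right_mono) auto
    finally show ?case unfolding eq .
  qed (simp add: \<rho>_def)
  have "\<rho> j \<le> 1 + 2 / real m * exp (2 * real j)"
  proof (cases "j \<le> m")
    case True
    have "\<rho> j - 1 = \<rho> j * (1 - 1 / \<rho> j)" using pos[of j] by (simp add: field_simps)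
    also have "\<dots> \<le> \<rho> j * ((real j)\<^sup>2 / real m)"
      using inv[OF True] pos[of j] by (intro mult_left_mono) auto
    also have "\<dots> \<le> exp (real j) * (2 * exp (real j) / real m)"
      using exp[OF True] pos[of j] sq_le_2exp[of j] by (intro mult_mono divide_right_mono) auto
    also have "\<dots> = 2 / real m * exp (2 * real j)" by (simp flip: exp_add)
    finally show ?thesis by simp
  next
    \<comment> \<open>The case of all \<open>m + 1\<close> edges of a cycle: \<open>m - j\<close>
      truncates to 0, just as \<open>m - m\<close> does, so the ratio is \<open>m\<close> times the
      one for \<open>m\<close> edges.\<close>
    case False
    then have j': "j = Suc m" using j by simp
    have "\<rho> j = real m * \<rho> m" by (simp add: \<rho>_def j')
    also have "\<dots> \<le> real m * exp (real m)" using exp[of m] by (intro mult_left_mono) auto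
    also have "\<dots> = 1 / real m * ((real m)\<^sup>2 * exp (real m))"
      using m by (simp add: power2_eq_square)
    also have "\<dots> \<le> 1 / real m * (2 * exp (real m) * exp (real m))"
      by (intro mult_left_mono mult_right_mono sq_le_2exp) auto
    also have "\<dots> = 2 / real m * exp (2 * real m)" by (simp flip: exp_add)
    also have "\<dots> \<le> 1 + 2 / real m * exp (2 * real j)"
      by (intro add_increasing mult_left_mono) (auto simp: j')
    finally show ?thesis .
  qed
  then show ?thesis by (simp add: \<rho>_def)
qed

text \<open>With all ratios equal to 1 the sum would be at most \<open>exp y\<close>. The error term
  of \<open>falling_ratio_bound\<close> carries \<open>exp (2 * j)\<close>, which multiplies
  \<open>y\<close> by \<open>exp 2\<close>; the 8 in the exponent is a bound for
  \<open>exp 2\<close>.\<close>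

lemma weighted_ratio_sum:
  fixes y :: real
  assumes "0 \<le> y" "0 < m"
  shows "(\<Sum>j\<le>Suc m. y ^ j / fact j * (real m ^ j * fact (m - j) / fact m))
    \<le> exp (y + 2 / real m * exp (8 * y))"
proof -
  have e2: "exp (2::real) \<le> 8"
  proof -
    have "exp (2::real) = exp 1 * exp 1" by (simp flip: exp_add)
    also have "\<dots> \<le> 2.8 * 2.8" using e_less_272 by (intro mult_mono) auto
    finally show ?thesis by simp
  qed
  have "(\<Sum>j\<le>Suc m. y ^ j / fact j * (real m ^ j * fact (m - j) / fact m))
      \<le> (\<Sum>j\<le>Suc m. y ^ j / fact j * (1 + 2 / real m * exp (2 * real j)))"
    using assms by (intro sum_mono mult_left_mono falling_ratio_bound) auto
  also have "\<dots> = (\<Sum>j\<le>Suc m. y ^ j / fact j)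
      + 2 / real m * (\<Sum>j\<le>Suc m. (exp 2 * y) ^ j / fact j)"
    unfolding sum_distrib_left sum.distrib[symmetric]
    by (intro sum.cong refl)
      (simp add: power_mult_distrib distrib_left mult_ac flip: exp_of_nat_mult)
  also have "\<dots> \<le> exp y + 2 / real m * exp (exp 2 * y)"
    using assms by (intro add_mono mult_left_mono sum_le_exp) auto
  also have "\<dots> \<le> exp y + exp y * (2 / real m * exp (8 * y))"
  proof -
    have "exp (exp 2 * y) \<le> 1 * exp (8 * y)"
      using e2 assms by (simp add: mult_right_mono)
    also have "\<dots> \<le> exp y * exp (8 * y)" using assms by (intro mult_right_mono) auto
    finally have "2 / real m * exp (exp 2 * y) \<le> 2 / real m * (exp y * exp (8 * y))"
      by (intro mult_left_mono) auto
    then show ?thesis by (simp add: mult_ac)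
  qed
  also have "\<dots> = exp y * (1 + 2 / real m * exp (8 * y))" by (simp add: distrib_left)
  also have "\<dots> \<le> exp y * exp (2 / real m * exp (8 * y))"
    by (intro mult_left_mono exp_ge_add_one_self) auto
  finally show ?thesis by (simp add: exp_add)
qed

lemma power_card_eq_sum_Pow:
  fixes b :: real
  assumes "finite A"
  shows "b ^ card A = (\<Sum>S\<in>Pow A. (b - 1) ^ card S)"
  using prod_add[OF assms, of "\<lambda>_. b - 1" "\<lambda>_. 1"] by simp

text \<open>Expand \<open>b ^ card (C \<inter> U)\<close> into \<open>(b - 1) ^ card S\<close> over
  \<open>S \<subseteq> C \<inter> U\<close>. A random cycle contains \<open>S\<close> with
  probability about \<open>(2 / m) ^ card S\<close>, so the average behaves as for a Poisson
  variable: \<open>y\<close> is \<open>b - 1\<close> times the mean number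
  \<open>2 * card U / m\<close> of edges that the cycle shares with \<open>U\<close>.\<close>

lemma sum_power_overlap:
  fixes b :: real
  assumes n: "3 \<le> n" and U: "finite U" "\<And>e. e \<in> U \<Longrightarrow> card e = 2" and b: "1 \<le> b"
  defines "y \<equiv> 2 * (b - 1) * card U / real (n - 1)"
  shows "(\<Sum>xs\<in>permutations_of_set {1..n}. b ^ card (cycle_edges xs \<inter> U))
    \<le> fact n * exp (y + 2 / real (n - 1) * exp (8 * y))"
proof -
  define m where "m = n - 1"
  define c where "c = b - 1"
  let ?P = "permutations_of_set {1..n}"
  have n': "n = Suc m" and m: "0 < m" using n by (auto simp: m_def)
  have c: "0 \<le> c" using b by (simp add: c_def)
  have "(\<Sum>xs\<in>?P. b ^ card (cycle_edges xs \<inter> U))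
      = (\<Sum>xs\<in>?P. \<Sum>S\<in>Pow U. if S \<subseteq> cycle_edges xs then c ^ card S else 0)"
  proof (intro sum.cong refl)
    fix xs
    have "Pow (cycle_edges xs \<inter> U) = {S \<in> Pow U. S \<subseteq> cycle_edges xs}" by auto
    then show "b ^ card (cycle_edges xs \<inter> U) = (\<Sum>S\<in>Pow U. if S \<subseteq> cycle_edges xs then c ^ card S else 0)"
      using U sum.inter_filter[of "Pow U" "\<lambda>S. c ^ card S" "\<lambda>S. S \<subseteq> cycle_edges xs"]
      by (simp only: power_card_eq_sum_Pow finite_Int finite_Pow_iff simp_thms c_def)
  qed
  also have "\<dots> = (\<Sum>S\<in>Pow U. \<Sum>xs\<in>?P. if S \<subseteq> cycle_edges xs then c ^ card S else 0)"
    by (rule sum.swap)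
  also have "\<dots> = (\<Sum>S\<in>Pow U. real (card {xs \<in> ?P. S \<subseteq> cycle_edges xs}) * c ^ card S)"
    by (simp flip: sum.inter_filter)
  \<comment> \<open>A cycle has only \<open>n\<close> edges, so larger \<open>S\<close> contribute
    nothing. The cut-off must be explicit: past \<open>n\<close> the truncated factorial stays at 1,
    and \<open>falling_ratio_bound\<close> is restricted to \<open>j \<le> Suc m\<close>.\<close>
  also have "\<dots> \<le> (\<Sum>S\<in>Pow U. if card S \<le> n then real n * 2 ^ card S * fact (m - card S) * c ^ card S else 0)"
  proof (rule sum_mono)
    fix S assume S: "S \<in> Pow U"
    have finS: "finite S" using S U by (auto intro: finite_subset)
    show "real (card {xs \<in> ?P. S \<subseteq> cycle_edges xs}) * c ^ card S
      \<le> (if card S \<le> n then real n * 2 ^ card S * fact (m - card S) * c ^ card S else 0)"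
    proof (cases "card S \<le> n")
      case True
      have "card {xs \<in> ?P. S \<subseteq> cycle_edges xs} \<le> n * 2 ^ card S * fact (m - card S)"
        using card_permutations_cycle_edges[of "{1..n}" S] finS S U n by (auto simp: m_def)
      then have "real (card {xs \<in> ?P. S \<subseteq> cycle_edges xs}) \<le> real n * 2 ^ card S * fact (m - card S)"
        by (auto dest!: of_nat_mono[where 'a = real])
      then show ?thesis using True c by (auto intro!: mult_right_mono)
    next
      case False
      have "\<not> S \<subseteq> cycle_edges xs" if "xs \<in> ?P" for xs
      proof
        assume "S \<subseteq> cycle_edges xs"
        then have "card S \<le> card (cycle_edges xs)" by (intro card_mono) auto
        also have "\<dots> = n"
          using that n card_cycle_edges[of xs] length_finite_permutations_of_set[OF that]
          by (simp add: permutations_of_setD)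
        finally show False using False by simp
      qed
      then have "{xs \<in> ?P. S \<subseteq> cycle_edges xs} = {}" by blast
      then show ?thesis using False by (simp only: card.empty) simp
    qed
  qed
  also have "\<dots> = (\<Sum>S | S \<in> Pow U \<and> card S \<le> n. real n * 2 ^ card S * fact (m - card S) * c ^ card S)"
    using U by (simp only: sum.inter_filter finite_Pow_iff)
  also have "\<dots> = (\<Sum>j\<le>n. \<Sum>S | S \<in> {S \<in> Pow U. card S \<le> n} \<and> card S = j. real n * 2 ^ card S * fact (m - card S) * c ^ card S)"
    using U by (intro sum.group[symmetric]) auto
  also have "\<dots> = (\<Sum>j\<le>n. real (card U choose j) * (real n * 2 ^ j * fact (m - j) * c ^ j))"
  proof (intro sum.cong refl)
    fix j assume j: "j \<in> {..n}"
    then have "{S. S \<in> {S \<in> Pow U. card S \<le> n} \<and> card S = j} = {S. S \<subseteq> U \<and> card S = j}" by auto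
    then show "(\<Sum>S | S \<in> {S \<in> Pow U. card S \<le> n} \<and> card S = j. real n * 2 ^ card S * fact (m - card S) * c ^ card S)
      = real (card U choose j) * (real n * 2 ^ j * fact (m - j) * c ^ j)"
      using U by (simp add: n_subsets)
  qed
  also have "\<dots> \<le> (\<Sum>j\<le>n. fact n * (y ^ j / fact j * (real m ^ j * fact (m - j) / fact m)))"
  proof (rule sum_mono)
    fix j assume "j \<in> {..n}"
    have "real ((card U choose j) * fact j) \<le> real (card U ^ j)"
      using binomial_fact_pow of_nat_mono by blast
    then have "real (card U choose j) \<le> real (card U) ^ j / fact j"
      by (simp add: field_simps)
    then have "real (card U choose j) * (real n * 2 ^ j * fact (m - j) * c ^ j)
      \<le> real (card U) ^ j / fact j * (real n * 2 ^ j * fact (m - j) * c ^ j)"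
      using c by (intro mult_right_mono) auto
    also have "\<dots> = fact n * (y ^ j / fact j * (real m ^ j * fact (m - j) / fact m))"
      using m by (simp add: y_def n' flip: c_def) (simp add: field_simps power_mult_distrib power_divide)
    finally show "real (card U choose j) * (real n * 2 ^ j * fact (m - j) * c ^ j)
      \<le> fact n * (y ^ j / fact j * (real m ^ j * fact (m - j) / fact m))" .
  qed
  also have "\<dots> = fact n * (\<Sum>j\<le>Suc m. y ^ j / fact j * (real m ^ j * fact (m - j) / fact m))"
    by (simp only: sum_distrib_left n')
  also have "\<dots> \<le> fact n * exp (y + 2 / real m * exp (8 * y))"
    using m b by (intro mult_left_mono weighted_ratio_sum) (auto simp: y_def)
  finally show ?thesis by (simp add: m_def)
qed

section \<open>Tuples of cycles, revealed one at a time\<close>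

definition tuples :: "nat \<Rightarrow> nat \<Rightarrow> nat list list set" where
  "tuples n k = {cs. set cs \<subseteq> permutations_of_set {1..n} \<and> length cs = k}"

definition tuple_edges :: "nat list list \<Rightarrow> nat set set" where
  "tuple_edges cs = (\<Union>xs\<in>set cs. cycle_edges xs)"

lemma sum_tuples_Suc:
  "(\<Sum>cs\<in>tuples n (Suc k). f cs) = (\<Sum>cs\<in>tuples n k. \<Sum>xs\<in>permutations_of_set {1..n}. f (xs # cs))"
  unfolding tuples_def lists_length_Suc_eq
  by (subst sum.reindex) (auto simp: inj_on_def sum.cartesian_product comp_def case_prod_unfold)

lemma finite_tuples [simp]: "finite (tuples n k)"
  unfolding tuples_def by (intro finite_lists_length_eq) simp

lemma tuples_0: "tuples n 0 = {[]}"
  by (auto simp: tuples_def)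

lemma sum_power_tuples:
  fixes f :: "nat list \<Rightarrow> real"
  shows "(\<Sum>xs\<in>permutations_of_set {1..n}. f xs) ^ k = (\<Sum>cs\<in>tuples n k. prod_list (map f cs))"
proof (induction k)
  case (Suc k)
  then show ?case
    by (simp add: sum_tuples_Suc flip: sum_distrib_right sum_distrib_left)
qed (simp add: tuples_0)

lemma tuple_edges:
  assumes n: "3 \<le> n" and cs: "cs \<in> tuples n k"
  shows "finite (tuple_edges cs)" "e \<in> tuple_edges cs \<Longrightarrow> e \<subseteq> {1..n} \<and> card e = 2"
    "card (tuple_edges cs) \<le> k * n"
proof -
  have xs: "distinct xs" "set xs = {1..n}" "length xs = n" if "xs \<in> set cs" for xs
    using that cs length_finite_permutations_of_set[of xs "{1..n}"]
    by (auto simp: tuples_def permutations_of_set_def)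
  show "finite (tuple_edges cs)" by (simp add: tuple_edges_def)
  show "e \<subseteq> {1..n} \<and> card e = 2" if "e \<in> tuple_edges cs"
    using that xs cycle_edges_pairs n by (fastforce simp: tuple_edges_def)
  have "card (tuple_edges cs) \<le> (\<Sum>xs\<in>set cs. card (cycle_edges xs))"
    unfolding tuple_edges_def by (intro card_UN_le) simp
  also have "\<dots> = card (set cs) * n" using xs n by (simp add: card_cycle_edges)
  also have "\<dots> \<le> k * n" using cs card_length[of cs] by (intro mult_right_mono) (auto simp: tuples_def)
  finally show "card (tuple_edges cs) \<le> k * n" .
qed

text \<open>The exponent \<open>k * n - card (tuple_edges cs)\<close> is the total overlap. A cycle
  added to \<open>l\<close> earlier ones raises it by its overlap with at most \<open>l * n\<close>
  edges, at a cost of \<open>2 * (b - 1) * l * n / m\<close> in the exponent; summing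
  \<open>2 * l\<close> over \<open>l < k\<close> gives \<open>k * (k - 1)\<close>. The bound
  \<open>K\<close> is fixed in advance so that each step of the induction has the same error
  term.\<close>

lemma sum_tuples_overlap:
  fixes b :: real
  assumes n: "3 \<le> n" and b: "1 \<le> b" and kK: "real k \<le> K"
  defines "m \<equiv> real (n - 1)"
  shows "(\<Sum>cs\<in>tuples n k. b ^ (k * n - card (tuple_edges cs)))
    \<le> fact n ^ k * exp ((b - 1) * k * (real k - 1) * n / m + k * (2 / m * exp (16 * (b - 1) * K * n / m)))"
  using kK
proof (induction k)
  case 0
  then show ?case by (simp add: tuples_0 tuple_edges_def)
next
  case (Suc k)
  define Z where "Z = 2 / m * exp (16 * (b - 1) * K * n / m)"
  have m: "0 < m" using n by (simp add: m_def)
  have "(\<Sum>cs\<in>tuples n (Suc k). b ^ (Suc k * n - card (tuple_edges cs)))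
      = (\<Sum>cs\<in>tuples n k. b ^ (k * n - card (tuple_edges cs)) *
          (\<Sum>xs\<in>permutations_of_set {1..n}. b ^ card (cycle_edges xs \<inter> tuple_edges cs)))"
    unfolding sum_tuples_Suc sum_distrib_left power_add[symmetric]
  proof (intro sum.cong refl arg_cong[where f = "\<lambda>i. b ^ i"])
    fix cs xs assume cs: "cs \<in> tuples n k" and xs: "xs \<in> permutations_of_set {1..n}"
    have cxs: "card (cycle_edges xs) = n"
      using xs n card_cycle_edges[of xs] length_finite_permutations_of_set[OF xs]
      by (simp add: permutations_of_setD)
    have "card (cycle_edges xs) + card (tuple_edges cs)
        = card (cycle_edges xs \<union> tuple_edges cs) + card (cycle_edges xs \<inter> tuple_edges cs)"
      using tuple_edges[OF n cs] by (intro card_Un_Int) auto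
    moreover have "tuple_edges (xs # cs) = cycle_edges xs \<union> tuple_edges cs"
      by (simp add: tuple_edges_def)
    moreover have "card (tuple_edges cs) \<le> k * n" using tuple_edges[OF n cs] by simp
    moreover have "card (cycle_edges xs \<inter> tuple_edges cs) \<le> card (tuple_edges cs)"
      using tuple_edges[OF n cs] by (intro card_mono) auto
    ultimately show "Suc k * n - card (tuple_edges (xs # cs))
        = k * n - card (tuple_edges cs) + card (cycle_edges xs \<inter> tuple_edges cs)"
      using cxs by simp
  qed
  also have "\<dots> \<le> (\<Sum>cs\<in>tuples n k. b ^ (k * n - card (tuple_edges cs)) *
      (fact n * exp (2 * (b - 1) * k * n / m + Z)))"
  proof (intro sum_mono mult_left_mono)
    fix cs assume cs: "cs \<in> tuples n k"
    define y where "y = 2 * (b - 1) * card (tuple_edges cs) / m"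
    have "real (card (tuple_edges cs)) \<le> real (k * n)"
      using tuple_edges[OF n cs] by (intro of_nat_mono)
    then have y: "y \<le> 2 * (b - 1) * k * n / m"
      using b m by (auto simp: y_def mult.assoc intro!: divide_right_mono mult_left_mono)
    also have "\<dots> \<le> 2 * (b - 1) * K * n / m"
      using b m Suc.prems by (intro divide_right_mono mult_right_mono mult_left_mono) auto
    finally have "8 * y \<le> 8 * (2 * (b - 1) * K * n / m)" by linarith
    also have "\<dots> = 16 * (b - 1) * K * n / m" by simp
    finally have "exp (8 * y) \<le> exp (16 * (b - 1) * K * n / m)" by simp
    then have "2 / m * exp (8 * y) \<le> Z" using m unfolding Z_def by (intro mult_left_mono) auto
    moreover have "(\<Sum>xs\<in>permutations_of_set {1..n}. b ^ card (cycle_edges xs \<inter> tuple_edges cs))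
        \<le> fact n * exp (y + 2 / m * exp (8 * y))"
      unfolding y_def m_def using tuple_edges[OF n cs] by (intro sum_power_overlap n b) auto
    ultimately show "(\<Sum>xs\<in>permutations_of_set {1..n}. b ^ card (cycle_edges xs \<inter> tuple_edges cs))
        \<le> fact n * exp (2 * (b - 1) * k * n / m + Z)"
      using y by (elim order_trans) (auto intro: add_mono)
  qed (use b in auto)
  also have "\<dots> = (\<Sum>cs\<in>tuples n k. b ^ (k * n - card (tuple_edges cs))) *
      (fact n * exp (2 * (b - 1) * k * n / m + Z))"
    by (simp only: sum_distrib_right)
  also have "\<dots> \<le> fact n ^ k * exp ((b - 1) * k * (real k - 1) * n / m + k * Z) *
      (fact n * exp (2 * (b - 1) * k * n / m + Z))"
    using Suc by (intro mult_right_mono) (auto simp: Z_def)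
  also have "\<dots> = fact n ^ Suc k * exp (((b - 1) * k * (real k - 1) * n / m + k * Z) + (2 * (b - 1) * k * n / m + Z))"
    by (simp add: exp_add mult_ac)
  also have "((b - 1) * k * (real k - 1) * n / m + k * Z) + (2 * (b - 1) * k * n / m + Z)
      = (b - 1) * Suc k * (real (Suc k) - 1) * n / m + Suc k * Z"
    using m by (simp add: field_simps)
  finally show ?case by (simp add: Z_def)
qed

section \<open>Edge indicators and their moment generating function\<close>

definition pairs :: "nat \<Rightarrow> nat set set" where
  "pairs n = {e. e \<subseteq> {1..n} \<and> card e = 2}"

lemma finite_pairs [simp]: "finite (pairs n)"
  unfolding pairs_def by (rule finite_subset[of _ "Pow {1..n}"]) auto

lemma pairs_subset: "pairs n \<subseteq> vertex_pairs"
  by (auto simp: pairs_def vertex_pairs_def)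

lemma card_pairs: "card (pairs n) = n choose 2"
  unfolding pairs_def using n_subsets[of "{1..n}" 2] by simp

lemma real_card_pairs: "real (card (pairs n)) = real n * (real n - 1) / 2"
  by (cases n) (simp_all add: card_pairs choose_two real_of_nat_div algebra_simps)

lemma pairs_mono: "n \<le> n' \<Longrightarrow> pairs n \<subseteq> pairs n'"
  by (auto simp: pairs_def)

locale nontrivial_random_graph = random_graph +
  assumes p_pos: "0 < p" and p_less_1: "p < 1"
begin

lemma events_edge: "e \<in> vertex_pairs \<Longrightarrow> {\<omega> \<in> space M. e \<in> G \<omega>} \<in> events"
  using edges_indep by (auto simp: indep_events_def)

lemma prob_subset:
  assumes "finite J" "J \<subseteq> vertex_pairs"
  shows "{\<omega> \<in> space M. J \<subseteq> G \<omega>} \<in> events" "prob {\<omega> \<in> space M. J \<subseteq> G \<omega>} = p ^ card J"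
proof -
  have eq: "{\<omega> \<in> space M. J \<subseteq> G \<omega>} = (\<Inter>e\<in>J. {\<omega> \<in> space M. e \<in> G \<omega>})" if "J \<noteq> {}"
    using that by auto
  show "{\<omega> \<in> space M. J \<subseteq> G \<omega>} \<in> events"
  proof (cases "J = {}")
    case False
    then show ?thesis unfolding eq[OF False]
      using assms events_edge by (intro sets.finite_INT) auto
  qed simp
  show "prob {\<omega> \<in> space M. J \<subseteq> G \<omega>} = p ^ card J"
  proof (cases "J = {}")
    case False
    have "prob (\<Inter>e\<in>J. {\<omega> \<in> space M. e \<in> G \<omega>}) = (\<Prod>e\<in>J. prob {\<omega> \<in> space M. e \<in> G \<omega>})"
      using edges_indep assms False unfolding indep_events_def by blast
    also have "\<dots> = (\<Prod>e\<in>J. p)" using assms edges_prob by (intro prod.cong) auto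
    finally show ?thesis unfolding eq[OF False] by simp
  qed (simp add: prob_space)
qed

text \<open>Independence is available as the probability \<open>p ^ card J\<close> of
  \<open>J \<subseteq> G \<omega>\<close>. So each factor is written as an indicator times
  \<open>f e - g e\<close>, plus \<open>g e\<close>; the product is expanded over subsets
  \<open>J\<close>, integrated term by term, and folded back into a product.\<close>

lemma expectation_prod_edges:
  assumes A: "finite A" "A \<subseteq> vertex_pairs"
  shows "integrable M (\<lambda>\<omega>. \<Prod>e\<in>A. if e \<in> G \<omega> then f e else g e :: real)" (is ?int)
    and "expectation (\<lambda>\<omega>. \<Prod>e\<in>A. if e \<in> G \<omega> then f e else g e) =
      (\<Prod>e\<in>A. p * f e + (1 - p) * g e)" (is ?eq)
proof -
  let ?F = "\<lambda>\<omega>. \<Sum>J\<in>Pow A. indicator {\<omega> \<in> space M. J \<subseteq> G \<omega>} \<omega> * ((\<Prod>e\<in>J. f e - g e) * (\<Prod>e\<in>A-J. g e))"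
  have eq: "(\<Prod>e\<in>A. if e \<in> G \<omega> then f e else g e) = ?F \<omega>" if "\<omega> \<in> space M" for \<omega>
  proof -
    have "(\<Prod>e\<in>A. if e \<in> G \<omega> then f e else g e) = (\<Prod>e\<in>A. of_bool (e \<in> G \<omega>) * (f e - g e) + g e)"
      by (intro prod.cong) auto
    also have "\<dots> = (\<Sum>J\<in>Pow A. (\<Prod>e\<in>J. of_bool (e \<in> G \<omega>) * (f e - g e)) * (\<Prod>e\<in>A-J. g e))"
      by (rule prod_add[OF A(1)])
    also have "\<dots> = ?F \<omega>"
    proof (intro sum.cong refl)
      fix J assume "J \<in> Pow A"
      then have "finite J" using A by (auto intro: finite_subset)
      then have "(\<Prod>e\<in>J. of_bool (e \<in> G \<omega>)) = (indicator {\<omega> \<in> space M. J \<subseteq> G \<omega>} \<omega> :: real)"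
        using that by (induction J rule: finite_induct) (auto simp: indicator_def)
      then show "(\<Prod>e\<in>J. of_bool (e \<in> G \<omega>) * (f e - g e)) * (\<Prod>e\<in>A-J. g e) =
        indicator {\<omega> \<in> space M. J \<subseteq> G \<omega>} \<omega> * ((\<Prod>e\<in>J. f e - g e) * (\<Prod>e\<in>A-J. g e))"
        by (simp add: prod.distrib)
    qed
    finally show ?thesis .
  qed
  have J: "finite J" "J \<subseteq> vertex_pairs" if "J \<in> Pow A" for J
    using that A by (auto intro: finite_subset)
  have int: "integrable M (\<lambda>\<omega>. indicator {\<omega> \<in> space M. J \<subseteq> G \<omega>} \<omega> * c :: real)" if "J \<in> Pow A" for J c
    using prob_subset(1)[OF J[OF that]]
    by (intro integrable_mult_left integrable_real_indicator) (auto simp: emeasure_eq_measure)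
  have "integrable M ?F" by (intro Bochner_Integration.integrable_sum int)
  moreover have "integrable M (\<lambda>\<omega>. \<Prod>e\<in>A. if e \<in> G \<omega> then f e else g e) \<longleftrightarrow> integrable M ?F"
    by (intro Bochner_Integration.integrable_cong refl eq)
  ultimately show ?int by simp
  have "expectation (\<lambda>\<omega>. \<Prod>e\<in>A. if e \<in> G \<omega> then f e else g e) = expectation ?F"
    by (intro Bochner_Integration.integral_cong refl eq)
  also have "\<dots> = (\<Sum>J\<in>Pow A. expectation (\<lambda>\<omega>. indicator {\<omega> \<in> space M. J \<subseteq> G \<omega>} \<omega> *
      ((\<Prod>e\<in>J. f e - g e) * (\<Prod>e\<in>A-J. g e))))"
    by (intro Bochner_Integration.integral_sum int)
  also have "\<dots> = (\<Sum>J\<in>Pow A. (\<Prod>e\<in>J. p * (f e - g e)) * (\<Prod>e\<in>A-J. g e))"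
  proof (intro sum.cong refl)
    fix J assume J': "J \<in> Pow A"
    have "space M \<inter> {\<omega> \<in> space M. J \<subseteq> G \<omega>} = {\<omega> \<in> space M. J \<subseteq> G \<omega>}" by auto
    then show "expectation (\<lambda>\<omega>. indicator {\<omega> \<in> space M. J \<subseteq> G \<omega>} \<omega> *
        ((\<Prod>e\<in>J. f e - g e) * (\<Prod>e\<in>A-J. g e))) = (\<Prod>e\<in>J. p * (f e - g e)) * (\<Prod>e\<in>A-J. g e)"
      using prob_subset[OF J[OF J']] by (simp add: prod.distrib Int_commute)
  qed
  also have "\<dots> = (\<Prod>e\<in>A. p * (f e - g e) + g e)" by (rule prod_add[OF A(1), symmetric])
  also have "\<dots> = (\<Prod>e\<in>A. p * f e + (1 - p) * g e)" by (simp add: algebra_simps)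
  finally show ?eq .
qed

lemma indicator_restrict:
  assumes "finite A" "S \<subseteq> A"
  shows "of_bool (G \<omega> \<inter> A = S) = (\<Prod>e\<in>A. if e \<in> G \<omega> then of_bool (e \<in> S) else of_bool (e \<notin> S) :: real)"
proof (cases "G \<omega> \<inter> A = S")
  case True
  have "(\<Prod>e\<in>A. if e \<in> G \<omega> then of_bool (e \<in> S) else of_bool (e \<notin> S) :: real) = 1"
    using True by (intro prod.neutral) auto
  then show ?thesis using True by simp
next
  case False
  then obtain e where "e \<in> A" "(e \<in> G \<omega>) \<noteq> (e \<in> S)" using assms by blast
  then have "(\<Prod>e\<in>A. if e \<in> G \<omega> then of_bool (e \<in> S) else of_bool (e \<notin> S) :: real) = 0"
    using assms by (intro prod_zero) auto
  then show ?thesis using False by simp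
qed

text \<open>Any real function of the finitely many possible traces
  \<open>G \<omega> \<inter> A\<close> is a finite combination of indicators. Integrability,
  measurability and independence of such functions thus reduce to
  \<open>expectation_prod_edges\<close>, with no measurable structure on the set of graphs.\<close>

lemma restrict_expand:
  fixes F :: "nat set set \<Rightarrow> real"
  assumes "finite A"
  shows "F (G \<omega> \<inter> A) = (\<Sum>S\<in>Pow A. F S * of_bool (G \<omega> \<inter> A = S))"
proof -
  have "(\<Sum>S\<in>Pow A. F S * of_bool (G \<omega> \<inter> A = S)) = (\<Sum>S\<in>Pow A. if G \<omega> \<inter> A = S then F S else 0)"
    by (intro sum.cong) auto
  also have "\<dots> = F (G \<omega> \<inter> A)" using assms by (simp add: sum.delta')
  finally show ?thesis by simp
qed

lemma integrable_restrict:
  fixes F :: "nat set set \<Rightarrow> real"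
  assumes "finite A" "A \<subseteq> vertex_pairs"
  shows "integrable M (\<lambda>\<omega>. F (G \<omega> \<inter> A))"
  unfolding restrict_expand[OF assms(1), of F]
proof (intro Bochner_Integration.integrable_sum integrable_mult_right)
  fix S assume "S \<in> Pow A"
  then show "integrable M (\<lambda>\<omega>. of_bool (G \<omega> \<inter> A = S) :: real)"
    using expectation_prod_edges(1)[OF assms] by (simp add: indicator_restrict assms)
qed

lemma measurable_restrict:
  fixes F :: "nat set set \<Rightarrow> real"
  assumes "finite A" "A \<subseteq> vertex_pairs"
  shows "(\<lambda>\<omega>. F (G \<omega> \<inter> A)) \<in> borel_measurable M"
  using integrable_restrict[OF assms] by (rule borel_measurable_integrable)

text \<open>Independence of the graph on disjoint edge sets: the law \<open>?\<mu>\<close> of a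
  trace is a product over edges and hence factorizes along \<open>A \<union> B\<close>.\<close>

lemma expectation_mult_restrict:
  fixes F H :: "nat set set \<Rightarrow> real"
  assumes A: "finite A" "A \<subseteq> vertex_pairs" and B: "finite B" "B \<subseteq> vertex_pairs" and disj: "A \<inter> B = {}"
  shows "expectation (\<lambda>\<omega>. F (G \<omega> \<inter> A) * H (G \<omega> \<inter> B)) =
    expectation (\<lambda>\<omega>. F (G \<omega> \<inter> A)) * expectation (\<lambda>\<omega>. H (G \<omega> \<inter> B))"
proof -
  let ?\<mu> = "\<lambda>A S. \<Prod>e\<in>A. p * of_bool (e \<in> S) + (1 - p) * of_bool (e \<notin> S) :: real"
  have single: "integrable M (\<lambda>\<omega>. of_bool (G \<omega> \<inter> C = S) :: real)"
      "expectation (\<lambda>\<omega>. of_bool (G \<omega> \<inter> C = S)) = ?\<mu> C S"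
    if "S \<in> Pow C" "finite C" "C \<subseteq> vertex_pairs" for C S
    using that expectation_prod_edges[OF that(2,3)] by (simp_all add: indicator_restrict)
  have E: "expectation (\<lambda>\<omega>. F (G \<omega> \<inter> C)) = (\<Sum>S\<in>Pow C. F S * ?\<mu> C S)"
    if "finite C" "C \<subseteq> vertex_pairs" for C and F :: "nat set set \<Rightarrow> real"
    unfolding restrict_expand[OF that(1), of F] using that single
    by (subst Bochner_Integration.integral_sum) auto
  have pair: "of_bool (G \<omega> \<inter> A = S) * of_bool (G \<omega> \<inter> B = T) =
      (of_bool (G \<omega> \<inter> (A \<union> B) = S \<union> T) :: real)"
    if "S \<in> Pow A" "T \<in> Pow B" for S T \<omega>
  proof -
    have "G \<omega> \<inter> A = S \<and> G \<omega> \<inter> B = T \<longleftrightarrow> G \<omega> \<inter> (A \<union> B) = S \<union> T"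
      using that disj by blast
    then show ?thesis by (simp flip: of_bool_conj)
  qed
  have mu: "?\<mu> (A \<union> B) (S \<union> T) = ?\<mu> A S * ?\<mu> B T" if "S \<in> Pow A" "T \<in> Pow B" for S T
  proof -
    have "?\<mu> (A \<union> B) (S \<union> T) = ?\<mu> A (S \<union> T) * ?\<mu> B (S \<union> T)"
      using A B disj by (intro prod.union_disjoint)
    also have "?\<mu> A (S \<union> T) = ?\<mu> A S" using that disj by (intro prod.cong refl) auto
    also have "?\<mu> B (S \<union> T) = ?\<mu> B T" using that disj by (intro prod.cong refl) auto
    finally show ?thesis .
  qed
  have AB: "finite (A \<union> B)" "A \<union> B \<subseteq> vertex_pairs" using A B by auto
  have "expectation (\<lambda>\<omega>. F (G \<omega> \<inter> A) * H (G \<omega> \<inter> B)) =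
      expectation (\<lambda>\<omega>. \<Sum>S\<in>Pow A. \<Sum>T\<in>Pow B. F S * H T * of_bool (G \<omega> \<inter> (A \<union> B) = S \<union> T))"
    unfolding restrict_expand[OF A(1), of F] restrict_expand[OF B(1), of H] sum_product
    by (intro Bochner_Integration.integral_cong sum.cong refl) (simp add: pair[symmetric] mult_ac)
  also have "\<dots> = (\<Sum>S\<in>Pow A. \<Sum>T\<in>Pow B. F S * H T * ?\<mu> (A \<union> B) (S \<union> T))"
  proof -
    have i: "integrable M (\<lambda>\<omega>. F S * H T * of_bool (G \<omega> \<inter> (A \<union> B) = S \<union> T))"
      if "S \<in> Pow A" "T \<in> Pow B" for S T
      using that by (intro integrable_mult_right single AB) auto
    have val: "expectation (\<lambda>\<omega>. F S * H T * of_bool (G \<omega> \<inter> (A \<union> B) = S \<union> T)) =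
        F S * H T * ?\<mu> (A \<union> B) (S \<union> T)" if "S \<in> Pow A" "T \<in> Pow B" for S T
    proof -
      have ST: "S \<union> T \<in> Pow (A \<union> B)" using that by auto
      show ?thesis by (simp only: integral_mult_right_zero single(2)[OF ST AB])
    qed
    have "expectation (\<lambda>\<omega>. \<Sum>S\<in>Pow A. \<Sum>T\<in>Pow B. F S * H T * of_bool (G \<omega> \<inter> (A \<union> B) = S \<union> T)) =
        (\<Sum>S\<in>Pow A. expectation (\<lambda>\<omega>. \<Sum>T\<in>Pow B. F S * H T * of_bool (G \<omega> \<inter> (A \<union> B) = S \<union> T)))"
      by (intro Bochner_Integration.integral_sum Bochner_Integration.integrable_sum i)
    also have "\<dots> = (\<Sum>S\<in>Pow A. \<Sum>T\<in>Pow B. expectation (\<lambda>\<omega>. F S * H T * of_bool (G \<omega> \<inter> (A \<union> B) = S \<union> T)))"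
      by (intro sum.cong refl Bochner_Integration.integral_sum i)
    also have "\<dots> = (\<Sum>S\<in>Pow A. \<Sum>T\<in>Pow B. F S * H T * ?\<mu> (A \<union> B) (S \<union> T))"
      by (intro sum.cong refl val)
    finally show ?thesis .
  qed
  also have "\<dots> = (\<Sum>S\<in>Pow A. \<Sum>T\<in>Pow B. (F S * ?\<mu> A S) * (H T * ?\<mu> B T))"
    by (intro sum.cong refl) (simp only: mu mult_ac)
  also have "\<dots> = expectation (\<lambda>\<omega>. F (G \<omega> \<inter> A)) * expectation (\<lambda>\<omega>. H (G \<omega> \<inter> B))"
    by (simp add: E A B sum_product)
  finally show ?thesis .
qed

section \<open>Centred edge counts and their exponential moments\<close>

definition deviation :: "nat set set \<Rightarrow> 'a \<Rightarrow> real" where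
  "deviation A \<omega> = (\<Sum>e\<in>A. of_bool (e \<in> G \<omega>) - p)"

definition edge_mgf :: "real \<Rightarrow> real" where
  "edge_mgf t = p * exp (t * (1 - p)) + (1 - p) * exp (- (t * p))"

lemma deviation_restrict: "deviation A \<omega> = (\<Sum>e\<in>A. of_bool (e \<in> G \<omega> \<inter> A) - p)"
  unfolding deviation_def by (intro sum.cong) auto

lemma deviation_union:
  "\<lbrakk>finite A; finite B; A \<inter> B = {}\<rbrakk> \<Longrightarrow> deviation (A \<union> B) \<omega> = deviation A \<omega> + deviation B \<omega>"
  unfolding deviation_def by (rule sum.union_disjoint)

lemma exp_deviation:
  "finite A \<Longrightarrow> exp (t * deviation A \<omega>) = (\<Prod>e\<in>A. if e \<in> G \<omega> then exp (t * (1 - p)) else exp (- (t * p)))"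
  unfolding deviation_def sum_distrib_left exp_sum by (intro prod.cong) auto

lemma measurable_deviation [measurable]:
  "\<lbrakk>finite A; A \<subseteq> vertex_pairs\<rbrakk> \<Longrightarrow> deviation A \<in> borel_measurable M"
  unfolding deviation_restrict[abs_def] by (rule measurable_restrict)

lemma mgf_deviation:
  assumes "finite A" "A \<subseteq> vertex_pairs"
  shows "integrable M (\<lambda>\<omega>. exp (t * deviation A \<omega>))"
    and "expectation (\<lambda>\<omega>. exp (t * deviation A \<omega>)) = edge_mgf t ^ card A"
  using expectation_prod_edges[OF assms] assms by (simp_all add: exp_deviation edge_mgf_def)

text \<open>Jensen's inequality for a centred variable: the linear terms of
  \<open>1 + x \<le> exp x\<close> average out. In the maximal inequality this says that further
  edges do not decrease the exponential moment.\<close>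

lemma edge_mgf_ge_1: "1 \<le> edge_mgf t"
proof -
  have "p * (1 + t * (1 - p)) + (1 - p) * (1 + - (t * p)) \<le> edge_mgf t"
    unfolding edge_mgf_def using p_pos p_less_1
    by (intro add_mono mult_left_mono exp_ge_add_one_self) auto
  moreover have "p * (1 + t * (1 - p)) + (1 - p) * (1 + - (t * p)) = 1" by (simp add: algebra_simps)
  ultimately show ?thesis by simp
qed

lemma exp_taylor_2:
  fixes x :: real
  assumes "\<bar>x\<bar> \<le> 1"
  shows "\<bar>exp x - (1 + x + x\<^sup>2 / 2)\<bar> \<le> \<bar>x\<bar> ^ 3"
proof -
  obtain t where t: "\<bar>t\<bar> \<le> \<bar>x\<bar>" "exp x = (\<Sum>m<3. x ^ m / fact m) + exp t / fact 3 * x ^ 3"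
    using Maclaurin_exp_le[of x 3] by auto
  have "exp t \<le> exp 1" using t(1) assms by simp
  also have "\<dots> \<le> 6" using e_less_272 by simp
  finally have "exp t / 6 \<le> 1" by simp
  then have "\<bar>exp t / 6 * x ^ 3\<bar> \<le> 1 * \<bar>x\<bar> ^ 3"
    unfolding abs_mult power_abs by (intro mult_right_mono) auto
  then show ?thesis using t(2) by (simp add: eval_nat_numeral)
qed

lemma edge_mgf_taylor:
  assumes t: "\<bar>t\<bar> \<le> 1"
  shows "\<bar>edge_mgf t - (1 + p * (1 - p) * t\<^sup>2 / 2)\<bar> \<le> \<bar>t\<bar> ^ 3"
proof -
  define r where "r x = exp x - (1 + x + x\<^sup>2 / 2)" for x :: real
  have "\<bar>t * (1 - p)\<bar> \<le> \<bar>t\<bar> * 1" "\<bar>- (t * p)\<bar> \<le> \<bar>t\<bar> * 1"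
    unfolding abs_mult abs_minus_cancel using p_pos p_less_1 by (intro mult_left_mono; simp)+
  then have *: "\<bar>t * (1 - p)\<bar> \<le> \<bar>t\<bar>" "\<bar>- (t * p)\<bar> \<le> \<bar>t\<bar>" by simp_all
  have "\<bar>r (t * (1 - p))\<bar> \<le> \<bar>t * (1 - p)\<bar> ^ 3" "\<bar>r (- (t * p))\<bar> \<le> \<bar>- (t * p)\<bar> ^ 3"
    unfolding r_def using * t by (intro exp_taylor_2; linarith)+
  moreover have "\<bar>t * (1 - p)\<bar> ^ 3 \<le> \<bar>t\<bar> ^ 3" "\<bar>- (t * p)\<bar> ^ 3 \<le> \<bar>t\<bar> ^ 3"
    using * by (intro power_mono; simp)+
  ultimately have r: "\<bar>r (t * (1 - p))\<bar> \<le> \<bar>t\<bar> ^ 3" "\<bar>r (- (t * p))\<bar> \<le> \<bar>t\<bar> ^ 3" by linarith+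
  have "edge_mgf t - (1 + p * (1 - p) * t\<^sup>2 / 2) = p * r (t * (1 - p)) + (1 - p) * r (- (t * p))"
    by (simp add: edge_mgf_def r_def power2_eq_square field_simps)
  also have "\<bar>\<dots>\<bar> \<le> \<bar>p * r (t * (1 - p))\<bar> + \<bar>(1 - p) * r (- (t * p))\<bar>" by (rule abs_triangle_ineq)
  also have "\<dots> \<le> p * \<bar>t\<bar> ^ 3 + (1 - p) * \<bar>t\<bar> ^ 3"
    unfolding abs_mult using p_pos p_less_1 r by (intro add_mono mult_mono) auto
  also have "\<dots> = \<bar>t\<bar> ^ 3" by (simp add: algebra_simps)
  finally show ?thesis .
qed

text \<open>The edge variance \<open>p * (1 - p)\<close> with a cubic error. In the moment
  computation there are about \<open>n^2 / 2\<close> edges and \<open>t\<close> is of order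
  \<open>k / n\<close>, so the quadratic term is of order \<open>k^2\<close> and the error only of
  order \<open>k^3 / n\<close>. In the lower bound, the constant 5 is 1 from Taylor plus 4 for the
  term \<open>x\<^sup>2\<close> lost in \<open>ln (1 + x)\<close>.\<close>

lemma ln_edge_mgf:
  assumes t: "\<bar>t\<bar> \<le> 1 / 2"
  shows "p * (1 - p) * t\<^sup>2 / 2 - 5 * \<bar>t\<bar> ^ 3 \<le> ln (edge_mgf t)"
    and "ln (edge_mgf t) \<le> p * (1 - p) * t\<^sup>2 / 2 + \<bar>t\<bar> ^ 3"
proof -
  define x where "x = edge_mgf t - 1"
  have x0: "0 \<le> x" using edge_mgf_ge_1 by (simp add: x_def)
  have T: "\<bar>x - p * (1 - p) * t\<^sup>2 / 2\<bar> \<le> \<bar>t\<bar> ^ 3"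
    using edge_mgf_taylor[of t] t by (simp add: x_def algebra_simps)
  have pq: "p * (1 - p) \<le> 1 * 1" using p_pos p_less_1 by (intro mult_mono) auto
  have "p * (1 - p) * t\<^sup>2 \<le> 1 * t\<^sup>2" using pq by (intro mult_right_mono) auto
  moreover have t3: "\<bar>t\<bar> ^ 3 = \<bar>t\<bar> * t\<^sup>2" by (simp add: power3_eq_cube power2_eq_square)
  moreover have "\<bar>t\<bar> * t\<^sup>2 \<le> 1 / 2 * t\<^sup>2" using t by (intro mult_right_mono) auto
  ultimately have x2: "x \<le> t\<^sup>2" using T by linarith
  have t2: "t\<^sup>2 \<le> \<bar>t\<bar> * (1 / 2)"
    using t mult_left_mono[of "\<bar>t\<bar>" "1/2" "\<bar>t\<bar>"] by (simp add: power2_eq_square)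
  have x1: "x \<le> 1" using x2 t2 t by linarith
  have "x\<^sup>2 \<le> (t\<^sup>2) * (\<bar>t\<bar> * (1 / 2))" unfolding power2_eq_square[of x]
    using x2 t2 x0 by (intro mult_mono) auto
  moreover have "t\<^sup>2 * (\<bar>t\<bar> * (1 / 2)) = 1 / 2 * \<bar>t\<bar> ^ 3" by (simp add: t3)
  ultimately have xx: "x\<^sup>2 \<le> 4 * \<bar>t\<bar> ^ 3" using zero_le_power[of "\<bar>t\<bar>" 3] by linarith
  have "x - x\<^sup>2 \<le> ln (1 + x)" using x0 x1 by (rule ln_one_plus_pos_lower_bound)
  then show "p * (1 - p) * t\<^sup>2 / 2 - 5 * \<bar>t\<bar> ^ 3 \<le> ln (edge_mgf t)"
    using T xx by (simp add: x_def abs_le_iff)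
  have "ln (1 + x) \<le> x" using x0 by (rule ln_add_one_self_le_self)
  then show "ln (edge_mgf t) \<le> p * (1 - p) * t\<^sup>2 / 2 + \<bar>t\<bar> ^ 3"
    using T by (simp add: x_def abs_le_iff)
qed

lemma edge_mgf_power_bounds:
  assumes t: "\<bar>t\<bar> \<le> 1 / 2"
  shows "exp (real N * (p * (1 - p) * t\<^sup>2 / 2 - 5 * \<bar>t\<bar> ^ 3)) \<le> edge_mgf t ^ N"
    and "edge_mgf t ^ N \<le> exp (real N * (p * (1 - p) * t\<^sup>2 / 2 + \<bar>t\<bar> ^ 3))"
proof -
  have "0 < edge_mgf t" using edge_mgf_ge_1[of t] by simp
  then have "edge_mgf t ^ N = exp (real N * ln (edge_mgf t))" by (simp add: exp_of_nat_mult)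
  then show "exp (real N * (p * (1 - p) * t\<^sup>2 / 2 - 5 * \<bar>t\<bar> ^ 3)) \<le> edge_mgf t ^ N"
    "edge_mgf t ^ N \<le> exp (real N * (p * (1 - p) * t\<^sup>2 / 2 + \<bar>t\<bar> ^ 3))"
    using ln_edge_mgf[OF t] by (simp_all add: mult_left_mono)
qed

end

section \<open>Moments of the normalized number of Hamiltonian cycles\<close>

lemma card_ham_lists_sum:
  "real (card (ham_lists E n)) = (\<Sum>xs\<in>permutations_of_set {1..n}. of_bool (cycle_edges xs \<subseteq> E))"
  by (simp add: ham_lists_def flip: sum.inter_filter card_eq_sum add: of_bool_def sum.If_cases Int_def)

lemma ham_lists_restrict:
  assumes "3 \<le> n"
  shows "ham_lists (E \<inter> pairs n) n = ham_lists E n"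
proof -
  have "cycle_edges xs \<subseteq> pairs n" if "xs \<in> permutations_of_set {1..n}" for xs
    using that assms cycle_edges_pairs[of xs] length_finite_permutations_of_set[OF that]
    by (auto simp: pairs_def permutations_of_set_def)
  then show ?thesis by (auto simp: ham_lists_def)
qed

context nontrivial_random_graph
begin

text \<open>A surplus of \<open>Z\<close> edges raises the density from \<open>p\<close> to
  \<open>p + Z / N\<close> with \<open>N = n * (n - 1) / 2\<close>. A cycle has \<open>n\<close>
  edges, so the logarithm of the count rises by about \<open>n * Z / (N * p)\<close>, which is
  \<open>slope n * Z\<close>.\<close>

definition slope :: "nat \<Rightarrow> real" where
  "slope n = 2 / (real (n - 1) * p)"

text \<open>Every Hamiltonian cycle is counted by \<open>2 n\<close> lists, whence \<open>fact n\<close> instead of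
  \<open>fact (n - 1) / 2\<close>. The exponential removes the first-order effect of the number of edges.\<close>

definition W :: "nat \<Rightarrow> 'a \<Rightarrow> real" where
  "W n \<omega> = card (ham_lists (G \<omega>) n) / (fact n * p ^ n) * exp (- (slope n * deviation (pairs n) \<omega>))"

lemma W_nonneg: "0 \<le> W n \<omega>"
  using p_pos by (simp add: W_def)

lemma W_function:
  assumes "3 \<le> n"
  shows "\<exists>F :: nat set set \<Rightarrow> real. \<forall>\<omega>. W n \<omega> = F (G \<omega> \<inter> pairs n)"
proof (intro exI allI)
  show "W n \<omega> = (\<lambda>E. card (ham_lists E n) / (fact n * p ^ n) *
      exp (- (slope n * (\<Sum>e\<in>pairs n. of_bool (e \<in> E) - p)))) (G \<omega> \<inter> pairs n)" for \<omega>
    unfolding W_def deviation_restrict[of "pairs n" \<omega>] by (simp add: ham_lists_restrict assms)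
qed

lemma measurable_W:
  assumes "3 \<le> n"
  shows "W n \<in> borel_measurable M" "integrable M (\<lambda>\<omega>. W n \<omega> ^ k)"
proof -
  obtain F :: "nat set set \<Rightarrow> real" where F: "\<And>\<omega>. W n \<omega> = F (G \<omega> \<inter> pairs n)"
    using W_function[OF assms] by blast
  show "W n \<in> borel_measurable M"
    unfolding F[abs_def] by (rule measurable_restrict[OF finite_pairs pairs_subset])
  show "integrable M (\<lambda>\<omega>. W n \<omega> ^ k)"
    unfolding F by (rule integrable_restrict[OF finite_pairs pairs_subset, of "\<lambda>E. F E ^ k"])
qed

text \<open>An edge of \<open>U\<close> has to be present and contributes
  \<open>p * exp (- (t * (1 - p)))\<close>; every other edge of \<open>A\<close> contributes its
  full generating function.\<close>

lemma expectation_subset_exp: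
  assumes A: "finite A" "A \<subseteq> vertex_pairs" and U: "U \<subseteq> A"
  shows "integrable M (\<lambda>\<omega>. of_bool (U \<subseteq> G \<omega>) * exp (- (t * deviation A \<omega>)))"
    and "expectation (\<lambda>\<omega>. of_bool (U \<subseteq> G \<omega>) * exp (- (t * deviation A \<omega>))) =
      (p * exp (- (t * (1 - p)))) ^ card U * edge_mgf (- t) ^ (card A - card U)"
proof -
  let ?f = "\<lambda>e. exp (- (t * (1 - p)))" and ?g = "\<lambda>e. if e \<in> U then 0 else exp (t * p)"
  have finU: "finite U" using A U by (rule_tac finite_subset)
  have eq: "of_bool (U \<subseteq> G \<omega>) * exp (- (t * deviation A \<omega>)) =
      (\<Prod>e\<in>A. if e \<in> G \<omega> then ?f e else ?g e)" for \<omega>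
  proof (cases "U \<subseteq> G \<omega>")
    case True
    then have "(\<Prod>e\<in>A. if e \<in> G \<omega> then ?f e else ?g e) =
        (\<Prod>e\<in>A. if e \<in> G \<omega> then exp ((- t) * (1 - p)) else exp (- ((- t) * p)))"
      by (intro prod.cong) auto
    then show ?thesis using True exp_deviation[OF A(1), of "- t" \<omega>] by simp
  next
    case False
    then obtain e where "e \<in> A" "e \<in> U" "e \<notin> G \<omega>" using U by blast
    then have "(\<Prod>e\<in>A. if e \<in> G \<omega> then ?f e else ?g e) = 0" using A by (intro prod_zero) auto
    then show ?thesis using False by simp
  qed
  show "integrable M (\<lambda>\<omega>. of_bool (U \<subseteq> G \<omega>) * exp (- (t * deviation A \<omega>)))"
    unfolding eq by (rule expectation_prod_edges[OF A])
  have "expectation (\<lambda>\<omega>. of_bool (U \<subseteq> G \<omega>) * exp (- (t * deviation A \<omega>))) =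
      (\<Prod>e\<in>A. p * ?f e + (1 - p) * ?g e)"
    unfolding eq by (rule expectation_prod_edges[OF A])
  also have "\<dots> = (\<Prod>e\<in>A-U. p * ?f e + (1 - p) * ?g e) * (\<Prod>e\<in>U. p * ?f e + (1 - p) * ?g e)"
    by (rule prod.subset_diff[OF U A(1)])
  also have "(\<Prod>e\<in>A-U. p * ?f e + (1 - p) * ?g e) = (\<Prod>e\<in>A-U. edge_mgf (- t))"
    by (intro prod.cong) (auto simp: edge_mgf_def)
  also have "(\<Prod>e\<in>U. p * ?f e + (1 - p) * ?g e) = (\<Prod>e\<in>U. p * exp (- (t * (1 - p))))"
    by (intro prod.cong) auto
  finally show "expectation (\<lambda>\<omega>. of_bool (U \<subseteq> G \<omega>) * exp (- (t * deviation A \<omega>))) =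
      (p * exp (- (t * (1 - p)))) ^ card U * edge_mgf (- t) ^ (card A - card U)"
    using U A finU by (simp add: card_Diff_subset)
qed

lemma W_power:
  "W n \<omega> ^ k = (1 / (fact n * p ^ n)) ^ k *
    (\<Sum>cs\<in>tuples n k. of_bool (tuple_edges cs \<subseteq> G \<omega>) * exp (- (k * slope n * deviation (pairs n) \<omega>)))"
proof -
  have "prod_list (map (\<lambda>xs. of_bool (cycle_edges xs \<subseteq> G \<omega>)) cs) = (of_bool (tuple_edges cs \<subseteq> G \<omega>) :: real)"
    for cs by (induction cs) (auto simp: tuple_edges_def)
  then have "real (card (ham_lists (G \<omega>) n)) ^ k = (\<Sum>cs\<in>tuples n k. of_bool (tuple_edges cs \<subseteq> G \<omega>))"
    unfolding card_ham_lists_sum sum_power_tuples by simp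
  moreover have "exp (- (slope n * deviation (pairs n) \<omega>)) ^ k = exp (- (k * slope n * deviation (pairs n) \<omega>))"
    by (simp add: mult.assoc flip: exp_of_nat_mult)
  ultimately show ?thesis
    by (simp add: W_def power_mult_distrib power_divide divide_inverse mult_ac flip: sum_distrib_left)
qed

text \<open>The exponential factor reweights the edge probability to
  \<open>p * exp (- (t * (1 - p))) / \<phi> = 1 / b\<close>. A tuple whose union has
  \<open>u\<close> edges therefore has weight \<open>\<phi> ^ card (pairs n) / b ^ u\<close>: each
  repeated edge gains a factor \<open>b\<close>, which is the sum bounded in
  \<open>sum_tuples_overlap\<close>.\<close>

lemma expectation_W_power:
  fixes k :: nat
  assumes n: "3 \<le> n"
  defines "t \<equiv> k * slope n"
  defines "\<phi> \<equiv> edge_mgf (- t)"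
  defines "b \<equiv> \<phi> * exp (t * (1 - p)) / p"
  shows "expectation (\<lambda>\<omega>. W n \<omega> ^ k) = \<phi> ^ card (pairs n) / (\<phi> * exp (t * (1 - p))) ^ (k * n) *
    ((\<Sum>cs\<in>tuples n k. b ^ (k * n - card (tuple_edges cs))) / fact n ^ k)"
proof -
  have \<phi>: "1 \<le> \<phi>" unfolding \<phi>_def by (rule edge_mgf_ge_1)
  have b0: "0 < b" using \<phi> p_pos by (simp add: b_def)
  have sub: "tuple_edges cs \<subseteq> pairs n" if "cs \<in> tuples n k" for cs
    using tuple_edges(2)[OF n that] by (auto simp: pairs_def)
  have "expectation (\<lambda>\<omega>. W n \<omega> ^ k) = (1 / (fact n * p ^ n)) ^ k *
      expectation (\<lambda>\<omega>. \<Sum>cs\<in>tuples n k. of_bool (tuple_edges cs \<subseteq> G \<omega>) * exp (- (t * deviation (pairs n) \<omega>)))"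
    unfolding W_power t_def by (simp only: integral_mult_right_zero)
  also have "expectation (\<lambda>\<omega>. \<Sum>cs\<in>tuples n k. of_bool (tuple_edges cs \<subseteq> G \<omega>) * exp (- (t * deviation (pairs n) \<omega>)))
      = (\<Sum>cs\<in>tuples n k. expectation (\<lambda>\<omega>. of_bool (tuple_edges cs \<subseteq> G \<omega>) * exp (- (t * deviation (pairs n) \<omega>))))"
    by (intro Bochner_Integration.integral_sum expectation_subset_exp sub finite_pairs pairs_subset)
  also have "\<dots> = (\<Sum>cs\<in>tuples n k. \<phi> ^ card (pairs n) / b ^ (k * n) * b ^ (k * n - card (tuple_edges cs)))"
  proof (intro sum.cong refl)
    fix cs assume cs: "cs \<in> tuples n k"
    define u where "u = card (tuple_edges cs)"
    have u: "u \<le> k * n" "u \<le> card (pairs n)"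
      using tuple_edges[OF n cs] sub[OF cs] by (auto simp: u_def intro!: card_mono)
    have pe: "p * exp (- (t * (1 - p))) = \<phi> / b" 
    proof -
      have "\<phi> / (\<phi> * x / p) = p * inverse x" if "0 < x" for x
        using that \<phi> p_pos by (simp add: field_simps)
      then show ?thesis unfolding b_def exp_minus by simp
    qed
    have "expectation (\<lambda>\<omega>. of_bool (tuple_edges cs \<subseteq> G \<omega>) * exp (- (t * deviation (pairs n) \<omega>))) =
        (\<phi> / b) ^ u * \<phi> ^ (card (pairs n) - u)"
      using expectation_subset_exp(2)[OF finite_pairs pairs_subset sub[OF cs], of t]
      by (simp only: pe u_def \<phi>_def)
    also have "\<dots> = \<phi> ^ (u + (card (pairs n) - u)) / b ^ u" by (simp add: power_divide power_add)
    also have "\<dots> = \<phi> ^ card (pairs n) / b ^ (k * n) * b ^ (k * n - u)"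
      using u b0 by (simp add: power_diff)
    finally show "expectation (\<lambda>\<omega>. of_bool (tuple_edges cs \<subseteq> G \<omega>) * exp (- (t * deviation (pairs n) \<omega>))) =
      \<phi> ^ card (pairs n) / b ^ (k * n) * b ^ (k * n - card (tuple_edges cs))" by (simp add: u_def)
  qed
  also have "\<dots> = \<phi> ^ card (pairs n) / b ^ (k * n) * (\<Sum>cs\<in>tuples n k. b ^ (k * n - card (tuple_edges cs)))"
    by (simp only: sum_distrib_left)
  also have "b ^ (k * n) = (\<phi> * exp (t * (1 - p))) ^ (k * n) / (p ^ n) ^ k"
    by (simp add: b_def power_divide power_mult mult.commute[of n k] flip: power_mult)
  finally show ?thesis
    using p_pos by (simp add: power_mult_distrib power_divide mult_ac)
qed

text \<open>With \<open>s = (1 - p) / p\<close> and \<open>r = n / m\<close>, the main exponents are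
  \<open>s * k^2 * r\<close> from the generating function, \<open>- 2 * s * k^2 * r\<close> from the
  forced edges, and \<open>s * k * (k - 1) * r\<close> from the overlaps, so the quadratic terms
  cancel. The hypothesis on \<open>k\<close> keeps the tilt \<open>t\<close> at most
  \<open>1 / 2\<close>.\<close>

lemma W_moment_bound:
  fixes k :: nat
  assumes n: "3 \<le> n" and k: "4 * k \<le> real (n - 1) * p"
  defines "m \<equiv> real (n - 1)"
  shows "expectation (\<lambda>\<omega>. W n \<omega> ^ k) \<le>
    exp (- ((1 - p) / p * k * n / m) + 24 * k ^ 3 / (m * p ^ 3) + 2 * k / m * exp (96 * k / p))"
proof -
  define t where "t = k * slope n"
  define \<phi> where "\<phi> = edge_mgf (- t)"
  define b where "b = \<phi> * exp (t * (1 - p)) / p"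
  define s where "s = (1 - p) / p"
  define r where "r = real n / m"
  have m2: "2 \<le> m" using n by (simp add: m_def)
  have nm: "real n = m + 1" using n by (simp add: m_def)
  have r2: "0 < r" "r \<le> 2" using m2 by (auto simp: r_def nm field_simps)
  have s0: "0 < s" "s \<le> 1 / p" using p_pos p_less_1 by (auto simp: s_def field_simps)
  have t_eq: "t = 2 * k / (m * p)" by (simp add: t_def slope_def m_def)
  have t0: "0 \<le> t" using m2 p_pos by (simp add: t_eq)
  have "real (4 * k) \<le> m * p" using k unfolding m_def .
  then have t1: "t \<le> 1 / 2" using m2 p_pos by (simp add: t_eq field_simps)
  have \<phi>1: "1 \<le> \<phi>" unfolding \<phi>_def by (rule edge_mgf_ge_1)
  have pq: "p * (1 - p) \<le> 1 * 1" using p_pos p_less_1 by (intro mult_mono) auto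
  have \<phi>_le: "\<phi> \<le> exp (p * (1 - p) * t\<^sup>2 / 2 + t ^ 3)"
    using edge_mgf_power_bounds(2)[of "- t" 1] t0 t1 by (simp add: \<phi>_def)
  have "exp (t * (1 - p)) \<ge> 1" using t0 p_less_1 by simp
  then have "1 * 1 \<le> \<phi> * exp (t * (1 - p))" using \<phi>1 by (intro mult_mono) auto
  then have "p \<le> \<phi> * exp (t * (1 - p))" using p_less_1 by simp
  then have b1: "1 \<le> b" using p_pos by (simp add: b_def)
  \<comment> \<open>Without the tilt, \<open>b\<close> would be \<open>1 / p\<close> and
    \<open>b - 1\<close> would be \<open>s\<close>. The error must be of order \<open>t\<close>,
    because it is multiplied by \<open>k^2\<close> and has to vanish for \<open>t\<close> of order
    \<open>k / m\<close>.\<close>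
  have b_le: "b - 1 \<le> s + 4 * t / p"
  proof -
    have "t ^ 2 \<le> t * 1" "t ^ 3 \<le> t * (1/4)"
    proof -
      show a: "t ^ 2 \<le> t * 1" using t0 t1 unfolding power2_eq_square by (intro mult_left_mono) auto
      have "t * (t * t) \<le> t * (1 / 2 * (1 / 2))" using t0 t1 by (intro mult_left_mono mult_mono) auto
      then show "t ^ 3 \<le> t * (1/4)" by (simp add: power3_eq_cube mult.assoc)
    qed
    moreover have "p * (1 - p) * t\<^sup>2 \<le> 1 * t\<^sup>2" using pq by (intro mult_right_mono) auto
    moreover have "t * (1 - p) \<le> t * 1" using t0 p_pos by (intro mult_left_mono) auto
    ultimately have e: "p * (1 - p) * t\<^sup>2 / 2 + t ^ 3 + t * (1 - p) \<le> 2 * t" using t0 by linarith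
    have "\<phi> * exp (t * (1 - p)) \<le> exp (p * (1 - p) * t\<^sup>2 / 2 + t ^ 3 + t * (1 - p))"
      using \<phi>_le by (simp add: exp_add mult_right_mono)
    also have "\<dots> \<le> exp (2 * t)" using e by simp
    also have "\<dots> \<le> 1 + 2 * t + (2 * t)\<^sup>2" using t0 t1 by (intro exp_bound) auto
    also have "\<dots> \<le> 1 + 4 * t"
      using mult_left_mono[of "2 * t" 1 "2 * t"] t0 t1 by (simp add: power2_eq_square)
    finally have "b \<le> (1 + 4 * t) / p" using p_pos by (simp add: b_def divide_right_mono)
    moreover have "s + 4 * t / p = (1 + 4 * t) / p - 1" using p_pos by (simp add: s_def field_simps)
    ultimately show ?thesis by simp
  qed
  have b3: "b - 1 \<le> 3 / p"
  proof -
    have "4 * t / p \<le> 2 / p" using t1 p_pos by (intro divide_right_mono) auto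
    moreover have "1 / p + 2 / p = 3 / p" by (simp add: field_simps)
    ultimately show ?thesis using b_le s0 by linarith
  qed
  define Z where "Z = 2 / m * exp (16 * (b - 1) * k * n / m)"
  have "(\<Sum>cs\<in>tuples n k. b ^ (k * n - card (tuple_edges cs))) \<le>
      fact n ^ k * exp ((b - 1) * k * (real k - 1) * n / m + k * Z)"
    unfolding Z_def m_def by (rule sum_tuples_overlap[OF n b1 order_refl])
  then have "(\<Sum>cs\<in>tuples n k. b ^ (k * n - card (tuple_edges cs))) / fact n ^ k \<le>
      exp ((b - 1) * k * (real k - 1) * n / m + k * Z)"
    by (simp add: field_simps)
  moreover have "\<phi> ^ card (pairs n) / (\<phi> * exp (t * (1 - p))) ^ (k * n) \<le>
      exp (card (pairs n) * (p * (1 - p) * t\<^sup>2 / 2 + t ^ 3)) / exp (t * (1 - p)) ^ (k * n)"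
  proof (rule frac_le)
    show "\<phi> ^ card (pairs n) \<le> exp (card (pairs n) * (p * (1 - p) * t\<^sup>2 / 2 + t ^ 3))"
      using edge_mgf_power_bounds(2)[of "- t" "card (pairs n)"] t0 t1 by (simp add: \<phi>_def)
    show "exp (t * (1 - p)) ^ (k * n) \<le> (\<phi> * exp (t * (1 - p))) ^ (k * n)"
      using \<phi>1 by (intro power_mono) auto
  qed auto
  ultimately have "expectation (\<lambda>\<omega>. W n \<omega> ^ k) \<le>
      exp (card (pairs n) * (p * (1 - p) * t\<^sup>2 / 2 + t ^ 3)) / exp (t * (1 - p)) ^ (k * n) *
      exp ((b - 1) * k * (real k - 1) * n / m + k * Z)"
    unfolding expectation_W_power[OF n] t_def[symmetric] \<phi>_def[symmetric] b_def[symmetric]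
    using b1 by (intro mult_mono divide_nonneg_nonneg sum_nonneg) auto
  also have "\<dots> = exp (card (pairs n) * (p * (1 - p) * t\<^sup>2 / 2 + t ^ 3) - k * n * (t * (1 - p))
      + ((b - 1) * k * (real k - 1) * n / m + k * Z))"
    by (simp add: exp_add exp_diff flip: exp_of_nat_mult)
  also have "\<dots> \<le> exp (- (s * k * n / m) + 24 * k ^ 3 / (m * p ^ 3) + 2 * k / m * exp (96 * k / p))"
    unfolding exp_le_cancel_iff
  proof -
    \<comment> \<open>Unit of the cubic errors: 8 from the generating function and 16 from
      \<open>b - 1\<close> make the 24 of the statement. The 96 is \<open>16 * 3 * 2\<close>, from
      \<open>b - 1 \<le> 3 / p\<close> and \<open>r \<le> 2\<close>.\<close>
    define q where "q = k ^ 3 / (m * p ^ 3)"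
    have 1: "card (pairs n) * (p * (1 - p) * t\<^sup>2 / 2) = s * k\<^sup>2 * r"
      using m2 p_pos unfolding real_card_pairs
      by (simp add: s_def t_eq r_def nm field_simps power2_eq_square)
    have 2: "card (pairs n) * t ^ 3 \<le> 8 * q"
    proof -
      have "card (pairs n) * t ^ 3 = 4 * q * r"
        using m2 p_pos unfolding real_card_pairs
        by (simp add: q_def t_eq r_def nm field_simps power2_eq_square power3_eq_cube)
      also have "\<dots> \<le> 4 * q * 2" using r2 m2 p_pos by (intro mult_left_mono) (auto simp: q_def)
      finally show ?thesis by simp
    qed
    have 3: "k * n * (t * (1 - p)) = 2 * (s * k\<^sup>2 * r)"
      using m2 p_pos by (simp add: s_def t_eq r_def field_simps power2_eq_square)
    have 4: "(b - 1) * k * (real k - 1) * n / m \<le> s * k\<^sup>2 * r - s * k * r + 16 * q"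
    proof (cases "k = 0")
      case False
      then have k1: "1 \<le> real k" by simp
      have "(b - 1) * k * (real k - 1) * n / m = (b - 1) * (k * (real k - 1) * r)" by (simp add: r_def)
      also have "\<dots> \<le> (s + 4 * t / p) * (k * (real k - 1) * r)"
        using k1 r2 by (intro mult_right_mono b_le) auto
      also have "\<dots> = s * k\<^sup>2 * r - s * k * r + 4 * t / p * (k * (real k - 1) * r)"
        by (simp add: algebra_simps power2_eq_square)
      also have "4 * t / p * (k * (real k - 1) * r) \<le> 4 * t / p * (real k * real k * 2)"
        using k1 r2 t0 p_pos by (intro mult_left_mono mult_mono) auto
      also have "4 * t / p * (real k * real k * 2) = 16 * (k ^ 3 / (m * p ^ 2))"
        by (simp add: t_eq power2_eq_square power3_eq_cube)
      also have "k ^ 3 / (m * p ^ 2) \<le> q"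
        unfolding q_def using m2 p_pos p_less_1
        by (intro divide_left_mono mult_left_mono power_decreasing) auto
      finally show ?thesis by simp
    qed (use m2 p_pos in \<open>simp add: q_def\<close>)
    have 5: "k * Z \<le> 2 * k / m * exp (96 * k / p)"
    proof -
      have "16 * (b - 1) * k * n / m = 16 * ((b - 1) * r) * k" by (simp add: r_def)
      also have "\<dots> \<le> 16 * (3 / p * 2) * k"
        using b3 r2 b1 p_pos by (intro mult_right_mono mult_left_mono mult_mono) auto
      finally have "exp (16 * (b - 1) * k * n / m) \<le> exp (96 * k / p)" by simp
      then have "k * (2 / m) * exp (16 * (b - 1) * k * n / m) \<le> k * (2 / m) * exp (96 * k / p)"
        using m2 by (intro mult_left_mono) auto
      then show ?thesis by (simp add: Z_def mult_ac)
    qed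
    let ?E = "2 * k / m * exp (96 * k / p)"
    have "card (pairs n) * (p * (1 - p) * t\<^sup>2 / 2 + t ^ 3) - k * n * (t * (1 - p))
        + ((b - 1) * k * (real k - 1) * n / m + k * Z)
      \<le> s * k\<^sup>2 * r + 8 * q - 2 * (s * k\<^sup>2 * r) + (s * k\<^sup>2 * r - s * k * r + 16 * q + ?E)"
      unfolding distrib_left 1 3 by (intro add_mono diff_mono order_refl 2 4 5)
    also have "\<dots> = - (s * k * r) + 24 * q + ?E" by simp
    finally show "card (pairs n) * (p * (1 - p) * t\<^sup>2 / 2 + t ^ 3) - k * n * (t * (1 - p))
        + ((b - 1) * k * (real k - 1) * n / m + k * Z)
      \<le> - (s * k * n / m) + 24 * k ^ 3 / (m * p ^ 3) + ?E"
      by (simp add: r_def q_def)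
  qed
  finally show ?thesis by (simp add: s_def)
qed

text \<open>For \<open>k = 1\<close> there are no overlaps, so \<open>expectation_W_power\<close> is
  an explicit formula and only the generating function has to be estimated, below in the numerator
  and above in the denominator.\<close>

lemma W_mean_lower_bound:
  assumes n: "3 \<le> n" and k: "4 \<le> real (n - 1) * p"
  defines "m \<equiv> real (n - 1)"
  shows "exp (- ((1 - p) / p * n / m) - 60 / (m * p ^ 3)) \<le> expectation (W n)"
proof -
  define t where "t = slope n"
  define \<phi> where "\<phi> = edge_mgf (- t)"
  define s where "s = (1 - p) / p"
  define r where "r = real n / m"
  have m2: "2 \<le> m" using n by (simp add: m_def)
  have nm: "real n = m + 1" using n by (simp add: m_def)
  have r2: "0 < r" "r \<le> 2" using m2 by (auto simp: r_def nm field_simps)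
  have t_eq: "t = 2 / (m * p)" by (simp add: t_def slope_def m_def)
  have t0: "0 \<le> t" using m2 p_pos by (simp add: t_eq)
  have "4 \<le> m * p" using k unfolding m_def .
  then have t1: "t \<le> 1 / 2" using m2 p_pos by (simp add: t_eq field_simps)
  have \<phi>1: "1 \<le> \<phi>" unfolding \<phi>_def by (rule edge_mgf_ge_1)
  let ?S = "\<Sum>cs\<in>tuples n 1. (\<phi> * exp (t * (1 - p)) / p) ^ (1 * n - card (tuple_edges cs))"
  have "?S = (\<Sum>cs\<in>tuples n 1. 1)"
  proof (intro sum.cong refl)
    fix cs assume "cs \<in> tuples n 1"
    then obtain xs where "cs = [xs]" "xs \<in> permutations_of_set {1..n}"
      by (auto simp: tuples_def length_Suc_conv)
    then have "card (tuple_edges cs) = n"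
      using n card_cycle_edges[of xs] length_finite_permutations_of_set[of xs "{1..n}"]
      by (simp add: tuple_edges_def permutations_of_setD)
    then show "(\<phi> * exp (t * (1 - p)) / p) ^ (1 * n - card (tuple_edges cs)) = 1" by simp
  qed
  also have "\<dots> = fact n"
    by (simp add: tuples_def card_lists_length_eq)
  finally have S: "?S / fact n ^ 1 = 1" by simp
  have "expectation (\<lambda>\<omega>. W n \<omega> ^ 1) =
      \<phi> ^ card (pairs n) / (\<phi> * exp (t * (1 - p))) ^ (1 * n) * (?S / fact n ^ 1)"
    using expectation_W_power[OF n, of 1] by (simp only: t_def \<phi>_def of_nat_1 mult_1)
  then have "expectation (W n) = \<phi> ^ card (pairs n) / (\<phi> * exp (t * (1 - p))) ^ n"
    unfolding S by simp
  moreover have "exp (card (pairs n) * (p * (1 - p) * t\<^sup>2 / 2 - 5 * t ^ 3)) /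
      (exp (p * (1 - p) * t\<^sup>2 / 2 + t ^ 3) * exp (t * (1 - p))) ^ n \<le>
      \<phi> ^ card (pairs n) / (\<phi> * exp (t * (1 - p))) ^ n"
  proof (rule frac_le)
    show "exp (card (pairs n) * (p * (1 - p) * t\<^sup>2 / 2 - 5 * t ^ 3)) \<le> \<phi> ^ card (pairs n)"
      using edge_mgf_power_bounds(1)[of "- t" "card (pairs n)"] t0 t1 by (simp add: \<phi>_def)
    show "(\<phi> * exp (t * (1 - p))) ^ n \<le> (exp (p * (1 - p) * t\<^sup>2 / 2 + t ^ 3) * exp (t * (1 - p))) ^ n"
      using edge_mgf_power_bounds(2)[of "- t" 1] t0 t1 \<phi>1
      by (intro power_mono mult_right_mono) (auto simp: \<phi>_def)
  qed (use \<phi>1 in auto)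
  ultimately have "exp (card (pairs n) * (p * (1 - p) * t\<^sup>2 / 2 - 5 * t ^ 3)) /
      (exp (p * (1 - p) * t\<^sup>2 / 2 + t ^ 3) * exp (t * (1 - p))) ^ n \<le> expectation (W n)" by simp
  also have "exp (card (pairs n) * (p * (1 - p) * t\<^sup>2 / 2 - 5 * t ^ 3)) /
      (exp (p * (1 - p) * t\<^sup>2 / 2 + t ^ 3) * exp (t * (1 - p))) ^ n =
      exp (card (pairs n) * (p * (1 - p) * t\<^sup>2 / 2 - 5 * t ^ 3) -
        n * (p * (1 - p) * t\<^sup>2 / 2 + t ^ 3 + t * (1 - p)))"
    by (simp add: exp_diff flip: exp_of_nat_mult exp_add)
  finally have E: "exp (card (pairs n) * (p * (1 - p) * t\<^sup>2 / 2 - 5 * t ^ 3) -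
        n * (p * (1 - p) * t\<^sup>2 / 2 + t ^ 3 + t * (1 - p))) \<le> expectation (W n)" .
  define q where "q = 1 / (m * p ^ 3)"
  have q0: "0 < q" using m2 p_pos by (simp add: q_def)
  have 1: "card (pairs n) * (p * (1 - p) * t\<^sup>2 / 2) = s * r"
    using m2 p_pos unfolding real_card_pairs
    by (simp add: s_def t_eq r_def nm field_simps power2_eq_square)
  have 2: "card (pairs n) * t ^ 3 \<le> 8 * q"
  proof -
    have "card (pairs n) * t ^ 3 = 4 * q * r"
      using m2 p_pos unfolding real_card_pairs
      by (simp add: q_def t_eq r_def nm field_simps power2_eq_square power3_eq_cube)
    also have "\<dots> \<le> 4 * q * 2" using r2 q0 by (intro mult_left_mono) auto
    finally show ?thesis by simp
  qed
  have 3: "n * (t * (1 - p)) = 2 * s * r"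
    using m2 p_pos by (simp add: s_def t_eq r_def field_simps power2_eq_square)
  have 4: "n * (p * (1 - p) * t\<^sup>2 / 2) \<le> 4 * q"
  proof -
    have "n * (p * (1 - p) * t\<^sup>2 / 2) = 2 * (1 - p) * r / (m * p)"
      using m2 p_pos by (simp add: t_eq r_def field_simps power2_eq_square)
    also have "\<dots> \<le> 2 * 1 * 2 / (m * p ^ 3)"
    proof (rule frac_le)
      have "p ^ 3 \<le> p ^ 1" using p_pos p_less_1 by (intro power_decreasing) auto
      then show "m * p ^ 3 \<le> m * p" using m2 by (intro mult_left_mono) auto
      show "2 * (1 - p) * r \<le> 2 * 1 * 2" using p_pos p_less_1 r2 by (intro mult_mono) auto
    qed (use m2 p_pos in auto)
    finally show ?thesis by (simp add: q_def)
  qed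
  have 5: "n * t ^ 3 \<le> 16 * q"
  proof -
    have "n * t ^ 3 \<le> card (pairs n) * t ^ 3 * 2"
    proof -
      have "real n * 1 \<le> real n * (real n - 1)" using n by (intro mult_left_mono) auto
      then have "real n \<le> card (pairs n) * 2" using real_card_pairs[of n] by simp
      from mult_right_mono[OF this, of "t ^ 3"] show ?thesis using t0 by (simp add: mult_ac)
    qed
    then show ?thesis using 2 by simp
  qed
  \<comment> \<open>The 60 is \<open>5 * 8 + 4 + 16\<close>, from the facts 2, 4 and 5.\<close>
  have "- (s * n / m) - 60 / (m * p ^ 3) = - (s * r) - 60 * q" by (simp add: r_def q_def)
  also have "\<dots> \<le> card (pairs n) * (p * (1 - p) * t\<^sup>2 / 2) - 5 * (card (pairs n) * t ^ 3) -
      (n * (p * (1 - p) * t\<^sup>2 / 2) + n * t ^ 3 + n * (t * (1 - p)))"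
    using 1 2 3 4 5 q0 by linarith
  also have "\<dots> = card (pairs n) * (p * (1 - p) * t\<^sup>2 / 2 - 5 * t ^ 3) -
        n * (p * (1 - p) * t\<^sup>2 / 2 + t ^ 3 + t * (1 - p))"
    by (simp add: algebra_simps)
  finally show ?thesis using E unfolding s_def by (meson exp_le_cancel_iff order_trans)
qed

end

section \<open>Almost sure bounds for W, for all large n and along factorials\<close>

lemma (in prob_space) borel_cantelli_eventually:
  assumes A: "\<forall>\<^sub>F n in sequentially. A n \<in> events \<and> prob (A n) \<le> g n" and g: "summable g"
  shows "AE \<omega> in M. \<forall>\<^sub>F n in sequentially. \<omega> \<notin> A n"
proof -
  \<comment> \<open>Measurability of \<open>A n\<close> is known only for large \<open>n\<close>;
    the exceptional terms are emptied.\<close>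
  define B where "B n = (if A n \<in> events then A n else {})" for n
  have "summable (\<lambda>n. prob (B n))"
    using A by (intro summable_comparison_test_ev[OF _ g]) (auto elim!: eventually_mono simp: B_def)
  then have "AE \<omega> in M. \<forall>\<^sub>F n in sequentially. \<omega> \<in> space M - B n"
    by (intro borel_cantelli_AE1) (auto simp: B_def emeasure_eq_measure)
  then show ?thesis
  proof (eventually_elim)
    case (elim \<omega>)
    then show ?case using A by eventually_elim (auto simp: B_def split: if_splits)
  qed
qed

context nontrivial_random_graph
begin

lemma W_upper:
  assumes \<epsilon>: "0 < \<epsilon>"
  shows "AE \<omega> in M. \<forall>\<^sub>F n in sequentially. W n \<omega> < exp (\<epsilon> * sqrt (ln (ln (real n))))"
proof -
  \<comment> \<open>Then the threshold to the power \<open>x n\<close> is \<open>n ^ 3\<close>, and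
    Markov leaves a tail that is summable over all \<open>n\<close>; \<open>n ^ 2\<close> is what is
    used.\<close>
  define x where "x n = 3 * ln (real n) / (\<epsilon> * sqrt (ln (ln (real n))))" for n
  define k where "k n = nat \<lceil>x n\<rceil>" for n
  \<comment> \<open>Makes \<open>96 * k / p\<close> at most \<open>ln n / 4\<close>, so that the
    error \<open>exp (96 * k / p) * k / m\<close> of the moment bound tends to 0.\<close>
  define \<delta> where "\<delta> = p / 400"
  have \<delta>: "0 < \<delta>" using p_pos by (simp add: \<delta>_def)
  have k_le: "\<forall>\<^sub>F n in sequentially. real (k n) \<le> \<delta> * ln (real n)"
  proof -
    have "((\<lambda>n. 3 / (\<epsilon> * sqrt (ln (ln (real n)))) + 1 / ln (real n)) \<longlongrightarrow> 0) sequentially"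
      using \<epsilon> by real_asymp
    then have "\<forall>\<^sub>F n in sequentially. 3 / (\<epsilon> * sqrt (ln (ln (real n)))) + 1 / ln (real n) < \<delta>"
      using \<delta> by (rule order_tendstoD)
    moreover have "\<forall>\<^sub>F n in sequentially. 0 < ln (real n)" "\<forall>\<^sub>F n in sequentially. 0 < ln (ln (real n))"
      by real_asymp+
    ultimately show ?thesis
    proof eventually_elim
      case (elim n)
      have "0 \<le> x n" using elim \<epsilon> by (simp add: x_def)
      then have "real (k n) \<le> x n + 1" unfolding k_def by linarith
      also have "x n + 1 = (3 / (\<epsilon> * sqrt (ln (ln (real n)))) + 1 / ln (real n)) * ln (real n)"
        using elim by (simp add: x_def field_simps)
      also have "\<dots> \<le> \<delta> * ln (real n)" using elim by (intro mult_right_mono) auto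
      finally show ?case .
    qed
  qed
  have lim: "((\<lambda>n. 24 * (\<delta> * ln (real n)) ^ 3 / ((real n - 1) * p ^ 3) +
      2 * (\<delta> * ln (real n)) / (real n - 1) * exp (1 / 4 * ln (real n))) \<longlongrightarrow> 0) sequentially"
    using \<delta> p_pos by real_asymp
  have ev1: "\<forall>\<^sub>F n in sequentially. 4 * (\<delta> * ln (real n)) \<le> (real n - 1) * p"
    using \<delta> p_pos by real_asymp
  have "\<forall>\<^sub>F n in sequentially. {\<omega> \<in> space M. exp (\<epsilon> * sqrt (ln (ln (real n)))) \<le> W n \<omega>} \<in> events \<and>
      prob {\<omega> \<in> space M. exp (\<epsilon> * sqrt (ln (ln (real n)))) \<le> W n \<omega>} \<le> exp 1 * (1 / real n ^ 2)"
    using k_le ev1 order_tendstoD(2)[OF lim zero_less_one] eventually_ge_at_top[of 3]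
      eventually_gt_at_top[of 3]
  proof eventually_elim
    case (elim n)
    define \<tau> where "\<tau> = exp (\<epsilon> * sqrt (ln (ln (real n))))"
    have n: "3 \<le> n" by fact
    have m: "real (n - 1) = real n - 1" "2 \<le> real n - 1" using n by (auto simp: of_nat_diff)
    have lnn: "1 < ln (real n)"
    proof -
      have "exp 1 < real n" using e_less_272 n by linarith
      then show ?thesis using n ln_less_cancel_iff[of "exp 1" "real n"] by simp
    qed
    have [measurable]: "W n \<in> borel_measurable M" by (rule measurable_W[OF n])
    have ev: "{\<omega> \<in> space M. \<tau> \<le> W n \<omega>} \<in> events" by measurable
    have "real (4 * k n) \<le> real (n - 1) * p" using elim unfolding m(1) by simp
    from W_moment_bound[OF n this] have "expectation (\<lambda>\<omega>. W n \<omega> ^ k n) \<le>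
        exp (- ((1 - p) / p * k n * n / (real n - 1)) + 24 * k n ^ 3 / ((real n - 1) * p ^ 3) +
          2 * k n / (real n - 1) * exp (96 * k n / p))"
      unfolding m(1) by simp
    also have "\<dots> \<le> exp 1"
      unfolding exp_le_cancel_iff
    proof -
      have "0 \<le> (1 - p) / p * k n * n / (real n - 1)" using p_pos p_less_1 m by auto
      moreover have "24 * k n ^ 3 / ((real n - 1) * p ^ 3) \<le> 24 * (\<delta> * ln (real n)) ^ 3 / ((real n - 1) * p ^ 3)"
        using elim(1) m p_pos by (intro divide_right_mono) (auto intro!: power_mono)
      moreover have "2 * k n / (real n - 1) * exp (96 * k n / p) \<le>
          2 * (\<delta> * ln (real n)) / (real n - 1) * exp (1 / 4 * ln (real n))"
      proof (intro mult_mono divide_right_mono)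
        have "96 * k n / p \<le> 96 * (\<delta> * ln (real n)) / p"
          using elim(1) p_pos by (intro divide_right_mono) auto
        also have "\<dots> = 96 / 400 * ln (real n)" using p_pos by (simp add: \<delta>_def)
        also have "\<dots> \<le> 1 / 4 * ln (real n)" using lnn by simp
        finally show "exp (96 * k n / p) \<le> exp (1 / 4 * ln (real n))" by simp
      qed (use elim(1) m lnn \<delta> in auto)
      ultimately show "- ((1 - p) / p * k n * n / (real n - 1)) + 24 * k n ^ 3 / ((real n - 1) * p ^ 3) +
          2 * k n / (real n - 1) * exp (96 * k n / p) \<le> 1"
        using elim(3) by linarith
    qed
    finally have E: "expectation (\<lambda>\<omega>. W n \<omega> ^ k n) \<le> exp 1" .
    have "{\<omega> \<in> space M. \<tau> \<le> W n \<omega>} \<subseteq> {\<omega> \<in> space M. \<tau> ^ k n \<le> W n \<omega> ^ k n}"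
      by (auto intro!: power_mono simp: \<tau>_def)
    then have "prob {\<omega> \<in> space M. \<tau> \<le> W n \<omega>} \<le> prob {\<omega> \<in> space M. \<tau> ^ k n \<le> W n \<omega> ^ k n}"
      by (intro finite_measure_mono) measurable
    also have "\<dots> \<le> expectation (\<lambda>\<omega>. W n \<omega> ^ k n) / \<tau> ^ k n"
      using measurable_W[OF n] W_nonneg
      by (intro integral_Markov_inequality_measure[of _ _ "{}"]) (auto simp: \<tau>_def)
    also have "\<dots> \<le> exp 1 / real n ^ 2"
    proof (intro frac_le E)
      have "x n \<le> k n" unfolding k_def by linarith
      then have "\<epsilon> * sqrt (ln (ln (real n))) * x n \<le> \<epsilon> * sqrt (ln (ln (real n))) * k n"
        using \<epsilon> lnn by (intro mult_left_mono) auto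
      moreover have "0 < sqrt (ln (ln (real n)))" using lnn by simp
      then have "\<epsilon> * sqrt (ln (ln (real n))) * x n = 3 * ln (real n)"
        using \<epsilon> by (simp add: x_def)
      ultimately have "2 * ln (real n) \<le> k n * (\<epsilon> * sqrt (ln (ln (real n))))"
        using lnn by (simp add: mult_ac)
      then have "exp (2 * ln (real n)) \<le> \<tau> ^ k n" by (simp add: \<tau>_def flip: exp_of_nat_mult)
      moreover have "exp (2 * ln (real n)) = real n ^ 2"
        using n by (simp add: exp_of_nat_mult[of 2, simplified] )
      ultimately show "real n ^ 2 \<le> \<tau> ^ k n" by simp
    qed (use n in auto)
    finally show ?case using ev by (simp add: \<tau>_def)
  qed
  moreover have "summable (\<lambda>n. exp 1 * (1 / real n ^ 2))"
    by (intro summable_mult) (use inverse_power_summable[of 2, where 'a = real] in \<open>simp add: divide_inverse\<close>)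
  ultimately have "AE \<omega> in M. \<forall>\<^sub>F n in sequentially. \<omega> \<notin> {\<omega> \<in> space M. exp (\<epsilon> * sqrt (ln (ln (real n)))) \<le> W n \<omega>}"
    by (rule borel_cantelli_eventually)
  then show ?thesis
    by (rule AE_mp) (intro AE_I2 impI, auto elim!: eventually_mono simp: not_le)
qed

text \<open>The leading term of the second moment is the square of that of the mean, so their ratio
  is at most \<open>exp (a / m)\<close> and the relative variance is \<open>O(1 / m)\<close>. Since
  the mean is bounded below, Chebyshev gives a failure probability \<open>O(1 / n)\<close>, summable
  along factorials.\<close>

lemma W_lower:
  shows "\<exists>c>0. AE \<omega> in M. \<forall>\<^sub>F j in sequentially. c \<le> W (fact j) \<omega>"
proof -
  define s where "s = (1 - p) / p"
  \<comment> \<open>Half of a lower bound for the mean, valid for all \<open>n\<close> since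
    \<open>n / m \<le> 2\<close>; hence \<open>W n \<omega> < c\<close> forces a distance of at
    least half the mean.\<close>
  define c where "c = exp (- (2 * s) - 60 / p ^ 3) / 2"
  \<comment> \<open>The errors of \<open>W_moment_bound\<close> at \<open>k = 2\<close>, plus twice
    the error 60 of the mean, which gets squared.\<close>
  define a where "a = 192 / p ^ 3 + 4 * exp (192 / p) + 120 / p ^ 3"
  have a0: "0 < a" using p_pos by (simp add: a_def add_pos_pos)
  have s0: "0 < s" using p_pos p_less_1 by (simp add: s_def)
  have c0: "0 < c" by (simp add: c_def)
  have key: "{\<omega> \<in> space M. W n \<omega> < c} \<in> events \<and> prob {\<omega> \<in> space M. W n \<omega> < c} \<le> 16 * a * inverse (real n)"
    if n: "3 \<le> n" and n1: "8 \<le> real (n - 1) * p" and n2: "a \<le> real (n - 1)" for n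
  proof -
    define m where "m = real (n - 1)"
    define r where "r = real n / m"
    have m2: "2 \<le> m" using n by (simp add: m_def)
    have nm: "real n = m + 1" using n by (simp add: m_def)
    have r2: "0 < r" "r \<le> 2" using m2 by (auto simp: r_def nm field_simps)
    have [measurable]: "W n \<in> borel_measurable M" by (rule measurable_W[OF n])
    have int: "integrable M (\<lambda>\<omega>. (W n \<omega>)\<^sup>2)" "integrable M (W n)"
      using measurable_W(2)[OF n, of 2] measurable_W(2)[OF n, of 1] by simp_all
    define \<mu> where "\<mu> = expectation (W n)"
    have n1': "4 \<le> real (n - 1) * p" "real (4 * 2) \<le> real (n - 1) * p" using n1 by linarith+
    have \<mu>1: "exp (- (s * r) - 60 / p ^ 3 / m) \<le> \<mu>"
      using W_mean_lower_bound[OF n n1'(1)] by (simp add: \<mu>_def s_def r_def m_def mult_ac)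
    have "2 * c \<le> exp (- (s * r) - 60 / p ^ 3 / m)"
    proof -
      have "s * r \<le> s * 2" using s0 r2 by (intro mult_left_mono) auto
      moreover have "60 / p ^ 3 / m \<le> 60 / p ^ 3 / 1" using m2 p_pos by (intro divide_left_mono) auto
      ultimately have "- (2 * s) - 60 / p ^ 3 \<le> - (s * r) - 60 / p ^ 3 / m" by simp
      then show ?thesis by (simp add: c_def)
    qed
    then have \<mu>c: "2 * c \<le> \<mu>" using \<mu>1 by simp
    have \<mu>0: "0 < \<mu>" using \<mu>c c0 by simp
    have "(exp (- (s * r) - 60 / p ^ 3 / m))\<^sup>2 \<le> \<mu>\<^sup>2" using \<mu>1 by (intro power_mono) auto
    moreover have "2 * (- (s * r) - 60 / p ^ 3 / m) = - (2 * s * r) - 120 / p ^ 3 / m" by simp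
    ultimately have \<mu>2: "exp (- (2 * s * r) - 120 / p ^ 3 / m) \<le> \<mu>\<^sup>2"
      by (metis exp_double)
    have E2: "expectation (\<lambda>\<omega>. (W n \<omega>)\<^sup>2) \<le> exp (- (2 * s * r) + 192 / p ^ 3 / m + 4 * exp (192 / p) / m)"
      using W_moment_bound[OF n n1'(2)] by (simp add: s_def r_def m_def mult_ac)
    have "exp (- (2 * s * r) + 192 / p ^ 3 / m + 4 * exp (192 / p) / m) =
        exp (a / m) * exp (- (2 * s * r) - 120 / p ^ 3 / m)"
      by (simp add: a_def add_divide_distrib flip: exp_add)
    also have "\<dots> \<le> exp (a / m) * \<mu>\<^sup>2" using \<mu>2 by (intro mult_left_mono) auto
    also have "\<dots> \<le> (1 + 2 * (a / m)) * \<mu>\<^sup>2"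
    proof (intro mult_right_mono)
      have x: "0 \<le> a / m" "a / m \<le> 1" using a0 m2 n2 by (auto simp: m_def)
      then have "exp (a / m) \<le> 1 + a / m + (a / m)\<^sup>2" by (intro exp_bound)
      also have "(a / m)\<^sup>2 \<le> a / m * 1" unfolding power2_eq_square using x by (intro mult_left_mono) auto
      finally show "exp (a / m) \<le> 1 + 2 * (a / m)" by simp
    qed auto
    finally have "variance (W n) \<le> 2 * (a / m) * \<mu>\<^sup>2"
      using E2 variance_eq[OF int(2,1)] by (simp add: \<mu>_def algebra_simps)
    moreover have "prob {\<omega> \<in> space M. \<mu> / 2 \<le> \<bar>W n \<omega> - \<mu>\<bar>} \<le> variance (W n) / (\<mu> / 2)\<^sup>2"
      unfolding \<mu>_def using int \<mu>0 by (intro Chebyshev_inequality) (auto simp: \<mu>_def)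
    ultimately have "prob {\<omega> \<in> space M. \<mu> / 2 \<le> \<bar>W n \<omega> - \<mu>\<bar>} \<le> 2 * (a / m) * \<mu>\<^sup>2 / (\<mu> / 2)\<^sup>2"
      by (meson divide_right_mono order_trans zero_le_power2)
    also have "\<dots> = 8 * a * (1 / m)" using \<mu>0 by (simp add: power2_eq_square field_simps)
    also have "\<dots> \<le> 8 * a * (2 / real n)"
      using a0 m2 by (intro mult_left_mono) (auto simp: nm field_simps)
    also have "\<dots> = 16 * a * inverse (real n)" by (simp add: divide_inverse)
    finally have P: "prob {\<omega> \<in> space M. \<mu> / 2 \<le> \<bar>W n \<omega> - \<mu>\<bar>} \<le> 16 * a * inverse (real n)" .
    have "{\<omega> \<in> space M. W n \<omega> < c} \<subseteq> {\<omega> \<in> space M. \<mu> / 2 \<le> \<bar>W n \<omega> - \<mu>\<bar>}"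
    proof (intro Collect_mono impI, elim conjE, intro conjI)
      fix \<omega> assume "W n \<omega> < c"
      then show "\<mu> / 2 \<le> \<bar>W n \<omega> - \<mu>\<bar>" using \<mu>c by linarith
    qed
    then have "prob {\<omega> \<in> space M. W n \<omega> < c} \<le> prob {\<omega> \<in> space M. \<mu> / 2 \<le> \<bar>W n \<omega> - \<mu>\<bar>}"
      by (intro finite_measure_mono) measurable
    moreover have "{\<omega> \<in> space M. W n \<omega> < c} \<in> events" by measurable
    ultimately show ?thesis using P by simp
  qed
  have fj: "filterlim (fact :: nat \<Rightarrow> nat) at_top sequentially"
    by (rule filterlim_at_top_mono[OF filterlim_ident]) (simp add: fact_ge_self)
  have "\<forall>\<^sub>F n in sequentially. 8 \<le> (real n - 1) * p" "\<forall>\<^sub>F n in sequentially. a \<le> real n - 1"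
    using p_pos by real_asymp+
  then have "\<forall>\<^sub>F n in sequentially. 3 \<le> n \<and> 8 \<le> real (n - 1) * p \<and> a \<le> real (n - 1)"
    using eventually_ge_at_top[of 3] by eventually_elim (simp add: of_nat_diff)
  then have "\<forall>\<^sub>F j in sequentially. 3 \<le> (fact j :: nat) \<and> 8 \<le> real (fact j - 1) * p \<and> a \<le> real (fact j - 1)"
    using fj by (rule eventually_compose_filterlim)
  then have "\<forall>\<^sub>F j in sequentially. {\<omega> \<in> space M. W (fact j) \<omega> < c} \<in> events \<and>
      prob {\<omega> \<in> space M. W (fact j) \<omega> < c} \<le> 16 * a * inverse (fact j)"
  proof eventually_elim
    case (elim j)
    then show ?case using key[of "fact j"] by simp
  qed
  moreover have "summable (\<lambda>j. 16 * a * inverse (fact j) :: real)"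
    using summable_exp[of "1::real"] by (intro summable_mult) simp
  ultimately have "AE \<omega> in M. \<forall>\<^sub>F j in sequentially. \<omega> \<notin> {\<omega> \<in> space M. W (fact j) \<omega> < c}"
    by (rule borel_cantelli_eventually)
  then have "AE \<omega> in M. \<forall>\<^sub>F j in sequentially. c \<le> W (fact j) \<omega>"
    by (rule AE_mp) (intro AE_I2 impI, auto elim!: eventually_mono simp: not_less)
  then show ?thesis using c0 by blast
qed

end

section \<open>The law of the iterated logarithm for the number of edges\<close>

context nontrivial_random_graph
begin

text \<open>Doob's inequality for \<open>exp (t * deviation)\<close>, by splitting according to the
  first time the level \<open>a\<close> is reached. That event depends only on
  \<open>pairs i\<close>; the later edges are independent of it and have exponential moment at least
  1.\<close>

lemma prob_max_deviation_ge:
  assumes t: "0 \<le> t"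
  shows "{\<omega> \<in> space M. \<exists>i\<le>m. a \<le> deviation (pairs i) \<omega>} \<in> events"
    and "prob {\<omega> \<in> space M. \<exists>i\<le>m. a \<le> deviation (pairs i) \<omega>} \<le> exp (- (t * a)) * edge_mgf t ^ card (pairs m)"
proof -
  define z where "z i S = (\<Sum>e\<in>pairs i. of_bool (e \<in> S) - p)" for i and S :: "nat set set"
  have z: "deviation (pairs i) \<omega> = z i (G \<omega> \<inter> pairs j)" if "i \<le> j" for i j \<omega>
    using pairs_mono[OF that] unfolding deviation_def z_def by (intro sum.cong) auto
  define first where "first i \<omega> \<longleftrightarrow> a \<le> deviation (pairs i) \<omega> \<and> (\<forall>j<i. deviation (pairs j) \<omega> < a)" for i \<omega>
  have [measurable]: "deviation (pairs i) \<in> borel_measurable M" for i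
    by (rule measurable_deviation[OF finite_pairs pairs_subset])
  show ev: "{\<omega> \<in> space M. \<exists>i\<le>m. a \<le> deviation (pairs i) \<omega>} \<in> events" by measurable
  have evF [measurable]: "{\<omega> \<in> space M. first i \<omega>} \<in> events" for i unfolding first_def by measurable
  have step: "exp (t * a) * prob {\<omega> \<in> space M. first i \<omega>} \<le>
      expectation (\<lambda>\<omega>. of_bool (first i \<omega>) * exp (t * deviation (pairs m) \<omega>))" if "i \<le> m" for i
  proof -
    let ?A = "pairs i" and ?B = "pairs m - pairs i"
    have fin: "finite ?A" "?A \<subseteq> vertex_pairs" "finite ?B" "?B \<subseteq> vertex_pairs" "?A \<inter> ?B = {}"
      using pairs_subset[of i] pairs_subset[of m] by auto
    have un: "?A \<union> ?B = pairs m" using pairs_mono[OF that] by auto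
    define F where "F S = of_bool (a \<le> z i S \<and> (\<forall>j<i. z j S < a)) * exp (t * z i S)" for S
    define H where "H S = exp (t * (\<Sum>e\<in>?B. of_bool (e \<in> S) - p))" for S
    have F: "F (G \<omega> \<inter> ?A) = of_bool (first i \<omega>) * exp (t * deviation ?A \<omega>)" for \<omega>
      using z[of _ i \<omega>] by (auto simp: F_def first_def)
    have H: "H (G \<omega> \<inter> ?B) = exp (t * deviation ?B \<omega>)" for \<omega>
      unfolding H_def deviation_restrict[of ?B \<omega>] ..
    have FH: "F (G \<omega> \<inter> ?A) * H (G \<omega> \<inter> ?B) = of_bool (first i \<omega>) * exp (t * deviation (pairs m) \<omega>)" for \<omega>
      using deviation_union[OF fin(1,3,5), of \<omega>] unfolding F H un by (simp add: distrib_left exp_add)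
    have "exp (t * a) * prob {\<omega> \<in> space M. first i \<omega>} =
        expectation (\<lambda>\<omega>. exp (t * a) * indicator {\<omega> \<in> space M. first i \<omega>} \<omega>)"
      using sets.sets_into_space[OF evF] by (simp add: Int_absorb1)
    also have "\<dots> \<le> expectation (\<lambda>\<omega>. F (G \<omega> \<inter> ?A))"
    proof (intro integral_mono)
      show "integrable M (\<lambda>\<omega>. exp (t * a) * indicator {\<omega> \<in> space M. first i \<omega>} \<omega>)"
        by (intro integrable_mult_right integrable_real_indicator evF) (simp add: emeasure_eq_measure)
      show "integrable M (\<lambda>\<omega>. F (G \<omega> \<inter> ?A))" by (rule integrable_restrict[OF fin(1,2)])
      show "exp (t * a) * indicator {\<omega> \<in> space M. first i \<omega>} \<omega> \<le> F (G \<omega> \<inter> ?A)" for \<omega>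
        using t by (auto simp: F first_def indicator_def intro!: mult_left_mono)
    qed
    also have "\<dots> \<le> expectation (\<lambda>\<omega>. F (G \<omega> \<inter> ?A)) * expectation (\<lambda>\<omega>. H (G \<omega> \<inter> ?B))"
    proof -
      have "1 \<le> expectation (\<lambda>\<omega>. H (G \<omega> \<inter> ?B))"
        unfolding H mgf_deviation(2)[OF fin(3,4)] by (intro one_le_power edge_mgf_ge_1)
      moreover have "0 \<le> expectation (\<lambda>\<omega>. F (G \<omega> \<inter> ?A))"
        by (intro integral_nonneg_AE AE_I2) (simp add: F)
      ultimately show ?thesis by (simp add: mult_le_cancel_left1)
    qed
    also have "\<dots> = expectation (\<lambda>\<omega>. F (G \<omega> \<inter> ?A) * H (G \<omega> \<inter> ?B))"
      by (rule expectation_mult_restrict[OF fin, symmetric])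
    finally show ?thesis unfolding FH .
  qed
  have disj: "disjoint_family_on (\<lambda>i. {\<omega> \<in> space M. first i \<omega>}) {..m}"
    unfolding disjoint_family_on_def
  proof (intro ballI impI equals0I)
    fix i j \<omega> assume "i \<noteq> j" and *: "\<omega> \<in> {\<omega> \<in> space M. first i \<omega>} \<inter> {\<omega> \<in> space M. first j \<omega>}"
    then consider "i < j" | "j < i" by linarith
    then show False using * by cases (auto simp: first_def not_le[symmetric])
  qed
  have "{\<omega> \<in> space M. \<exists>i\<le>m. a \<le> deviation (pairs i) \<omega>} \<subseteq> (\<Union>i\<in>{..m}. {\<omega> \<in> space M. first i \<omega>})"
  proof
    fix \<omega> assume \<omega>: "\<omega> \<in> {\<omega> \<in> space M. \<exists>i\<le>m. a \<le> deviation (pairs i) \<omega>}"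
    define i where "i = (LEAST i. a \<le> deviation (pairs i) \<omega>)"
    obtain j where j: "j \<le> m" "a \<le> deviation (pairs j) \<omega>" using \<omega> by auto
    have "a \<le> deviation (pairs i) \<omega>" unfolding i_def using j(2) by (rule LeastI)
    moreover have "deviation (pairs l) \<omega> < a" if "l < i" for l
      using not_less_Least[OF that[unfolded i_def]] by simp
    moreover have "i \<le> j" unfolding i_def using j(2) by (rule Least_le)
    ultimately show "\<omega> \<in> (\<Union>i\<in>{..m}. {\<omega> \<in> space M. first i \<omega>})" using \<omega> j by (auto simp: first_def)
  qed
  then have "prob {\<omega> \<in> space M. \<exists>i\<le>m. a \<le> deviation (pairs i) \<omega>} \<le> prob (\<Union>i\<in>{..m}. {\<omega> \<in> space M. first i \<omega>})"
    by (intro finite_measure_mono) auto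
  also have "\<dots> = (\<Sum>i\<le>m. prob {\<omega> \<in> space M. first i \<omega>})"
    using disj by (intro finite_measure_finite_Union) auto
  finally have "exp (t * a) * prob {\<omega> \<in> space M. \<exists>i\<le>m. a \<le> deviation (pairs i) \<omega>} \<le>
      (\<Sum>i\<le>m. exp (t * a) * prob {\<omega> \<in> space M. first i \<omega>})"
    by (simp flip: sum_distrib_left)
  also have "\<dots> \<le> (\<Sum>i\<le>m. expectation (\<lambda>\<omega>. of_bool (first i \<omega>) * exp (t * deviation (pairs m) \<omega>)))"
    by (intro sum_mono step) simp
  also have "\<dots> = expectation (\<lambda>\<omega>. \<Sum>i\<le>m. of_bool (first i \<omega>) * exp (t * deviation (pairs m) \<omega>))"
  proof (rule Bochner_Integration.integral_sum[symmetric])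
    fix i
    show "integrable M (\<lambda>\<omega>. of_bool (first i \<omega>) * exp (t * deviation (pairs m) \<omega>))"
    proof (rule Bochner_Integration.integrable_bound[OF mgf_deviation(1)[OF finite_pairs pairs_subset, of t m]])
      have "(\<lambda>\<omega>. of_bool (first i \<omega>) :: real) \<in> borel_measurable M"
        unfolding of_bool_def by measurable
      then show "(\<lambda>\<omega>. of_bool (first i \<omega>) * exp (t * deviation (pairs m) \<omega>)) \<in> borel_measurable M"
        by measurable
    qed (auto simp: of_bool_def)
  qed
  also have "\<dots> \<le> expectation (\<lambda>\<omega>. exp (t * deviation (pairs m) \<omega>))"
  proof (rule integral_mono')
    show "integrable M (\<lambda>\<omega>. exp (t * deviation (pairs m) \<omega>))"
      by (rule mgf_deviation[OF finite_pairs pairs_subset])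
    fix \<omega>
    have "(\<Sum>i\<le>m. of_bool (first i \<omega>) :: real) \<le> 1"
    proof (cases "\<exists>i\<le>m. first i \<omega>")
      case True
      then obtain i where i: "i \<le> m" "first i \<omega>" by blast
      have "j = i" if "first j \<omega>" for j
        using that i(2) unfolding first_def by (meson linorder_neqE_nat not_le)
      then have "first j \<omega> \<longleftrightarrow> j = i" for j using i(2) by blast
      then show ?thesis by (simp add: of_bool_def)
    qed auto
    then show "(\<Sum>i\<le>m. of_bool (first i \<omega>) * exp (t * deviation (pairs m) \<omega>)) \<le> exp (t * deviation (pairs m) \<omega>)"
      unfolding sum_distrib_right[symmetric] by (simp add: mult_le_cancel_right1)
  qed auto
  also have "\<dots> = edge_mgf t ^ card (pairs m)" by (rule mgf_deviation[OF finite_pairs pairs_subset])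
  finally show "prob {\<omega> \<in> space M. \<exists>i\<le>m. a \<le> deviation (pairs i) \<omega>} \<le> exp (- (t * a)) * edge_mgf t ^ card (pairs m)"
    by (simp add: exp_minus field_simps)
qed

text \<open>The variance is \<open>p * (1 - p) * n * (n - 1) / 2\<close>, so the root is the usual
  \<open>sqrt (2 * variance * ln (ln n))\<close>. The maximal inequality is applied up to the end of
  each geometric block, with the level taken at its beginning.\<close>

lemma deviation_upper:
  assumes \<epsilon>: "0 < \<epsilon>"
  shows "AE \<omega> in M. \<forall>\<^sub>F n in sequentially.
    deviation (pairs n) \<omega> < (1 + \<epsilon>) * sqrt (p * (1 - p) * (real n * (real n - 1)) * ln (ln (real n)))"
proof -
  \<comment> \<open>The variance grows by about \<open>\<rho>\<^sup>2 = 1 + \<epsilon>\<close> over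
    a block. This uses up one of the two factors \<open>1 + \<epsilon>\<close> in the squared level,
    and the other one makes the tails summable.\<close>
  define \<rho> where "\<rho> = sqrt (1 + \<epsilon>)"
  have \<rho>: "1 < \<rho>" "\<rho>\<^sup>2 = 1 + \<epsilon>" using \<epsilon> by (auto simp: \<rho>_def)
  define v where "v = p * (1 - p)"
  have v: "0 < v" using p_pos p_less_1 by (simp add: v_def)
  define a where "a y = (1 + \<epsilon>) * sqrt (v * (y * (y - 1)) * ln (ln y))" for y :: real
  \<comment> \<open>Upper bound for the variance at the end of the block that starts in
    \<open>y\<close>; \<open>t = a / D\<close> is the optimal Chernoff parameter.\<close>
  define D where "D y = v * \<rho>\<^sup>2 * y\<^sup>2 / 2" for y :: real
  define t where "t y = a y / D y" for y
  define m where "m k = nat \<lfloor>\<rho> ^ Suc k\<rfloor>" for k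
  have lim1: "(t \<longlongrightarrow> 0) at_top"
    unfolding t_def a_def D_def using v \<epsilon> \<rho>(1) by real_asymp
  have lim2: "((\<lambda>y. \<rho>\<^sup>2 * y\<^sup>2 / 2 * t y ^ 3) \<longlongrightarrow> 0) at_top"
    unfolding t_def a_def D_def using v \<epsilon> \<rho>(1) by real_asymp
  have lim3: "((\<lambda>y::real. (1 + \<epsilon>) * (1 - 1 / y)) \<longlongrightarrow> (1 + \<epsilon>) * (1 - 0)) at_top"
    by (intro tendsto_intros) real_asymp
  have half: "0 < (1 / 2 :: real)" "1 + \<epsilon> / 2 < (1 + \<epsilon>) * (1 - 0)" using \<epsilon> by auto
  have "\<forall>\<^sub>F y in at_top. 0 \<le> t y \<and> t y \<le> 1 / 2 \<and> - (t y * a y) + \<rho>\<^sup>2 * y\<^sup>2 / 2 * (v * (t y)\<^sup>2 / 2 + t y ^ 3)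
      \<le> - ((1 + \<epsilon> / 2) * ln (ln y)) + 1"
    using order_tendstoD(2)[OF lim1 half(1)] order_tendstoD(2)[OF lim2 zero_less_one]
      order_tendstoD(1)[OF lim3 half(2)] eventually_gt_at_top[of "exp 1 :: real"]
  proof eventually_elim
    case (elim y)
    have y: "1 < y" using elim(4) exp_gt_one[of 1] by linarith
    have "1 < ln y" using elim(4) y ln_less_cancel_iff[of "exp 1" y] by simp
    then have lnln: "0 < ln (ln y)" by simp
    have a0: "0 \<le> a y" using v y lnln \<epsilon> by (simp add: a_def)
    have D0: "0 < D y" unfolding D_def \<rho>(2) using v y \<epsilon> by simp
    have "- (t y * a y) + \<rho>\<^sup>2 * y\<^sup>2 / 2 * (v * (t y)\<^sup>2 / 2 + t y ^ 3) =
        - (t y * a y) + D y * (t y)\<^sup>2 / 2 + \<rho>\<^sup>2 * y\<^sup>2 / 2 * t y ^ 3"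
      by (simp add: D_def field_simps)
    also have "- (t y * a y) + D y * (t y)\<^sup>2 / 2 = - ((a y)\<^sup>2 / (2 * D y))"
      using D0 by (simp add: t_def power2_eq_square field_simps)
    also have "(a y)\<^sup>2 / (2 * D y) = (1 + \<epsilon>) * (1 - 1 / y) * ln (ln y)"
    proof -
      have "(a y)\<^sup>2 = (1 + \<epsilon>)\<^sup>2 * (v * (y * (y - 1)) * ln (ln y))"
        using v y lnln by (simp add: a_def power_mult_distrib)
      also have "\<dots> / (2 * D y) = (1 + \<epsilon>) * (1 - 1 / y) * ln (ln y)"
      proof -
        have "F\<^sup>2 * (v * (y * (y - 1)) * l) / (2 * (v * F * y\<^sup>2 / 2)) = F * (1 - 1 / y) * l"
          if "0 < F" for F l
          using v y that by (simp add: power2_eq_square field_simps)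
        then show ?thesis unfolding D_def \<rho>(2) using \<epsilon> by simp
      qed
      finally show ?thesis .
    qed
    also have "- ((1 + \<epsilon>) * (1 - 1 / y) * ln (ln y)) + \<rho>\<^sup>2 * y\<^sup>2 / 2 * t y ^ 3 \<le> - ((1 + \<epsilon> / 2) * ln (ln y)) + 1"
      using elim(2,3) lnln by (intro add_mono le_imp_neg_le mult_right_mono) auto
    finally show ?case using elim(1) a0 D0 by (simp add: t_def)
  qed
  moreover have lim_y: "filterlim (\<lambda>k. \<rho> ^ k) at_top sequentially"
    using \<rho>(1) by (rule filterlim_realpow_sequentially_gt1[unfolded real_norm_def, simplified] | real_asymp)
  ultimately have ev: "\<forall>\<^sub>F k in sequentially. 0 \<le> t (\<rho> ^ k) \<and> t (\<rho> ^ k) \<le> 1 / 2 \<and>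
      - (t (\<rho> ^ k) * a (\<rho> ^ k)) + \<rho>\<^sup>2 * (\<rho> ^ k)\<^sup>2 / 2 * (v * (t (\<rho> ^ k))\<^sup>2 / 2 + t (\<rho> ^ k) ^ 3)
      \<le> - ((1 + \<epsilon> / 2) * ln (ln (\<rho> ^ k))) + 1"
    by (rule eventually_compose_filterlim)
  define C where "C = exp 1 * ln \<rho> powr - (1 + \<epsilon> / 2)"
  have "\<forall>\<^sub>F k in sequentially. {\<omega> \<in> space M. \<exists>i\<le>m k. a (\<rho> ^ k) \<le> deviation (pairs i) \<omega>} \<in> events \<and>
    prob {\<omega> \<in> space M. \<exists>i\<le>m k. a (\<rho> ^ k) \<le> deviation (pairs i) \<omega>} \<le> C * real k powr - (1 + \<epsilon> / 2)"
    using ev eventually_gt_at_top[of 0]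
  proof eventually_elim
    case (elim k)
    define y where "y = \<rho> ^ k"
    have y1: "1 \<le> y" using \<rho> by (simp add: y_def)
    have t: "0 \<le> t y" "t y \<le> 1 / 2"
      and B: "- (t y * a y) + \<rho>\<^sup>2 * y\<^sup>2 / 2 * (v * (t y)\<^sup>2 / 2 + t y ^ 3) \<le> - ((1 + \<epsilon> / 2) * ln (ln y)) + 1"
      using elim unfolding y_def by auto
    have "real (card (pairs (m k))) \<le> \<rho>\<^sup>2 * y\<^sup>2 / 2"
    proof -
      have "real (m k) \<le> \<rho> * y" using \<rho> y1 by (simp add: m_def y_def)
      then have "real (m k) * real (m k) \<le> (\<rho> * y) * (\<rho> * y)" by (intro mult_mono) auto
      moreover have "real (m k) * (real (m k) - 1) \<le> real (m k) * real (m k)"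
        by (intro mult_left_mono) auto
      ultimately have "real (m k) * (real (m k) - 1) \<le> (\<rho> * y) * (\<rho> * y)" by linarith
      then have "real (m k) * (real (m k) - 1) / 2 \<le> (\<rho> * y) * (\<rho> * y) / 2"
        by (rule divide_right_mono) simp
      also have "(\<rho> * y) * (\<rho> * y) = \<rho>\<^sup>2 * y\<^sup>2" by (simp add: power2_eq_square)
      finally show ?thesis unfolding real_card_pairs .
    qed
    then have c: "real (card (pairs (m k))) * (v * (t y)\<^sup>2 / 2 + t y ^ 3) \<le> \<rho>\<^sup>2 * y\<^sup>2 / 2 * (v * (t y)\<^sup>2 / 2 + t y ^ 3)"
      using t v by (intro mult_right_mono) auto
    have "prob {\<omega> \<in> space M. \<exists>i\<le>m k. a y \<le> deviation (pairs i) \<omega>} \<le> exp (- (t y * a y)) * edge_mgf (t y) ^ card (pairs (m k))"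
      by (rule prob_max_deviation_ge(2)[OF t(1)])
    also have "\<dots> \<le> exp (- (t y * a y)) * exp (real (card (pairs (m k))) * (v * (t y)\<^sup>2 / 2 + t y ^ 3))"
      using edge_mgf_power_bounds(2)[of "t y" "card (pairs (m k))"] t by (simp add: v_def)
    also have "\<dots> = exp (- (t y * a y) + real (card (pairs (m k))) * (v * (t y)\<^sup>2 / 2 + t y ^ 3))"
      by (rule exp_add[symmetric])
    also have "\<dots> \<le> exp (- ((1 + \<epsilon> / 2) * ln (ln y)) + 1)"
      unfolding exp_le_cancel_iff using add_left_mono[OF c] B by (rule order_trans)
    also have "\<dots> = C * real k powr - (1 + \<epsilon> / 2)"
    proof -
      have "ln y = real k * ln \<rho>" using \<rho> by (simp add: y_def ln_realpow)
      moreover have "0 < ln \<rho>" "0 < real k" using \<rho> elim by auto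
      ultimately have "ln (ln y) = ln (real k) + ln (ln \<rho>)" by (simp add: ln_mult)
      then have "- ((1 + \<epsilon> / 2) * ln (ln y)) + 1 = 1 + - (1 + \<epsilon> / 2) * ln (ln \<rho>) + - (1 + \<epsilon> / 2) * ln (real k)"
        by (simp add: algebra_simps)
      then show ?thesis using \<open>0 < ln \<rho>\<close> \<open>0 < real k\<close>
        by (simp only: exp_add C_def powr_def) simp
    qed
    finally show ?case
      using prob_max_deviation_ge(1)[OF t(1), of "m k" "a y"] unfolding y_def by (intro conjI)
  qed
  moreover have "summable (\<lambda>k. C * real k powr - (1 + \<epsilon> / 2))"
    using \<epsilon> by (intro summable_mult) (simp add: summable_real_powr_iff)
  ultimately have "AE \<omega> in M. \<forall>\<^sub>F k in sequentially. \<omega> \<notin> {\<omega> \<in> space M. \<exists>i\<le>m k. a (\<rho> ^ k) \<le> deviation (pairs i) \<omega>}"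
    by (rule borel_cantelli_eventually)
  then show ?thesis
  proof (rule AE_mp, intro AE_I2 impI)
    fix \<omega> assume \<omega>: "\<omega> \<in> space M"
      and bc: "\<forall>\<^sub>F k in sequentially. \<omega> \<notin> {\<omega> \<in> space M. \<exists>i\<le>m k. a (\<rho> ^ k) \<le> deviation (pairs i) \<omega>}"
    have "\<forall>\<^sub>F k in sequentially. exp 1 < \<rho> ^ k"
      using lim_y by (simp add: filterlim_at_top_dense)
    with bc have "\<forall>\<^sub>F k in sequentially. exp 1 < \<rho> ^ k \<and> (\<forall>i\<le>m k. deviation (pairs i) \<omega> < a (\<rho> ^ k))"
      by eventually_elim (use \<omega> in \<open>force simp: not_le\<close>)
    then obtain K where K: "\<And>k i. K \<le> k \<Longrightarrow> exp 1 < \<rho> ^ k" "\<And>k i. \<lbrakk>K \<le> k; i \<le> m k\<rbrakk> \<Longrightarrow> deviation (pairs i) \<omega> < a (\<rho> ^ k)"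
      by (auto simp: eventually_sequentially)
    show "\<forall>\<^sub>F n in sequentially. deviation (pairs n) \<omega> < (1 + \<epsilon>) * sqrt (p * (1 - p) * (real n * (real n - 1)) * ln (ln (real n)))"
      unfolding eventually_sequentially
    proof (intro exI allI impI)
      fix n assume n: "nat \<lceil>\<rho> ^ K\<rceil> \<le> n"
      have nK: "\<rho> ^ K \<le> real n" using n by linarith
      have n1: "1 \<le> real n" using nK \<rho> one_le_power[of \<rho> K] by linarith
      define k where "k = nat \<lfloor>log \<rho> (real n)\<rfloor>"
      have l0: "0 \<le> log \<rho> (real n)" using \<rho> n1 by simp
      have k: "real k \<le> log \<rho> (real n)" "log \<rho> (real n) < real k + 1"
        using l0 unfolding k_def by linarith+
      have "\<rho> powr real k \<le> real n" using k(1) \<rho> n1 by (simp add: le_log_iff)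
      then have y: "\<rho> ^ k \<le> real n" using \<rho> by (simp add: powr_realpow)
      have "real n < \<rho> powr real (Suc k)" using k(2) \<rho> n1 by (simp add: log_less_iff add.commute)
      then have "real n < \<rho> ^ Suc k" using \<rho> by (simp add: powr_realpow del: power_Suc of_nat_Suc)
      then have nm: "n \<le> m k" unfolding m_def by linarith
      have "real K \<le> log \<rho> (real n)"
        using nK \<rho> n1 by (simp add: le_log_iff powr_realpow)
      then have kK: "K \<le> k" unfolding k_def by linarith
      have e: "exp 1 < \<rho> ^ k" using K(1)[OF kK] .
      have y1: "1 < \<rho> ^ k" using e exp_gt_one[of 1] by linarith
      have "1 < ln (\<rho> ^ k)" using e y1 ln_less_cancel_iff[of "exp 1" "\<rho> ^ k"] by simp
      moreover have "ln (\<rho> ^ k) \<le> ln (real n)" using y y1 by simp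
      ultimately have "ln (ln (\<rho> ^ k)) \<le> ln (ln (real n))" "0 < ln (ln (\<rho> ^ k))" by simp_all
      moreover have "\<rho> ^ k * (\<rho> ^ k - 1) \<le> real n * (real n - 1)" using y y1 by (intro mult_mono) auto
      ultimately have "a (\<rho> ^ k) \<le> a (real n)"
        unfolding a_def using v \<epsilon> y y1 n1
        by (intro mult_left_mono real_sqrt_le_mono mult_mono) auto
      then show "deviation (pairs n) \<omega> < (1 + \<epsilon>) * sqrt (p * (1 - p) * (real n * (real n - 1)) * ln (ln (real n)))"
        using K(2)[OF kK nm] by (simp add: a_def v_def)
    qed
  qed
qed

text \<open>Replaces a change of measure: the part of \<open>exp (t * S)\<close> outside the window
  \<open>t * v * (1 - \<delta>) \<le> S \<le> t * v * (1 + \<delta>)\<close> is dominated by exponentials with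
  parameters \<open>(1 \<plusminus> \<delta>) * t\<close>.\<close>

lemma deviation_lower_tail:
  assumes A: "finite A" "A \<subseteq> vertex_pairs"
  defines "N \<equiv> real (card A)" and "v \<equiv> p * (1 - p) * real (card A)"
  assumes t: "0 < t" and \<delta>: "0 < \<delta>" "\<delta> < 1" and small: "t * (1 + \<delta>) \<le> 1 / 2"
    and h1: "3 / 4 \<le> exp (- (5 * N * t ^ 3))" and h2: "exp (8 * N * t ^ 3 - \<delta>\<^sup>2 * t\<^sup>2 * v / 2) \<le> 1 / 8"
  shows "exp (- (t\<^sup>2 * v * (1 + 2 * \<delta>) / 2)) / 2 \<le> prob {\<omega> \<in> space M. t * v * (1 - \<delta>) \<le> deviation A \<omega>}"
proof -
  define a where "a = t * v * (1 - \<delta>)"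
  define b where "b = t * v * (1 + \<delta>)"
  define X where "X = exp (t\<^sup>2 * v / 2)"
  let ?S = "deviation A"
  let ?E = "{\<omega> \<in> space M. a \<le> ?S \<omega>}"
  have N0: "0 \<le> N" by (simp add: N_def)
  have v_eq: "v = N * (p * (1 - p))" by (simp add: v_def N_def)
  have [measurable]: "?S \<in> borel_measurable M" by (rule measurable_deviation[OF A])
  have ev: "?E \<in> events" by measurable
  note int = mgf_deviation(1)[OF A]
  \<comment> \<open>The three summands cover the window, the part below \<open>a\<close> and the
    part above \<open>b\<close>.\<close>
  have pt: "exp (t * ?S \<omega>) \<le> exp (t * b) * indicator ?E \<omega> + exp (\<delta> * t * a) * exp ((1 - \<delta>) * t * ?S \<omega>)
      + exp (- (\<delta> * t * b)) * exp ((1 + \<delta>) * t * ?S \<omega>)" if "\<omega> \<in> space M" for \<omega>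
  proof -
    consider "?S \<omega> < a" | "b < ?S \<omega>" | "a \<le> ?S \<omega>" "?S \<omega> \<le> b" by linarith
    then show ?thesis
    proof cases
      case 1
      have "t * ?S \<omega> = \<delta> * t * ?S \<omega> + (1 - \<delta>) * t * ?S \<omega>" by (simp add: algebra_simps)
      also have "\<dots> \<le> \<delta> * t * a + (1 - \<delta>) * t * ?S \<omega>"
        using 1 t \<delta> by (intro add_right_mono mult_left_mono) auto
      finally have "exp (t * ?S \<omega>) \<le> exp (\<delta> * t * a) * exp ((1 - \<delta>) * t * ?S \<omega>)" by (simp flip: exp_add)
      moreover have "0 \<le> exp (t * b) * (indicator ?E \<omega> :: real)" by simp
      moreover have "0 \<le> exp (- (\<delta> * t * b)) * exp ((1 + \<delta>) * t * ?S \<omega>)" by simp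
      ultimately show ?thesis by linarith
    next
      case 2
      have "t * ?S \<omega> = - (\<delta> * t * ?S \<omega>) + (1 + \<delta>) * t * ?S \<omega>" by (simp add: algebra_simps)
      also have "\<dots> \<le> - (\<delta> * t * b) + (1 + \<delta>) * t * ?S \<omega>"
        using 2 t \<delta> by (intro add_right_mono le_imp_neg_le mult_left_mono) auto
      finally have "exp (t * ?S \<omega>) \<le> exp (- (\<delta> * t * b)) * exp ((1 + \<delta>) * t * ?S \<omega>)" by (simp flip: exp_add)
      moreover have "0 \<le> exp (t * b) * (indicator ?E \<omega> :: real)" by simp
      moreover have "0 \<le> exp (\<delta> * t * a) * exp ((1 - \<delta>) * t * ?S \<omega>)" by simp
      ultimately show ?thesis by linarith
    next
      case 3
      then have "exp (t * ?S \<omega>) \<le> exp (t * b) * indicator ?E \<omega>" using that t by simp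
      moreover have "0 \<le> exp (\<delta> * t * a) * exp ((1 - \<delta>) * t * ?S \<omega>)" by simp
      moreover have "0 \<le> exp (- (\<delta> * t * b)) * exp ((1 + \<delta>) * t * ?S \<omega>)" by simp
      ultimately show ?thesis by linarith
    qed
  qed
  have "expectation (\<lambda>\<omega>. exp (t * ?S \<omega>)) \<le> expectation (\<lambda>\<omega>. exp (t * b) * indicator ?E \<omega> +
      exp (\<delta> * t * a) * exp ((1 - \<delta>) * t * ?S \<omega>) + exp (- (\<delta> * t * b)) * exp ((1 + \<delta>) * t * ?S \<omega>))"
    using ev by (intro integral_mono pt int Bochner_Integration.integrable_add integrable_mult_right
        integrable_real_indicator) (auto simp: emeasure_eq_measure)
  also have "\<dots> = exp (t * b) * prob ?E + exp (\<delta> * t * a) * edge_mgf ((1 - \<delta>) * t) ^ card A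
      + exp (- (\<delta> * t * b)) * edge_mgf ((1 + \<delta>) * t) ^ card A"
    using ev int sets.sets_into_space[OF ev]
    by (subst Bochner_Integration.integral_add,
        (intro int Bochner_Integration.integrable_add integrable_mult_right integrable_real_indicator;
          simp add: emeasure_eq_measure)+,
        subst Bochner_Integration.integral_add,
        (intro int Bochner_Integration.integrable_add integrable_mult_right integrable_real_indicator;
          simp add: emeasure_eq_measure)+)
      (simp add: mgf_deviation(2)[OF A] Int_absorb1)
  finally have main: "edge_mgf t ^ card A \<le> exp (t * b) * prob ?E + exp (\<delta> * t * a) * edge_mgf ((1 - \<delta>) * t) ^ card A
      + exp (- (\<delta> * t * b)) * edge_mgf ((1 + \<delta>) * t) ^ card A"
    by (simp only: mgf_deviation(2)[OF A])
  have t\<delta>: "t \<le> t * (1 + \<delta>)" "0 \<le> (1 - \<delta>) * t" "(1 - \<delta>) * t \<le> t * (1 + \<delta>)"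
    using t \<delta> by (auto simp: algebra_simps)
  have cube: "((1 - \<delta>) * t) ^ 3 \<le> 8 * t ^ 3" "((1 + \<delta>) * t) ^ 3 \<le> 8 * t ^ 3"
  proof -
    have "((1 - \<delta>) * t) ^ 3 \<le> (2 * t) ^ 3" "((1 + \<delta>) * t) ^ 3 \<le> (2 * t) ^ 3"
      using t \<delta> by (intro power_mono mult_right_mono; simp)+
    then show "((1 - \<delta>) * t) ^ 3 \<le> 8 * t ^ 3" "((1 + \<delta>) * t) ^ 3 \<le> 8 * t ^ 3"
      by (simp_all add: power_mult_distrib)
  qed
  have "X * (3 / 4) \<le> X * exp (- (5 * N * t ^ 3))" using h1 by (intro mult_left_mono) (auto simp: X_def)
  also have "\<dots> = exp (N * (p * (1 - p) * t\<^sup>2 / 2 - 5 * t ^ 3))"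
    unfolding X_def v_eq exp_add[symmetric] by (simp add: algebra_simps)
  also have "\<dots> \<le> edge_mgf t ^ card A"
    using edge_mgf_power_bounds(1)[of t "card A"] t small t\<delta> by (simp add: N_def)
  finally have E1: "X * (3 / 4) \<le> edge_mgf t ^ card A" .
  \<comment> \<open>The quadratic exponents \<open>\<delta> * t * a\<close> and
    \<open>((1 - \<delta>) * t)^2 * v / 2\<close> add up to
    \<open>(1 - \<delta>^2) * t^2 * v / 2\<close>. The gain
    \<open>exp (- (\<delta>^2 * t^2 * v / 2))\<close> over \<open>X\<close> outweighs the cubic
    error by \<open>h2\<close>; the part above the window has the same gain.\<close>
  have E2: "exp (\<delta> * t * a) * edge_mgf ((1 - \<delta>) * t) ^ card A \<le> X * (1 / 8)"
  proof -
    have "exp (\<delta> * t * a) * edge_mgf ((1 - \<delta>) * t) ^ card A \<le>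
        exp (\<delta> * t * a) * exp (N * (p * (1 - p) * ((1 - \<delta>) * t)\<^sup>2 / 2 + ((1 - \<delta>) * t) ^ 3))"
      using edge_mgf_power_bounds(2)[of "(1 - \<delta>) * t" "card A"] small t\<delta>
      by (intro mult_left_mono) (auto simp: N_def)
    also have "\<dots> \<le> exp (\<delta> * t * a) * exp (N * (p * (1 - p) * ((1 - \<delta>) * t)\<^sup>2 / 2 + 8 * t ^ 3))"
      using cube N0 by (intro mult_left_mono) (auto intro!: mult_left_mono)
    also have "\<dots> = X * exp (8 * N * t ^ 3 - \<delta>\<^sup>2 * t\<^sup>2 * v / 2)"
      unfolding X_def a_def v_eq exp_add[symmetric]
      by (rule arg_cong[where f = exp]) (simp add: power2_eq_square field_simps)
    also have "\<dots> \<le> X * (1 / 8)" using h2 by (intro mult_left_mono) (auto simp: X_def)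
    finally show ?thesis .
  qed
  have E3: "exp (- (\<delta> * t * b)) * edge_mgf ((1 + \<delta>) * t) ^ card A \<le> X * (1 / 8)"
  proof -
    have "exp (- (\<delta> * t * b)) * edge_mgf ((1 + \<delta>) * t) ^ card A \<le>
        exp (- (\<delta> * t * b)) * exp (N * (p * (1 - p) * ((1 + \<delta>) * t)\<^sup>2 / 2 + ((1 + \<delta>) * t) ^ 3))"
      using edge_mgf_power_bounds(2)[of "(1 + \<delta>) * t" "card A"] small t \<delta>
      by (intro mult_left_mono) (auto simp: N_def mult.commute)
    also have "\<dots> \<le> exp (- (\<delta> * t * b)) * exp (N * (p * (1 - p) * ((1 + \<delta>) * t)\<^sup>2 / 2 + 8 * t ^ 3))"
      using cube N0 by (intro mult_left_mono) (auto intro!: mult_left_mono)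
    also have "\<dots> = X * exp (8 * N * t ^ 3 - \<delta>\<^sup>2 * t\<^sup>2 * v / 2)"
      unfolding X_def b_def v_eq exp_add[symmetric]
      by (rule arg_cong[where f = exp]) (simp add: power2_eq_square field_simps)
    also have "\<dots> \<le> X * (1 / 8)" using h2 by (intro mult_left_mono) (auto simp: X_def)
    finally show ?thesis .
  qed
  \<comment> \<open>Budget: \<open>3 / 4 - 1 / 8 - 1 / 8 = 1 / 2\<close>.\<close>
  have "X * (1 / 2) \<le> exp (t * b) * prob ?E" using main E1 E2 E3 by linarith
  then have "exp (- (t * b)) * (X * (1 / 2)) \<le> exp (- (t * b)) * (exp (t * b) * prob ?E)"
    by (intro mult_left_mono) auto
  also have "\<dots> = prob ?E" by (simp add: exp_minus)
  also have "exp (- (t * b)) * (X * (1 / 2)) = exp (- (t * b) + t\<^sup>2 * v / 2) / 2"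
    unfolding X_def exp_add by simp
  also have "- (t * b) + t\<^sup>2 * v / 2 = - (t\<^sup>2 * v * (1 + 2 * \<delta>) / 2)"
    by (simp add: b_def power2_eq_square field_simps)
  finally show ?thesis by (simp add: a_def)
qed

lemma prob_deviation_le:
  assumes A: "finite A" "A \<subseteq> vertex_pairs" and t: "0 \<le> t"
  shows "prob {\<omega> \<in> space M. deviation A \<omega> \<le> - b} \<le> exp (- (t * b)) * edge_mgf (- t) ^ card A"
proof -
  have [measurable]: "deviation A \<in> borel_measurable M" by (rule measurable_deviation[OF A])
  have "{\<omega> \<in> space M. deviation A \<omega> \<le> - b} \<subseteq> {\<omega> \<in> space M. exp (t * b) \<le> exp (- t * deviation A \<omega>)}"
  proof (intro Collect_mono impI, elim conjE, intro conjI)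
    fix \<omega> assume "deviation A \<omega> \<le> - b"
    then have "t * deviation A \<omega> \<le> t * - b" using t by (rule mult_left_mono)
    then show "exp (t * b) \<le> exp (- t * deviation A \<omega>)" by simp
  qed
  then have "prob {\<omega> \<in> space M. deviation A \<omega> \<le> - b} \<le>
      prob {\<omega> \<in> space M. exp (t * b) \<le> exp (- t * deviation A \<omega>)}"
    by (intro finite_measure_mono) measurable
  also have "\<dots> \<le> expectation (\<lambda>\<omega>. exp (- t * deviation A \<omega>)) / exp (t * b)"
    by (intro integral_Markov_inequality_measure[of _ _ "{}"] mgf_deviation(1)[OF A]) auto
  also have "\<dots> = exp (- (t * b)) * edge_mgf (- t) ^ card A"
    unfolding mgf_deviation(2)[OF A] by (simp add: exp_minus divide_inverse mult.commute)
  finally show ?thesis .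
qed

text \<open>Second Borel-Cantelli lemma. Disjoint edge sets make the events independent, so the
  chance that none of the events from \<open>J\<close> to \<open>K\<close> occurs is the product of
  \<open>1 - P j\<close>, at most \<open>exp (- (\<Sum>j=J..<K. P j))\<close>.\<close>

lemma borel_cantelli_disjoint_edges:
  assumes A: "\<And>j. finite (A j)" "\<And>j. A j \<subseteq> vertex_pairs" "disjoint_family A"
    and div: "\<not> summable (\<lambda>j. prob {\<omega> \<in> space M. Q j (G \<omega> \<inter> A j)})"
  shows "AE \<omega> in M. \<exists>\<^sub>F j in sequentially. Q j (G \<omega> \<inter> A j)"
proof -
  define P where "P j = prob {\<omega> \<in> space M. Q j (G \<omega> \<inter> A j)}" for j
  have ev [measurable]: "{\<omega> \<in> space M. Q j (G \<omega> \<inter> A j)} \<in> events" for j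
  proof -
    have "(\<lambda>\<omega>. of_bool (Q j (G \<omega> \<inter> A j)) :: real) \<in> borel_measurable M"
      by (rule measurable_restrict[OF A(1,2), of "\<lambda>S. of_bool (Q j S)"])
    then have "{\<omega> \<in> space M. (of_bool (Q j (G \<omega> \<inter> A j)) :: real) = 1} \<in> events" by measurable
    then show ?thesis by simp
  qed
  have E: "expectation (\<lambda>\<omega>. of_bool (\<not> Q j (G \<omega> \<inter> A j))) = 1 - P j" for j
  proof -
    have "expectation (\<lambda>\<omega>. of_bool (\<not> Q j (G \<omega> \<inter> A j))) =
        expectation (\<lambda>\<omega>. 1 - indicator {\<omega> \<in> space M. Q j (G \<omega> \<inter> A j)} \<omega>)"
      by (intro Bochner_Integration.integral_cong) (auto simp: indicator_def)
    also have "\<dots> = 1 - P j"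
      using sets.sets_into_space[OF ev[of j]]
      by (subst Bochner_Integration.integral_diff) (auto simp: prob_space P_def Int_absorb1 emeasure_eq_measure)
    finally show ?thesis .
  qed
  have prod: "expectation (\<lambda>\<omega>. \<Prod>j\<in>J. of_bool (\<not> Q j (G \<omega> \<inter> A j))) = (\<Prod>j\<in>J. 1 - P j)" if "finite J" for J
    using that
  proof (induction J rule: finite_induct)
    case empty
    then show ?case by (simp add: prob_space)
  next
    case (insert i J)
    let ?U = "\<Union>j\<in>J. A j"
    let ?F = "\<lambda>S. \<Prod>j\<in>J. of_bool (\<not> Q j (S \<inter> A j)) :: real"
    have F: "?F (G \<omega> \<inter> ?U) = (\<Prod>j\<in>J. of_bool (\<not> Q j (G \<omega> \<inter> A j)))" for \<omega>
    proof (intro prod.cong refl arg_cong[where f = "\<lambda>S. of_bool (\<not> Q _ S)"])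
      fix j assume "j \<in> J"
      then show "G \<omega> \<inter> ?U \<inter> A j = G \<omega> \<inter> A j" by auto
    qed
    have "A j \<inter> A i = {}" if "j \<in> J" for j
      using that insert.hyps disjoint_family_onD[OF A(3), of j i] by auto
    then have "?U \<inter> A i = {}" by blast
    then have "expectation (\<lambda>\<omega>. ?F (G \<omega> \<inter> ?U) * of_bool (\<not> Q i (G \<omega> \<inter> A i))) =
        expectation (\<lambda>\<omega>. ?F (G \<omega> \<inter> ?U)) * expectation (\<lambda>\<omega>. of_bool (\<not> Q i (G \<omega> \<inter> A i)))"
      using A insert.hyps by (intro expectation_mult_restrict[of ?U "A i" ?F "\<lambda>S. of_bool (\<not> Q i S)"]) auto
    then show ?case using insert unfolding F E by (simp add: mult.commute)
  qed
  have zero: "AE \<omega> in M. \<exists>j\<ge>J. Q j (G \<omega> \<inter> A j)" for J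
  proof -
    let ?B = "{\<omega> \<in> space M. \<forall>j\<ge>J. \<not> Q j (G \<omega> \<inter> A j)}"
    have B: "?B \<in> events" by measurable
    have P01: "0 \<le> P j" "P j \<le> 1" for j by (simp_all add: P_def)
    have le: "prob ?B \<le> exp (- (\<Sum>j=J..<K. P j))" for K
    proof -
      have "prob ?B = expectation (\<lambda>\<omega>. indicator ?B \<omega>)"
        using sets.sets_into_space[OF B] by (simp add: Int_absorb1)
      also have "\<dots> \<le> expectation (\<lambda>\<omega>. \<Prod>j=J..<K. of_bool (\<not> Q j (G \<omega> \<inter> A j)))"
      proof (rule integral_mono')
        let ?F = "\<lambda>S. \<Prod>j=J..<K. of_bool (\<not> Q j (S \<inter> A j)) :: real"
        have "?F (G \<omega> \<inter> (\<Union>j\<in>{J..<K}. A j)) = (\<Prod>j=J..<K. of_bool (\<not> Q j (G \<omega> \<inter> A j)))" for \<omega>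
        proof (intro prod.cong refl arg_cong[where f = "\<lambda>S. of_bool (\<not> Q _ S)"])
          fix j assume "j \<in> {J..<K}"
          then show "G \<omega> \<inter> (\<Union>j\<in>{J..<K}. A j) \<inter> A j = G \<omega> \<inter> A j" by auto
        qed
        then show "integrable M (\<lambda>\<omega>. \<Prod>j=J..<K. of_bool (\<not> Q j (G \<omega> \<inter> A j)) :: real)"
          using integrable_restrict[of "\<Union>j\<in>{J..<K}. A j" ?F] A by (simp add: UN_subset_iff)
        show "indicator ?B \<omega> \<le> (\<Prod>j=J..<K. of_bool (\<not> Q j (G \<omega> \<inter> A j)) :: real)" for \<omega>
          by (auto simp: indicator_def prod_nonneg)
      qed (simp add: prod_nonneg)
      also have "\<dots> = (\<Prod>j=J..<K. 1 - P j)" by (rule prod) simp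
      also have "\<dots> \<le> (\<Prod>j=J..<K. exp (- P j))"
        using P01 exp_ge_add_one_self[of "- P j" for j] by (intro prod_mono) (auto simp: algebra_simps)
      also have "\<dots> = exp (- (\<Sum>j=J..<K. P j))" by (simp add: exp_sum flip: sum_negf)
      finally show ?thesis .
    qed
    have "prob ?B \<le> \<epsilon>" if "0 < \<epsilon>" for \<epsilon>
    proof (rule ccontr)
      assume "\<not> prob ?B \<le> \<epsilon>"
      then have "\<epsilon> < exp (- (\<Sum>j=J..<K. P j))" for K using le[of K] by linarith
      then have lt: "ln \<epsilon> < - (\<Sum>j=J..<K. P j)" for K using that by (metis exp_less_cancel_iff exp_ln)
      have "(\<Sum>j=J..<K. P j) \<le> - ln \<epsilon>" for K using lt[of K] by linarith
      moreover have "(\<Sum>j<K. P j) \<le> (\<Sum>j<J. P j) + (\<Sum>j=J..<K. P j)" for K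
      proof -
        have "(\<Sum>j<K. P j) \<le> (\<Sum>j\<in>{..<J} \<union> {J..<K}. P j)" using P01 by (intro sum_mono2) auto
        also have "\<dots> = (\<Sum>j<J. P j) + (\<Sum>j=J..<K. P j)" by (intro sum.union_disjoint) auto
        finally show ?thesis .
      qed
      ultimately have "(\<Sum>j<K. P j) \<le> (\<Sum>j<J. P j) + - ln \<epsilon>" for K by (meson add_left_mono order_trans)
      then have "summable P" using P01 by (intro summableI_nonneg_bounded)
      then show False using div by (simp add: P_def[abs_def])
    qed
    then have "prob ?B \<le> 0" by (rule field_le_epsilon[of _ 0, simplified]) simp
    then have "prob ?B = 0" by (simp add: measure_le_0_iff)
    then have "AE \<omega> in M. \<omega> \<notin> ?B" using B by (simp add: prob_eq_0)
    then show ?thesis by (rule AE_mp) auto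
  qed
  have "AE \<omega> in M. \<forall>J. \<exists>j\<ge>J. Q j (G \<omega> \<inter> A j)" using zero by (simp add: AE_all_countable)
  then show ?thesis by (rule AE_mp) (auto simp: frequently_sequentially)
qed

end

section \<open>Factorial blocks and lower half of the law\<close>

lemma ln_fact_le: "ln (fact j) \<le> real j * ln (real j)" if "1 \<le> j"
proof -
  have "(fact j :: real) \<le> real j ^ j" using fact_le_power[of j, where 'a = real] by simp
  then have "ln (fact j) \<le> ln (real j ^ j)" using that by (subst ln_le_cancel_iff) auto
  then show ?thesis using that by (simp add: ln_realpow)
qed

lemma filterlim_fact: "filterlim (\<lambda>j. fact j :: real) at_top sequentially"
proof -
  have "\<forall>\<^sub>F j in sequentially. real j \<le> fact j"
    using fact_ge_self by (intro always_eventually allI) (metis of_nat_fact of_nat_mono)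
  then show ?thesis by (rule filterlim_at_top_mono[OF filterlim_real_sequentially])
qed

lemma product_fact_step:
  assumes j: "1 \<le> j"
  defines "r \<equiv> fact (j - 1) :: real" and "n \<equiv> fact j :: real"
  shows "r * (r - 1) \<le> n * (n - 1) / (real j)\<^sup>2"
proof -
  have n: "n = real j * r" using j by (simp add: n_def r_def fact_reduce[of j])
  have r: "1 \<le> r" by (simp add: r_def fact_ge_1)
  have "real j * (r - 1) \<le> n - 1" using j by (simp add: n algebra_simps)
  then have "n * (real j * (r - 1)) \<le> n * (n - 1)" using r by (intro mult_left_mono) (auto simp: n)
  then have "n * (real j * (r - 1)) / (real j)\<^sup>2 \<le> n * (n - 1) / (real j)\<^sup>2" by (intro divide_right_mono) auto
  moreover have "n * (real j * (r - 1)) / (real j)\<^sup>2 = r * (r - 1)"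
    using j by (simp add: n power2_eq_square)
  ultimately show ?thesis by simp
qed

context nontrivial_random_graph
begin

text \<open>The edges present before the \<open>j\<close>-th block have at most
  \<open>1 / j^2\<close> of the variance at \<open>j!\<close>, so a drop to the size of the standard
  deviation at \<open>j!\<close> has probability \<open>O(exp (- j))\<close>. This level lacks the
  factor \<open>sqrt (ln (ln n))\<close> and is negligible on the scale of the law.\<close>

lemma deviation_previous_block:
  "AE \<omega> in M. \<forall>\<^sub>F j in sequentially.
    - sqrt (p * (1 - p) * (fact j * (fact j - 1))) < deviation (pairs (fact (j - 1))) \<omega>"
proof -
  define v where "v = p * (1 - p)"
  have v: "0 < v" using p_pos p_less_1 by (simp add: v_def)
  have "((\<lambda>x::real. 1 / sqrt (v * (x * (x - 1)))) \<longlongrightarrow> 0) at_top" using v by real_asymp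
  then have "\<forall>\<^sub>F x in at_top. 1 / sqrt (v * (x * (x - 1))) < 1 / 2"
    by (rule order_tendstoD) simp
  moreover have "filterlim (\<lambda>j. fact (j - 1) :: real) at_top sequentially"
    by (intro filterlim_compose[OF filterlim_fact] filterlim_minus_const_nat_at_top)
  ultimately have "\<forall>\<^sub>F j in sequentially. 1 / sqrt (v * (fact (j - 1) * (fact (j - 1) - 1))) < 1 / 2"
    by (rule eventually_compose_filterlim)
  then have "\<forall>\<^sub>F j in sequentially.
      {\<omega> \<in> space M. deviation (pairs (fact (j - 1))) \<omega> \<le> - sqrt (v * (fact j * (fact j - 1)))} \<in> events \<and>
      prob {\<omega> \<in> space M. deviation (pairs (fact (j - 1))) \<omega> \<le> - sqrt (v * (fact j * (fact j - 1)))}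
        \<le> exp (1 / 4 + 1 / (4 * v)) * exp (- 1) ^ j"
    using eventually_ge_at_top[of 3]
  proof eventually_elim
    case (elim j)
    define r n where "r = (fact (j - 1) :: real)" and "n = (fact j :: real)"
    \<comment> \<open>Makes \<open>t\<close> times the level equal to \<open>j\<close>, while
      \<open>product_fact_step\<close> keeps the generating function bounded.\<close>
    define t where "t = real j / sqrt (v * (n * (n - 1)))"
    have [measurable]: "deviation (pairs (fact (j - 1))) \<in> borel_measurable M"
      by (rule measurable_deviation[OF finite_pairs pairs_subset])
    have step: "r * (r - 1) \<le> n * (n - 1) / (real j)\<^sup>2"
      unfolding r_def n_def using elim by (intro product_fact_step) simp
    have r1: "1 < r" using elim fact_less_mono[of 1 "j - 1", where 'a = real] by (simp add: r_def)
    have n1: "1 < n" using elim fact_less_mono[of 1 j, where 'a = real] by (simp add: n_def)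
    have S: "0 < v * (n * (n - 1))" "0 < v * (r * (r - 1))" using v n1 r1 by simp_all
    have j: "0 < real j" using elim by simp
    have t0: "0 \<le> t" using S j by (simp add: t_def)
    have t2: "t\<^sup>2 = (real j)\<^sup>2 / (v * (n * (n - 1)))" using S by (simp add: t_def power_divide)
    have t_half: "t \<le> 1 / 2"
    proof -
      have "(real j)\<^sup>2 * (v * (r * (r - 1))) \<le> v * (n * (n - 1))"
        using mult_left_mono[OF step, of "(real j)\<^sup>2 * v"] j v by (simp add: mult_ac)
      then have "real j * sqrt (v * (r * (r - 1))) \<le> sqrt (v * (n * (n - 1)))"
        using real_sqrt_le_mono[of "(real j)\<^sup>2 * (v * (r * (r - 1)))" "v * (n * (n - 1))"]
        by (simp add: real_sqrt_mult)
      then have "t \<le> 1 / sqrt (v * (r * (r - 1)))" using S by (simp add: t_def field_simps)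
      then show ?thesis using elim(1) by (simp add: r_def)
    qed
    have card: "real (card (pairs (fact (j - 1)))) = r * (r - 1) / 2" by (simp add: real_card_pairs r_def)
    have tc: "r * (r - 1) / 2 * t\<^sup>2 \<le> 1 / (2 * v)"
    proof -
      have "r * (r - 1) / 2 * t\<^sup>2 \<le> n * (n - 1) / (real j)\<^sup>2 / 2 * t\<^sup>2"
        using step by (intro mult_right_mono) auto
      also have "\<dots> = 1 / (2 * v)" using n1 j v by (simp add: t2)
      finally show ?thesis .
    qed
    have "prob {\<omega> \<in> space M. deviation (pairs (fact (j - 1))) \<omega> \<le> - sqrt (v * (n * (n - 1)))} \<le>
        exp (- (t * sqrt (v * (n * (n - 1))))) * edge_mgf (- t) ^ card (pairs (fact (j - 1)))"
      by (rule prob_deviation_le[OF finite_pairs pairs_subset t0])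
    also have "t * sqrt (v * (n * (n - 1))) = real j"
    proof -
      have "x / y * y = x" if "0 < y" for x y :: real using that by simp
      from this[of "sqrt (v * (n * (n - 1)))"] show ?thesis using S(1) unfolding t_def by (simp only: real_sqrt_gt_0_iff)
    qed
    also have "edge_mgf (- t) ^ card (pairs (fact (j - 1))) \<le> exp (1 / 4 + 1 / (4 * v))"
    proof -
      have "edge_mgf (- t) ^ card (pairs (fact (j - 1))) \<le> exp (r * (r - 1) / 2 * (v * t\<^sup>2 / 2 + t ^ 3))"
        using edge_mgf_power_bounds(2)[of "- t" "card (pairs (fact (j - 1)))", unfolded card] t0 t_half
        by (simp add: v_def)
      also have "r * (r - 1) / 2 * (v * t\<^sup>2 / 2 + t ^ 3) = (r * (r - 1) / 2 * t\<^sup>2) * (v / 2 + t)"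
      proof -
        have "y * (v * t\<^sup>2 / 2 + t ^ 3) = (y * t\<^sup>2) * (v / 2 + t)" for y
          by (simp add: power2_eq_square power3_eq_cube algebra_simps)
        then show ?thesis .
      qed
      also have "\<dots> \<le> 1 / (2 * v) * (v / 2 + 1 / 2)"
        using tc t_half t0 v by (intro mult_mono) auto
      also have "\<dots> = 1 / 4 + 1 / (4 * v)" using v by (simp add: field_simps)
      finally show ?thesis by simp
    qed
    finally have "prob {\<omega> \<in> space M. deviation (pairs (fact (j - 1))) \<omega> \<le> - sqrt (v * (n * (n - 1)))} \<le>
        exp (- real j) * exp (1 / 4 + 1 / (4 * v))" by simp
    also have "\<dots> = exp (1 / 4 + 1 / (4 * v)) * exp (- 1) ^ j"
      by (simp add: mult.commute flip: exp_of_nat_mult)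
    finally have "prob {\<omega> \<in> space M. deviation (pairs (fact (j - 1))) \<omega> \<le> - sqrt (v * (n * (n - 1)))} \<le>
        exp (1 / 4 + 1 / (4 * v)) * exp (- 1) ^ j" .
    moreover have "{\<omega> \<in> space M. deviation (pairs (fact (j - 1))) \<omega> \<le> - sqrt (v * (n * (n - 1)))} \<in> events"
      by measurable
    ultimately show ?case unfolding n_def by blast
  qed
  moreover have "summable (\<lambda>j. exp (1 / 4 + 1 / (4 * v)) * exp (- 1 :: real) ^ j)"
    by (intro summable_mult summable_geometric) simp
  ultimately have "AE \<omega> in M. \<forall>\<^sub>F j in sequentially.
      \<omega> \<notin> {\<omega> \<in> space M. deviation (pairs (fact (j - 1))) \<omega> \<le> - sqrt (v * (fact j * (fact j - 1)))}"
    by (rule borel_cantelli_eventually)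
  then show ?thesis
    by (rule AE_mp) (intro AE_I2 impI, auto elim!: eventually_mono simp: not_le v_def)
qed

definition block :: "nat \<Rightarrow> nat set set" where
  "block j = pairs (fact j) - pairs (fact (j - 1))"

lemma block: "finite (block j)" "block j \<subseteq> vertex_pairs" "disjoint_family block"
proof -
  show "finite (block j)" "block j \<subseteq> vertex_pairs" using pairs_subset[of "fact j"] by (auto simp: block_def)
  have "block i \<inter> block j = {}" if "i < j" for i j
  proof -
    have "pairs (fact i) \<subseteq> pairs (fact (j - 1))" using that by (intro pairs_mono fact_mono) simp
    then show ?thesis by (auto simp: block_def)
  qed
  then show "disjoint_family block"
    unfolding disjoint_family_on_def by (metis inf_commute linorder_neqE_nat)
qed

lemma deviation_fact_split:
  "deviation (pairs (fact j)) \<omega> = deviation (pairs (fact (j - 1))) \<omega> + deviation (block j) \<omega>"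
proof -
  have "pairs (fact (j - 1)) \<subseteq> pairs (fact j)" by (intro pairs_mono fact_mono) simp
  then have "pairs (fact j) = pairs (fact (j - 1)) \<union> block j" by (auto simp: block_def)
  then show ?thesis
    using deviation_union[of "pairs (fact (j - 1))" "block j" \<omega>] block(1)[of j] by (auto simp: block_def)
qed

lemma card_block:
  assumes "1 \<le> j"
  shows "fact j * (fact j - 1) / 2 * (1 - 1 / (real j)\<^sup>2) \<le> real (card (block j))"
    and "real (card (block j)) \<le> fact j * (fact j - 1) / 2"
proof -
  have sub: "pairs (fact (j - 1)) \<subseteq> pairs (fact j)" by (intro pairs_mono fact_mono) simp
  then have "real (card (block j)) = real (card (pairs (fact j))) - real (card (pairs (fact (j - 1))))"
    using card_mono[OF finite_pairs sub] by (simp add: block_def card_Diff_subset of_nat_diff)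
  then have eq: "real (card (block j)) = fact j * (fact j - 1) / 2 - fact (j - 1) * (fact (j - 1) - 1) / 2"
    by (simp add: real_card_pairs)
  show "fact j * (fact j - 1) / 2 * (1 - 1 / (real j)\<^sup>2) \<le> real (card (block j))"
  proof -
    have "x / 2 * (1 - 1 / y) = x / 2 - x / y / 2" for x y :: real by (simp add: right_diff_distrib)
    then show ?thesis unfolding eq using product_fact_step[OF assms] by simp
  qed
  show "real (card (block j)) \<le> fact j * (fact j - 1) / 2"
    unfolding eq using fact_ge_1[of "j - 1", where 'a = real] by simp
qed

text \<open>\<open>deviation_lower_tail\<close> bounds the probability from below by a multiple of
  \<open>(ln n) powr - \<alpha>\<close> for \<open>n = j!\<close> and some
  \<open>\<alpha> < 1\<close>. As \<open>ln n\<close> is at most \<open>j * ln j\<close>, these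
  probabilities eventually exceed \<open>1 / j\<close>, and the blocks are independent.\<close>

lemma deviation_block_lower:
  assumes \<delta>: "0 < \<delta>" "\<delta> < 1"
  shows "AE \<omega> in M. \<exists>\<^sub>F j in sequentially.
    (1 - \<delta>)\<^sup>2 * sqrt (2 * p * (1 - p) * card (block j) * ln (ln (fact j))) \<le> deviation (block j) \<omega>"
proof -
  define v where "v = p * (1 - p)"
  have v: "0 < v" using p_pos p_less_1 by (simp add: v_def)
  \<comment> \<open>Explicit upper bound for the tilt \<open>t\<close> below, using that a block
    contains at least half of all pairs.\<close>
  define h where "h x = sqrt (8 * ln (ln x) / (v * (x * (x - 1))))" for x :: real
  define \<alpha> where "\<alpha> = 1 - \<delta>\<^sup>2"
  have \<alpha>: "0 < \<alpha>" "\<alpha> < 1" using \<delta> by (auto simp: \<alpha>_def power_less_one_iff)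
  define Q where "Q j S \<longleftrightarrow> (1 - \<delta>)\<^sup>2 * sqrt (2 * p * (1 - p) * card (block j) * ln (ln (fact j)))
      \<le> (\<Sum>e\<in>block j. of_bool (e \<in> S) - p)" for j and S :: "nat set set"
  have Q: "Q j (G \<omega> \<inter> block j) \<longleftrightarrow> (1 - \<delta>)\<^sup>2 * sqrt (2 * p * (1 - p) * card (block j) * ln (ln (fact j)))
      \<le> deviation (block j) \<omega>" for j \<omega>
    unfolding Q_def deviation_restrict[of "block j" \<omega>] ..
  have lim1: "(h \<longlongrightarrow> 0) at_top" unfolding h_def using v by real_asymp
  have lim2: "((\<lambda>x. h x * (2 * ln (ln x) / v)) \<longlongrightarrow> 0) at_top" unfolding h_def using v by real_asymp
  have lim3: "\<forall>\<^sub>F x :: real in at_top. 4 \<le> \<delta>\<^sup>2 * (1 - \<delta>)\<^sup>2 * ln (ln x)"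
  proof -
    have "0 < \<delta>\<^sup>2 * (1 - \<delta>)\<^sup>2" using \<delta> by simp
    then have "filterlim (\<lambda>x::real. \<delta>\<^sup>2 * (1 - \<delta>)\<^sup>2 * ln (ln x)) at_top at_top" by real_asymp
    then show ?thesis by (simp add: filterlim_at_top)
  qed
  \<comment> \<open>\<open>1 / 4\<close> gives \<open>t * (1 + \<delta>) \<le> 1 / 2\<close>. With
    \<open>N * t ^ 3 \<le> 1 / 20\<close> the cubic error is at most \<open>5 / 20\<close> in
    \<open>h1\<close> and \<open>8 / 20\<close> in \<open>h2\<close>; the latter against 4 leaves an
    exponent below \<open>- 3\<close>.\<close>
  have "0 < 1 / (4 :: real)" "0 < 1 / (20 :: real)" by simp_all
  from order_tendstoD(2)[OF lim1 this(1)] order_tendstoD(2)[OF lim2 this(2)] lim3 eventually_gt_at_top[of "exp 1"]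
  have "\<forall>\<^sub>F x in at_top. h x < 1 / 4 \<and> h x * (2 * ln (ln x) / v) < 1 / 20 \<and>
      4 \<le> \<delta>\<^sup>2 * (1 - \<delta>)\<^sup>2 * ln (ln x) \<and> exp 1 < x"
    by eventually_elim auto
  from eventually_compose_filterlim[OF this filterlim_fact]
  have ev: "\<forall>\<^sub>F j in sequentially. h (fact j) < 1 / 4 \<and> h (fact j) * (2 * ln (ln (fact j)) / v) < 1 / 20 \<and>
      4 \<le> \<delta>\<^sup>2 * (1 - \<delta>)\<^sup>2 * ln (ln (fact j)) \<and> exp 1 < (fact j :: real)" .
  have "\<forall>\<^sub>F j in sequentially. 1 / real j \<le> (real j * ln (real j)) powr - \<alpha> / 2"
    using \<alpha> by real_asymp
  then have "\<forall>\<^sub>F j in sequentially. 1 / real j \<le> prob {\<omega> \<in> space M. Q j (G \<omega> \<inter> block j)}"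
    using ev eventually_ge_at_top[of 2]
  proof eventually_elim
    case (elim j)
    define n where "n = (fact j :: real)"
    define L where "L = ln (ln n)"
    define N where "N = real (card (block j))"
    \<comment> \<open>Places the lower end \<open>t * v * N * (1 - \<delta>)\<close> of the window
      at \<open>(1 - \<delta>)\<^sup>2\<close> times the iterated-logarithm level. The factor
      \<open>1 - \<delta>\<close> in the tilt pushes the exponent of the probability below
      1.\<close>
    define t where "t = (1 - \<delta>) * sqrt (2 * L / (v * N))"
    have hx: "h n < 1 / 4" "h n * (2 * L / v) < 1 / 20" "4 \<le> \<delta>\<^sup>2 * (1 - \<delta>)\<^sup>2 * L" "exp 1 < n"
      using elim(2) by (auto simp: n_def L_def)
    have n1: "1 < n" using hx(4) exp_gt_one[of 1] by linarith
    have lnn: "1 < ln n" using hx(4) n1 ln_less_cancel_iff[of "exp 1" n] by simp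
    have L: "0 < L" using lnn by (simp add: L_def)
    have j2: "2 \<le> real j" using elim by simp
    have "4 \<le> (real j)\<^sup>2" using power_mono[OF j2, of 2] by simp
    then have "1 / 2 \<le> 1 - 1 / (real j)\<^sup>2" using j2 by (simp add: field_simps)
    then have "n * (n - 1) / 2 * (1 / 2) \<le> n * (n - 1) / 2 * (1 - 1 / (real j)\<^sup>2)"
      using n1 by (intro mult_left_mono) auto
    also have "\<dots> \<le> N" unfolding N_def n_def using elim by (intro card_block) simp
    finally have N: "n * (n - 1) / 4 \<le> N" by simp
    have S: "0 < n * (n - 1)" using n1 by simp
    have N0: "0 < N" using N S by simp
    have t0: "0 < t" using \<delta> L v N0 by (simp add: t_def)
    have t2: "t\<^sup>2 = (1 - \<delta>)\<^sup>2 * (2 * L / (v * N))" using L v N0 by (simp add: t_def power_mult_distrib)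
    have th: "t \<le> h n"
    proof -
      have "2 * L / (v * N) \<le> 2 * L / (v * (n * (n - 1) / 4))"
        using N L v S N0 by (intro divide_left_mono mult_left_mono mult_pos_pos) auto
      also have "\<dots> = 8 * ln (ln n) / (v * (n * (n - 1)))" by (simp add: L_def)
      finally have "sqrt (2 * L / (v * N)) \<le> h n" unfolding h_def by (rule real_sqrt_le_mono)
      moreover have "t \<le> 1 * sqrt (2 * L / (v * N))"
        unfolding t_def using \<delta> L v N0 by (intro mult_right_mono) auto
      ultimately show ?thesis by simp
    qed
    have d2: "(1 - \<delta>)\<^sup>2 \<le> 1" using \<delta> by (intro power_le_one) auto
    have Nt3: "N * t ^ 3 \<le> 1 / 20"
    proof -
      have "N * t ^ 3 = t * ((1 - \<delta>)\<^sup>2 * (2 * L / v))"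
        using N0 by (simp add: power3_eq_cube t2[unfolded power2_eq_square] power2_eq_square mult.assoc)
      also have "\<dots> \<le> h n * (1 * (2 * L / v))"
        using th d2 L v t0 by (intro mult_mono) auto
      finally show ?thesis using hx(2) by simp
    qed
    have tv: "t\<^sup>2 * (v * N) = (1 - \<delta>)\<^sup>2 * (2 * L)" unfolding t2 using v N0 by simp
    have pqN: "p * (1 - p) * real (card (block j)) = v * N" by (simp add: v_def N_def)
    have bound: "exp (- (t\<^sup>2 * (v * N) * (1 + 2 * \<delta>) / 2)) / 2 \<le>
        prob {\<omega> \<in> space M. t * (v * N) * (1 - \<delta>) \<le> deviation (block j) \<omega>}"
      unfolding pqN[symmetric]
    proof (rule deviation_lower_tail[OF block(1,2) t0 \<delta>])
      have "t * (1 + \<delta>) \<le> 1 / 4 * 2" using th hx(1) t0 \<delta> by (intro mult_mono) auto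
      then show "t * (1 + \<delta>) \<le> 1 / 2" by simp
      have "3 / 4 \<le> 1 + - (5 * N * t ^ 3)" using Nt3 by simp
      also have "\<dots> \<le> exp (- (5 * N * t ^ 3))" by (rule exp_ge_add_one_self)
      finally show "3 / 4 \<le> exp (- (5 * real (card (block j)) * t ^ 3))" by (simp add: N_def)
      have "8 * N * t ^ 3 - \<delta>\<^sup>2 * t\<^sup>2 * (v * N) / 2 = 8 * (N * t ^ 3) - \<delta>\<^sup>2 * (1 - \<delta>)\<^sup>2 * L"
      proof -
        have "\<delta>\<^sup>2 * t\<^sup>2 * (v * N) / 2 = \<delta>\<^sup>2 * (t\<^sup>2 * (v * N)) / 2" by (simp only: mult.assoc)
        then show ?thesis unfolding tv by simp
      qed
      also have "\<dots> \<le> - 3" using Nt3 hx(3) by linarith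
      finally have "exp (8 * N * t ^ 3 - \<delta>\<^sup>2 * t\<^sup>2 * (v * N) / 2) \<le> exp (- 3)" by simp
      also have "\<dots> \<le> 1 / 8"
      proof -
        have "2 ^ 3 \<le> exp (1::real) ^ 3" using exp_ge_add_one_self[of 1] by (intro power_mono) auto
        also have "exp (1::real) ^ 3 = exp 3" by (simp flip: exp_of_nat_mult)
        finally show ?thesis by (simp add: exp_minus field_simps)
      qed
      finally show "exp (8 * real (card (block j)) * t ^ 3 - \<delta>\<^sup>2 * t\<^sup>2 * (p * (1 - p) * real (card (block j))) / 2) \<le> 1 / 8"
        unfolding pqN by (simp add: N_def)
    qed
    have "t * (v * N) = (1 - \<delta>) * sqrt (2 * L * (v * N))"
    proof -
      have "sqrt (2 * L / (v * N)) * (v * N) = sqrt (2 * L) * ((v * N) / sqrt (v * N))"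
        by (simp add: real_sqrt_divide)
      also have "(v * N) / sqrt (v * N) = sqrt (v * N)" using v N0 by (simp add: real_div_sqrt)
      finally show ?thesis by (simp add: t_def real_sqrt_mult)
    qed
    then have tvN: "t * (v * N) * (1 - \<delta>) = (1 - \<delta>)\<^sup>2 * sqrt (2 * p * (1 - p) * card (block j) * ln (ln (fact j)))"
      by (simp add: power2_eq_square v_def N_def L_def n_def mult_ac)
    have "t\<^sup>2 * (v * N) * (1 + 2 * \<delta>) / 2 = (1 - \<delta>)\<^sup>2 * (1 + 2 * \<delta>) * L" unfolding tv by simp
    also have "\<dots> \<le> \<alpha> * L"
    proof (intro mult_right_mono)
      \<comment> \<open>The product \<open>(1 - \<delta>)\<^sup>2 * (1 + 2 * \<delta>)\<close> is
        \<open>1 - 3 * \<delta>\<^sup>2 + 2 * \<delta>^3\<close>.\<close>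
      have "\<delta> * \<delta>\<^sup>2 \<le> 1 * \<delta>\<^sup>2" using \<delta> by (intro mult_right_mono) auto
      then show "(1 - \<delta>)\<^sup>2 * (1 + 2 * \<delta>) \<le> \<alpha>" by (simp add: \<alpha>_def power2_eq_square algebra_simps)
    qed (use L in simp)
    finally have "exp (- (\<alpha> * L)) / 2 \<le> exp (- (t\<^sup>2 * (v * N) * (1 + 2 * \<delta>) / 2)) / 2" by simp
    then have "exp (- (\<alpha> * L)) / 2 \<le> prob {\<omega> \<in> space M. Q j (G \<omega> \<inter> block j)}"
      using bound unfolding tvN Q by linarith
    moreover have "(real j * ln (real j)) powr - \<alpha> / 2 \<le> exp (- (\<alpha> * L)) / 2"
    proof -
      have "ln n \<le> real j * ln (real j)" unfolding n_def using elim by (intro ln_fact_le) simp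
      then have "(real j * ln (real j)) powr - \<alpha> \<le> ln n powr - \<alpha>"
        using lnn \<alpha> by (intro powr_mono2') auto
      also have "\<dots> = exp (- (\<alpha> * L))" using lnn by (simp add: powr_def L_def)
      finally show ?thesis by simp
    qed
    ultimately show ?case using elim(1) by linarith
  qed
  then have "\<not> summable (\<lambda>j. prob {\<omega> \<in> space M. Q j (G \<omega> \<inter> block j)})"
  proof (intro notI)
    assume ev: "\<forall>\<^sub>F j in sequentially. 1 / real j \<le> prob {\<omega> \<in> space M. Q j (G \<omega> \<inter> block j)}"
      and s: "summable (\<lambda>j. prob {\<omega> \<in> space M. Q j (G \<omega> \<inter> block j)})"
    have "summable (\<lambda>j. 1 / real j)"
      by (rule summable_comparison_test_ev[OF _ s]) (use ev in \<open>auto elim!: eventually_mono\<close>)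
    then show False using not_summable_harmonic[where 'a = real] by (simp add: divide_inverse)
  qed
  from borel_cantelli_disjoint_edges[OF block this] show ?thesis unfolding Q .
qed

lemma deviation_lower:
  assumes \<eta>: "0 < \<eta>" "\<eta> < 1"
  shows "AE \<omega> in M. \<exists>\<^sub>F j in sequentially.
    (1 - \<eta>) * sqrt (p * (1 - p) * (fact j * (fact j - 1)) * ln (ln (fact j))) \<le> deviation (pairs (fact j)) \<omega>"
proof -
  \<comment> \<open>Then \<open>(1 - \<delta>)\<^sup>2 \<ge> 1 - \<eta> / 2\<close>. The other half
    of \<open>\<eta>\<close> pays for the fraction \<open>1 / j^2\<close> of pairs outside the block
    and for the earlier edges, whose loss relative to the level is
    \<open>1 / sqrt (ln (ln n))\<close>.\<close>
  define \<delta> where "\<delta> = \<eta> / 4"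
  have \<delta>: "0 < \<delta>" "\<delta> < 1" using \<eta> by (auto simp: \<delta>_def)
  have lim1: "((\<lambda>j. (1 - \<eta> / 2) * (1 - 1 / (real j)\<^sup>2)) \<longlongrightarrow> (1 - \<eta> / 2) * (1 - 0)) sequentially"
    by (intro tendsto_intros) real_asymp
  have lim2: "((\<lambda>j. 1 / sqrt (ln (ln (fact j)))) \<longlongrightarrow> 0) sequentially"
  proof (rule filterlim_compose[OF _ filterlim_fact])
    show "((\<lambda>x::real. 1 / sqrt (ln (ln x))) \<longlongrightarrow> 0) at_top" by real_asymp
  qed
  have "1 - \<eta> < (1 - \<eta> / 2) * (1 - 0) - 0" using \<eta> by simp
  from order_tendstoD(1)[OF tendsto_diff[OF lim1 lim2] this]
  have ev1: "\<forall>\<^sub>F j in sequentially. 1 - \<eta> < (1 - \<eta> / 2) * (1 - 1 / (real j)\<^sup>2) - 1 / sqrt (ln (ln (fact j)))" .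
  have ev2: "\<forall>\<^sub>F j in sequentially. exp 1 < (fact j :: real)"
    using filterlim_fact by (simp add: filterlim_at_top_dense)
  show ?thesis using deviation_block_lower[OF \<delta>] deviation_previous_block
  proof eventually_elim
    case (elim \<omega>)
    have "\<forall>\<^sub>F j in sequentially. (1 - \<delta>)\<^sup>2 * sqrt (2 * p * (1 - p) * card (block j) * ln (ln (fact j))) \<le> deviation (block j) \<omega> \<longrightarrow>
        (1 - \<eta>) * sqrt (p * (1 - p) * (fact j * (fact j - 1)) * ln (ln (fact j))) \<le> deviation (pairs (fact j)) \<omega>"
      using elim(2) ev1 ev2 eventually_ge_at_top[of 1]
    proof eventually_elim
      case (elim j)
      define n where "n = (fact j :: real)"
      define V where "V = p * (1 - p) * (n * (n - 1))"
      define L where "L = ln (ln n)"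
      define u where "u = 1 - 1 / (real j)\<^sup>2"
      have n1: "1 < n" using elim(3) exp_gt_one[of 1] unfolding n_def by linarith
      have lnn: "1 < ln n" using elim(3) n1 ln_less_cancel_iff[of "exp 1" n] by (simp add: n_def)
      have L: "0 < L" using lnn by (simp add: L_def)
      have V: "0 < V" using n1 p_pos p_less_1 by (simp add: V_def)
      have u: "0 \<le> u" "u \<le> 1" using elim(4) by (auto simp: u_def)
      show ?case
      proof
        assume blk: "(1 - \<delta>)\<^sup>2 * sqrt (2 * p * (1 - p) * card (block j) * ln (ln (fact j))) \<le> deviation (block j) \<omega>"
        have "V * u \<le> 2 * p * (1 - p) * card (block j)"
        proof -
          have "n * (n - 1) * u \<le> 2 * real (card (block j))"
            using card_block(1)[OF elim(4)] by (simp add: u_def n_def)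
          then have "p * (1 - p) * (n * (n - 1) * u) \<le> p * (1 - p) * (2 * real (card (block j)))"
            using p_pos p_less_1 by (intro mult_left_mono) auto
          then show ?thesis by (simp only: V_def mult_ac)
        qed
        then have "V * u * L \<le> 2 * p * (1 - p) * card (block j) * L" using L by (intro mult_right_mono) auto
        then have "sqrt (V * L) * sqrt u \<le> sqrt (2 * p * (1 - p) * card (block j) * L)"
          unfolding real_sqrt_mult[symmetric] by (intro real_sqrt_le_mono) (simp add: mult_ac)
        moreover have "u \<le> sqrt u"
        proof -
          have "u * u \<le> u * 1" using u by (intro mult_left_mono) auto
          then show ?thesis using u by (intro real_le_rsqrt) (simp add: power2_eq_square)
        qed
        then have "sqrt (V * L) * u \<le> sqrt (V * L) * sqrt u" using V L by (intro mult_left_mono) auto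
        ultimately have s: "sqrt (V * L) * u \<le> sqrt (2 * p * (1 - p) * card (block j) * L)" by linarith
        have d: "1 - \<eta> / 2 \<le> (1 - \<delta>)\<^sup>2" by (simp add: \<delta>_def power2_eq_square algebra_simps)
        have "(1 - \<eta> / 2) * (sqrt (V * L) * u) \<le> (1 - \<delta>)\<^sup>2 * sqrt (2 * p * (1 - p) * card (block j) * L)"
          using d s u V L \<eta> by (intro mult_mono) auto
        then have b1: "(1 - \<eta> / 2) * (sqrt (V * L) * u) \<le> deviation (block j) \<omega>"
          using blk by (simp add: L_def n_def)
        have "sqrt V = sqrt (V * L) * (1 / sqrt L)" using L by (simp add: real_sqrt_mult)
        then have b2: "- (sqrt (V * L) * (1 / sqrt L)) \<le> deviation (pairs (fact (j - 1))) \<omega>"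
          using elim(1) by (simp add: V_def n_def)
        have "(1 - \<eta> / 2) * (sqrt (V * L) * u) - sqrt (V * L) * (1 / sqrt L) \<le> deviation (pairs (fact j)) \<omega>"
          using b1 b2 deviation_fact_split[of j \<omega>] by linarith
        moreover have "(1 - \<eta>) * sqrt (V * L) \<le> ((1 - \<eta> / 2) * u - 1 / sqrt L) * sqrt (V * L)"
          using elim(2) V L by (intro mult_right_mono) (auto simp: u_def L_def n_def)
        ultimately have "(1 - \<eta>) * sqrt (V * L) \<le> deviation (pairs (fact j)) \<omega>"
          by (simp add: algebra_simps)
        then show "(1 - \<eta>) * sqrt (p * (1 - p) * (fact j * (fact j - 1)) * ln (ln (fact j))) \<le> deviation (pairs (fact j)) \<omega>"
          by (simp add: V_def L_def n_def)
      qed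
    qed
    then show ?case using elim(1) by (rule frequently_mp)
  qed
qed

end

section \<open>The normalized logarithm\<close>

context nontrivial_random_graph
begin

definition scale :: "nat \<Rightarrow> real" where
  "scale n = sqrt (2 * (1 - p) / p) * sqrt (2 * ln (ln (real n)))"

definition normalized_log :: "nat \<Rightarrow> 'a \<Rightarrow> ereal" where
  "normalized_log n \<omega> = (ereal_log (num_ham_cycles (G \<omega>) n) - ereal (ln (fact (n - 1) / 2 * p ^ n))
    + ereal ((1 - p) / p)) / ereal (scale n)"

lemma measurable_normalized_log: "normalized_log n \<in> borel_measurable M"
proof -
  have "(\<lambda>\<omega>. real (num_ham_cycles (G \<omega>) n)) \<in> borel_measurable M \<longleftrightarrow>
      (\<lambda>\<omega>. real (num_ham_cycles (G \<omega> \<inter> pairs n) n)) \<in> borel_measurable M"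
  proof (rule measurable_cong)
    fix \<omega> assume "\<omega> \<in> space M"
    then have "induced_edges (G \<omega>) n = induced_edges (G \<omega> \<inter> pairs n) n"
      using edges_subset by (auto simp: induced_edges_def pairs_def vertex_pairs_def)
    then show "real (num_ham_cycles (G \<omega>) n) = real (num_ham_cycles (G \<omega> \<inter> pairs n) n)"
      by (simp add: num_ham_cycles_def)
  qed
  then have [measurable]: "(\<lambda>\<omega>. real (num_ham_cycles (G \<omega>) n)) \<in> borel_measurable M"
    using measurable_restrict[OF finite_pairs pairs_subset, of "\<lambda>E. real (num_ham_cycles E n)" n]
    by (rule iffD2)
  \<comment> \<open>Expressed through \<open>real k\<close>, whose measurability has just been
    established.\<close>
  have "ereal_log k = (if real k = 0 then - \<infinity> else ereal (ln (real k)))" for k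
    by (simp add: ereal_log_def)
  note this [simp]
  have "(\<lambda>\<omega>. if real (num_ham_cycles (G \<omega>) n) = 0 then - \<infinity>
      else ereal (ln (real (num_ham_cycles (G \<omega>) n)))) \<in> borel_measurable M"
    by measurable
  then have [measurable]: "(\<lambda>\<omega>. ereal_log (num_ham_cycles (G \<omega>) n)) \<in> borel_measurable M"
    by simp
  show ?thesis unfolding normalized_log_def[abs_def] by measurable
qed

lemma scale_pos: "exp 1 < real n \<Longrightarrow> 0 < scale n"
proof -
  assume n: "exp 1 < real n"
  have "0 < real n" using n exp_gt_zero[of 1] by linarith
  then have "1 < ln (real n)" using n ln_less_cancel_iff[of "exp 1" "real n"] by simp
  then show ?thesis using p_pos p_less_1 by (simp add: scale_def)
qed

lemma normalized_log_pos:
  assumes "0 < num_ham_cycles (G \<omega>) n" "0 < scale n"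
  shows "normalized_log n \<omega> = ereal ((ln (real (num_ham_cycles (G \<omega>) n)) - ln (fact (n - 1) / 2 * p ^ n)
    + (1 - p) / p) / scale n)"
  using assms by (simp add: normalized_log_def ereal_log_def)

lemma normalized_log_zero:
  assumes "num_ham_cycles (G \<omega>) n = 0" "0 < scale n"
  shows "normalized_log n \<omega> = - \<infinity>"
  using assms by (simp add: normalized_log_def ereal_log_def)

text \<open>\<open>slope n\<close> squared times the edge variance is
  \<open>2 * (1 - p) / p * n / (n - 1)\<close>. This is the origin of the constant
  \<open>2 * (1 - p) / p\<close> in the theorem.\<close>

lemma slope_sqrt:
  assumes n: "3 \<le> n"
  shows "slope n * sqrt (p * (1 - p) * (real n * (real n - 1)) * ln (ln (real n))) =
    scale n * sqrt (real n / (real n - 1))"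
proof -
  have m: "0 < real n - 1" "real (n - 1) = real n - 1" using n by (auto simp: of_nat_diff)
  have "slope n = sqrt ((2 / ((real n - 1) * p))\<^sup>2)" using m p_pos by (simp add: slope_def)
  then have "slope n * sqrt (p * (1 - p) * (real n * (real n - 1)) * ln (ln (real n))) =
      sqrt ((2 / ((real n - 1) * p))\<^sup>2 * (p * (1 - p) * (real n * (real n - 1)) * ln (ln (real n))))"
    by (simp only: real_sqrt_mult)
  also have "(2 / ((real n - 1) * p))\<^sup>2 * (p * (1 - p) * (real n * (real n - 1)) * ln (ln (real n))) =
      (2 * (1 - p) / p) * (2 * ln (ln (real n))) * (real n / (real n - 1))"
    using m(1) p_pos by (simp add: power2_eq_square divide_simps)
  finally show ?thesis by (simp only: scale_def real_sqrt_mult)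
qed

text \<open>Turns bounds for \<open>W\<close> and for the edge count into bounds for the logarithm,
  up to the additive \<open>ln 2\<close> inherited from \<open>card_ham_lists\<close>.\<close>

lemma ln_num_ham_cycles:
  assumes n: "3 \<le> n" and H: "0 < card (ham_lists (G \<omega>) n)"
  defines "Y \<equiv> ln (real (num_ham_cycles (G \<omega>) n)) - ln (fact (n - 1) / 2 * p ^ n)"
  shows "0 < num_ham_cycles (G \<omega>) n" "0 < W n \<omega>"
    "ln (W n \<omega>) + slope n * deviation (pairs n) \<omega> \<le> Y"
    "Y \<le> ln (W n \<omega>) + slope n * deviation (pairs n) \<omega> + ln 2"
proof -
  define x where "x = real (num_ham_cycles (G \<omega>) n)"
  define h where "h = real (card (ham_lists (G \<omega>) n))"
  have "real (n * num_ham_cycles (G \<omega>) n) \<le> h" "h \<le> real (2 * n * num_ham_cycles (G \<omega>) n)"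
    unfolding h_def using card_ham_lists[OF n, of "G \<omega>"] by (intro of_nat_mono; simp)+
  then have hx: "n * x \<le> h" "h \<le> 2 * n * x" by (simp_all add: x_def)
  have h0: "0 < h" using H by (simp add: h_def)
  have n0: "0 < real n" using n by simp
  have "0 < 2 * n * x" using hx(2) h0 by linarith
  then have x0: "0 < x" using n0 by (simp add: zero_less_mult_iff)
  then show "0 < num_ham_cycles (G \<omega>) n" by (simp add: x_def)
  have W: "W n \<omega> = h / (fact n * p ^ n) * exp (- (slope n * deviation (pairs n) \<omega>))"
    by (simp add: W_def h_def)
  then show "0 < W n \<omega>" using h0 p_pos by simp
  have "ln (W n \<omega>) = ln h - ln (fact n * p ^ n) - slope n * deviation (pairs n) \<omega>"
    using h0 p_pos unfolding W by (simp add: ln_mult ln_div)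
  moreover have "fact n * p ^ n = 2 * n * (fact (n - 1) / 2 * p ^ n)"
    using n by (simp add: fact_reduce[of n])
  then have "ln (fact n * p ^ n) = ln 2 + ln (real n) + ln (fact (n - 1) / 2 * p ^ n)"
    using n0 p_pos by (simp only: ln_mult) (simp add: ln_mult ln_div)
  ultimately have lnW: "ln (W n \<omega>) + slope n * deviation (pairs n) \<omega> =
      ln h - ln 2 - ln (real n) - ln (fact (n - 1) / 2 * p ^ n)" by linarith
  have "ln (n * x) \<le> ln h" "ln h \<le> ln (2 * n * x)" using hx h0 x0 n0 by (simp_all)
  then have "ln (real n) + ln x \<le> ln h" "ln h \<le> ln 2 + ln (real n) + ln x"
    using n0 x0 by (simp_all add: ln_mult)
  then show "ln (W n \<omega>) + slope n * deviation (pairs n) \<omega> \<le> Y"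
    "Y \<le> ln (W n \<omega>) + slope n * deviation (pairs n) \<omega> + ln 2"
    unfolding lnW Y_def x_def by linarith+
qed

lemma normalized_log_upper:
  assumes \<epsilon>: "0 < \<epsilon>"
  shows "AE \<omega> in M. \<forall>\<^sub>F n in sequentially. normalized_log n \<omega> \<le> ereal (1 + \<epsilon>)"
proof -
  define \<sigma> where "\<sigma> = sqrt (2 * (1 - p) / p) * sqrt 2"
  have \<sigma>: "0 < \<sigma>" using p_pos p_less_1 by (simp add: \<sigma>_def)
  define s where "s = (1 - p) / p"
  \<comment> \<open>One \<open>\<delta>\<close> is spent on \<open>W\<close> and one on the edge
    count, so the limit \<open>1 + 2 * \<delta>\<close> stays below \<open>1 + \<epsilon>\<close>;
    \<open>ln 2\<close> and \<open>s\<close> vanish after division by the scale.\<close>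
  define \<delta> where "\<delta> = \<epsilon> / 4"
  have \<delta>: "0 < \<delta>" "0 < \<delta> * \<sigma>" using \<epsilon> \<sigma> by (auto simp: \<delta>_def)
  have lim: "((\<lambda>n. \<delta> + (1 + \<delta>) * sqrt (real n / (real n - 1)) + (ln 2 + s) / (\<sigma> * sqrt (ln (ln (real n)))))
      \<longlongrightarrow> \<delta> + (1 + \<delta>) * 1 + 0) sequentially"
    by (intro tendsto_intros) (use \<sigma> in real_asymp)+
  have "\<delta> + (1 + \<delta>) * 1 + 0 < 1 + \<epsilon>" using \<epsilon> by (simp add: \<delta>_def)
  from order_tendstoD(2)[OF lim this]
  have ev: "\<forall>\<^sub>F n in sequentially. \<delta> + (1 + \<delta>) * sqrt (real n / (real n - 1))
      + (ln 2 + s) / (\<sigma> * sqrt (ln (ln (real n)))) < 1 + \<epsilon>" .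
  show ?thesis using W_upper[OF \<delta>(2)] deviation_upper[OF \<delta>(1)]
  proof eventually_elim
    case (elim \<omega>)
    then show ?case using ev eventually_ge_at_top[of 3]
    proof eventually_elim
      case (elim n)
      have n: "3 \<le> n" by fact
      have e: "exp 1 < real n" using e_less_272 n by linarith
      have sc: "0 < scale n" using e by (rule scale_pos)
      have scale: "scale n = \<sigma> * sqrt (ln (ln (real n)))" by (simp add: scale_def \<sigma>_def real_sqrt_mult)
      show ?case
      proof (cases "card (ham_lists (G \<omega>) n) = 0")
        \<comment> \<open>Without Hamiltonian cycles the value is minus infinity, and the upper
          bound is trivial.\<close>
        case True
        then have "num_ham_cycles (G \<omega>) n = 0" using card_ham_lists(1)[OF n, of "G \<omega>"] n by simp
        then show ?thesis using sc by (simp add: normalized_log_zero)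
      next
        case False
        then have H: "0 < card (ham_lists (G \<omega>) n)" by simp
        note Y = ln_num_ham_cycles[OF n H]
        have "ln (W n \<omega>) < ln (exp (\<delta> * \<sigma> * sqrt (ln (ln (real n)))))"
          using elim(1) Y(2) by (subst ln_less_cancel_iff) auto
        then have 1: "ln (W n \<omega>) \<le> \<delta> * scale n" by (simp add: scale mult.assoc)
        have "slope n * deviation (pairs n) \<omega> \<le>
            slope n * ((1 + \<delta>) * sqrt (p * (1 - p) * (real n * (real n - 1)) * ln (ln (real n))))"
          using elim(2) p_pos by (intro mult_left_mono) (auto simp: slope_def)
        also have "\<dots> = (1 + \<delta>) * (scale n * sqrt (real n / (real n - 1)))"
          unfolding slope_sqrt[OF n, symmetric] by simp
        finally have 2: "slope n * deviation (pairs n) \<omega> \<le> (1 + \<delta>) * (scale n * sqrt (real n / (real n - 1)))" .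
        have "ln (real (num_ham_cycles (G \<omega>) n)) - ln (fact (n - 1) / 2 * p ^ n) + s \<le>
            \<delta> * scale n + (1 + \<delta>) * (scale n * sqrt (real n / (real n - 1))) + (ln 2 + s)"
          using Y(4) 1 2 by linarith
        then have "(ln (real (num_ham_cycles (G \<omega>) n)) - ln (fact (n - 1) / 2 * p ^ n) + s) / scale n \<le>
            (\<delta> * scale n + (1 + \<delta>) * (scale n * sqrt (real n / (real n - 1))) + (ln 2 + s)) / scale n"
          using sc by (intro divide_right_mono) auto
        also have "\<dots> = \<delta> + (1 + \<delta>) * sqrt (real n / (real n - 1)) + (ln 2 + s) / scale n"
          using sc by (simp add: add_divide_distrib)
        also have "\<dots> \<le> 1 + \<epsilon>" using elim(3) unfolding scale by simp
        finally show ?thesis using normalized_log_pos[OF Y(1) sc] by (simp add: s_def)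
      qed
    qed
  qed
qed

text \<open>Both ingredients hold along factorials, which is enough for infinitely many
  \<open>n\<close>. The bound \<open>c \<le> W\<close> also guarantees that a Hamiltonian cycle
  exists there, so the logarithm is finite.\<close>

lemma normalized_log_lower:
  assumes \<epsilon>: "0 < \<epsilon>" "\<epsilon> < 1"
  shows "AE \<omega> in M. \<exists>\<^sub>F n in sequentially. ereal (1 - \<epsilon>) \<le> normalized_log n \<omega>"
proof -
  define s where "s = (1 - p) / p"
  define \<sigma> where "\<sigma> = sqrt (2 * (1 - p) / p) * sqrt 2"
  have \<sigma>: "0 < \<sigma>" using p_pos p_less_1 by (simp add: \<sigma>_def)
  obtain c where c: "0 < c" "AE \<omega> in M. \<forall>\<^sub>F j in sequentially. c \<le> W (fact j) \<omega>"
    using W_lower by blast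
  have \<delta>: "0 < \<epsilon> / 2" "\<epsilon> / 2 < 1" using \<epsilon> by auto
  have "((\<lambda>x::real. (ln c + s) / (\<sigma> * sqrt (ln (ln x)))) \<longlongrightarrow> 0) at_top" using \<sigma> by real_asymp
  then have "\<forall>\<^sub>F x in at_top. - (\<epsilon> / 2) < (ln c + s) / (\<sigma> * sqrt (ln (ln x)))"
    using \<epsilon> by (intro order_tendstoD) auto
  then have ev: "\<forall>\<^sub>F j in sequentially. - (\<epsilon> / 2) < (ln c + s) / (\<sigma> * sqrt (ln (ln (fact j))))"
    using filterlim_fact by (rule eventually_compose_filterlim)
  have fact_lim: "filterlim (fact :: nat \<Rightarrow> nat) at_top sequentially"
    by (rule filterlim_at_top_mono[OF filterlim_ident]) (simp add: fact_ge_self)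
  show ?thesis using deviation_lower[OF \<delta>] c(2)
  proof eventually_elim
    case (elim \<omega>)
    have "\<forall>\<^sub>F j in sequentially.
        (1 - \<epsilon> / 2) * sqrt (p * (1 - p) * (fact j * (fact j - 1)) * ln (ln (fact j))) \<le> deviation (pairs (fact j)) \<omega>
        \<longrightarrow> ereal (1 - \<epsilon>) \<le> normalized_log (fact j) \<omega>"
      using elim(2) ev eventually_compose_filterlim[OF eventually_ge_at_top[of 3] fact_lim]
    proof eventually_elim
      case (elim j)
      define n where "n = (fact j :: nat)"
      have nf: "real n = fact j" by (simp add: n_def)
      have n: "3 \<le> n" using elim(3) by (simp add: n_def)
      have e: "exp 1 < real n" using e_less_272 n by linarith
      have sc: "0 < scale n" using e by (rule scale_pos)
      have scale: "scale n = \<sigma> * sqrt (ln (ln (real n)))" by (simp add: scale_def \<sigma>_def real_sqrt_mult)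
      show ?case
      proof
        assume "(1 - \<epsilon> / 2) * sqrt (p * (1 - p) * (fact j * (fact j - 1)) * ln (ln (fact j))) \<le> deviation (pairs (fact j)) \<omega>"
        then have dev: "(1 - \<epsilon> / 2) * sqrt (p * (1 - p) * (real n * (real n - 1)) * ln (ln (real n))) \<le> deviation (pairs n) \<omega>"
          by (simp add: n_def)
        have Wc: "c \<le> W n \<omega>" using elim(1) by (simp add: n_def)
        have "card (ham_lists (G \<omega>) n) \<noteq> 0"
        proof
          assume "card (ham_lists (G \<omega>) n) = 0"
          then have "W n \<omega> = 0" by (simp add: W_def)
          then show False using Wc c(1) by simp
        qed
        then have H: "0 < card (ham_lists (G \<omega>) n)" by simp
        note Y = ln_num_ham_cycles[OF n H]
        have 1: "ln c \<le> ln (W n \<omega>)" using Wc c(1) Y(2) by simp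
        have "1 \<le> sqrt (real n / (real n - 1))" using n by simp
        then have "(1 - \<epsilon> / 2) * scale n * 1 \<le> (1 - \<epsilon> / 2) * scale n * sqrt (real n / (real n - 1))"
          using sc \<epsilon> by (intro mult_left_mono) auto
        also have "\<dots> = slope n * ((1 - \<epsilon> / 2) * sqrt (p * (1 - p) * (real n * (real n - 1)) * ln (ln (real n))))"
          using slope_sqrt[OF n] by (simp only: mult.left_commute[of "slope n"] mult.assoc)
        also have "\<dots> \<le> slope n * deviation (pairs n) \<omega>"
          using dev p_pos by (intro mult_left_mono) (auto simp: slope_def)
        finally have 2: "(1 - \<epsilon> / 2) * scale n \<le> slope n * deviation (pairs n) \<omega>" by simp
        have "1 - \<epsilon> = 1 - \<epsilon> / 2 + - (\<epsilon> / 2)" by simp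
        also have "\<dots> \<le> 1 - \<epsilon> / 2 + (ln c + s) / scale n"
          using elim(2) unfolding scale nf by simp
        also have "\<dots> = ((1 - \<epsilon> / 2) * scale n + (ln c + s)) / scale n"
          using sc by (simp add: add_divide_distrib)
        also have "\<dots> \<le> (ln (real (num_ham_cycles (G \<omega>) n)) - ln (fact (n - 1) / 2 * p ^ n) + s) / scale n"
          using sc Y(3) 1 2 by (intro divide_right_mono) auto
        finally show "ereal (1 - \<epsilon>) \<le> normalized_log (fact j) \<omega>"
          using normalized_log_pos[OF Y(1) sc] by (simp add: s_def n_def)
      qed
    qed
    then have "\<exists>\<^sub>F j in sequentially. ereal (1 - \<epsilon>) \<le> normalized_log (fact j) \<omega>"
      using elim(1) by (rule frequently_mp)
    then show ?case
      unfolding frequently_def using eventually_compose_filterlim[OF _ fact_lim] by blast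
  qed
qed

theorem limsup_normalized_log: "AE \<omega> in M. limsup (\<lambda>n. normalized_log n \<omega>) = 1"
proof -
  \<comment> \<open>Countably many \<open>\<epsilon>\<close> keep the exceptional set null; the
    offset 2 keeps them below 1, as \<open>normalized_log_lower\<close> demands.\<close>
  have "AE \<omega> in M. \<forall>i. \<forall>\<^sub>F n in sequentially. normalized_log n \<omega> \<le> ereal (1 + 1 / (real i + 2))"
    unfolding AE_all_countable by (intro allI normalized_log_upper) simp
  moreover have "AE \<omega> in M. \<forall>i. \<exists>\<^sub>F n in sequentially. ereal (1 - 1 / (real i + 2)) \<le> normalized_log n \<omega>"
    unfolding AE_all_countable by (intro allI normalized_log_lower) auto
  ultimately show ?thesis
  proof eventually_elim
    case (elim \<omega>)
    let ?l = "limsup (\<lambda>n. normalized_log n \<omega>)"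
    have u: "?l \<le> ereal (1 + 1 / (real i + 2))" for i using elim(1) by (intro Limsup_bounded) auto
    have "(\<lambda>i. ereal (1 + 1 / (real i + 2))) \<longlonglongrightarrow> ereal 1"
      unfolding lim_ereal by real_asymp
    then have "?l \<le> ereal 1" by (rule LIMSEQ_le_const) (use u in blast)
    have l: "ereal (1 - 1 / (real i + 2)) \<le> ?l" for i
    proof (rule ccontr)
      assume "\<not> ereal (1 - 1 / (real i + 2)) \<le> ?l"
      then have "?l < ereal (1 - 1 / (real i + 2))" by simp
      then have "\<forall>\<^sub>F n in sequentially. normalized_log n \<omega> < ereal (1 - 1 / (real i + 2))"
        by (rule Limsup_lessD)
      then show False using elim(2) by (auto simp: frequently_def not_le)
    qed
    have "(\<lambda>i. ereal (1 - 1 / (real i + 2))) \<longlonglongrightarrow> ereal 1"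
      unfolding lim_ereal by real_asymp
    then have "ereal 1 \<le> ?l" by (rule LIMSEQ_le_const2) (use l in blast)
    with \<open>?l \<le> ereal 1\<close> show ?case unfolding one_ereal_def by (rule antisym)
  qed
qed

end

theorem theorem1p5:
  fixes M :: "'a measure" and p :: real and G :: "'a \<Rightarrow> nat set set"
    and X :: "nat \<Rightarrow> 'a \<Rightarrow> nat" and Y :: "nat \<Rightarrow> 'a \<Rightarrow> ereal"
  assumes "0 < p" and "p < 1"
    and "random_graph M p G"
  defines "X \<equiv> (\<lambda>n \<omega>. num_ham_cycles (G \<omega>) n)"
    and "Y \<equiv> (\<lambda>n \<omega>. ereal_log (X n \<omega>))"
  shows "\<P>(\<omega> in M. limsup (\<lambda>n.
      (Y n \<omega> - ereal (ln (fact (n - 1) / 2 * p ^ n)) + ereal ((1 - p) / p))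
        / ereal (sqrt (2 * (1 - p) / p) * sqrt (2 * ln (ln (real n))))) = 1) = 1"
proof -
  interpret nontrivial_random_graph M p G
    using assms(1-3) by (simp add: nontrivial_random_graph_def nontrivial_random_graph_axioms_def)
  have eq: "(Y n \<omega> - ereal (ln (fact (n - 1) / 2 * p ^ n)) + ereal ((1 - p) / p))
      / ereal (sqrt (2 * (1 - p) / p) * sqrt (2 * ln (ln (real n)))) = normalized_log n \<omega>" for n \<omega>
    by (simp add: normalized_log_def scale_def X_def Y_def)
  have [measurable]: "normalized_log n \<in> borel_measurable M" for n by (rule measurable_normalized_log)
  have "{\<omega> \<in> space M. limsup (\<lambda>n. normalized_log n \<omega>) = 1} \<in> events" by measurable
  then show ?thesis unfolding eq using limsup_normalized_log by (simp add: prob_Collect_eq_1)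
qed

end
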